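(* Let $E$ be a finite-dimensional vector space over a complete ultrametric field $\mathbb{K}$ and let $\alpha\colon E\to E$ be a linear self-map. Then, for each $a\in(0,\infty)$, $E$ admits an $a$-centre-stable subspace with respect to $\alpha$ and an $a$-centre subspace with respect to $\alpha$. Moreover, for each $a\in(0,\infty)$, $\alpha$ is $a$-hyperbolic if and only if $a\notin R(\alpha)$.
   Context: A complete ultrametric field $(\mathbb{K},|\cdot|)$ is a field with an absolute value satisfying $|x+y|\le\max\{|x|,|y|\}$ whose metric is complete and defines a non-discrete topology. A norm $\|\cdot\|$ on a $\mathbb{K}$-vector space is ultrametric if $\|x+y\|\le\max\{\|x\|,\|y\|\}$. A finite-dimensional $\mathbb{K}$-vector space carries its canonical (Hausdorff vector) topology. A subspace $F$ is $\alpha$-invariant if $\alpha(F)\subseteq F$. Operator norms are taken with respect to the given norm $\|\cdot\|$, and $\frac10:=\infty$. $R(\alpha)\subseteq[0,\infty)$: the set of all $|\lambda|$, where $\lambda$ runs through the eigenvalues of $\alpha\otimes_{\mathbb{K}}\mathrm{id}_{\overline{\mathbb{K}}}$ in an algebraic closure $\overline{\mathbb{K}}$ of $\mathbb{K}$, and $|\cdot|$ also denotes the unique extension of $|\cdot|$ to an absolute value on $\overline{\mathbb{K}}$. Let $a\in(0,\infty)$. (1) $\alpha$ is $a$-hyperbolic if there are $\alpha$-invariant subspaces $E_{a,s},E_{a,u}$ with $E=E_{a,s}\oplus E_{a,u}$ and an ultrametric norm $\|\cdot\|$ on $E$ defining its topology such that: $\|x+y\|=\max\{\|x\|,\|y\|\}$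 for all $x\in E_{a,s}$, $y\in E_{a,u}$; $\alpha_2:=\alpha|_{E_{a,u}}\colon E_{a,u}\to E_{a,u}$ is invertible; and $\|\alpha|_{E_{a,s}}\|<a$ and $\frac{1}{\|\alpha_2^{-1}\|}>a$. (2) An $\alpha$-invariant subspace $E_{a,cs}\subseteq E$ is an $a$-centre-stable subspace if there is an $\alpha$-invariant subspace $E_{a,u}$ with $E=E_{a,cs}\oplus E_{a,u}$, $\alpha_2:=\alpha|_{E_{a,u}}\colon E_{a,u}\to E_{a,u}$ invertible, and an ultrametric norm $\|\cdot\|$ on $E$ defining its topology such that $\|x+y\|=\max\{\|x\|,\|y\|\}$ for all $x\in E_{a,cs}$, $y\in E_{a,u}$, and $\|\alpha|_{E_{a,cs}}\|\le a$ and $\frac{1}{\|\alpha_2^{-1}\|}>a$. (3) An $\alpha$-invariant subspace $E_{a,c}\subseteq E$ is an $a$-centre subspace if there are $\alpha$-invariant subspaces $E_{a,s},E_{a,u}$ with $E=E_{a,s}\oplus E_{a,c}\oplus E_{a,u}$ and an ultrametric norm $\|\cdot\|$ on $E$ defining its topology such that: $\|x+y+z\|=\max\{\|x\|,\|y\|,\|z\|\}$ for all $x\in E_{a,s}$, $y\in E_{a,c}$, $z\in E_{a,u}$; $\|\alpha(x)\|=a\|x\|$ for all $x\in E_{a,c}$; $\alpha_3:=\alpha|_{E_{a,u}}\colon E_{a,u}\to E_{a,u}$ is invertible; and $\|\alpha|_{E_{a,s}}\|<a$ and $\frac{1}{\|\alpha_3^{-1}\|}>a$. *)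

theory Defs
  imports "HOL-Analysis.Analysis" "HOL-Algebra.Algebraic_Closure_Type" "HOL-Library.Poly_Mapping"
begin

section \<open>Complete ultrametric fields\<close>

locale absolute_value =
  fixes av :: "'k::field \<Rightarrow> real"
  assumes av_nonneg: "0 \<le> av x"
    and av_eq_0_iff: "av x = 0 \<longleftrightarrow> x = 0"
    and av_mult: "av (x * y) = av x * av y"
    and av_triangle: "av (x + y) \<le> av x + av y"

definition av_topology :: "('k::field \<Rightarrow> real) \<Rightarrow> 'k topology" where
  "av_topology av = Metric_space.mtopology UNIV (\<lambda>x y. av (x - y))"

locale complete_ultrametric_field = absolute_value av
  for av :: "'k::field \<Rightarrow> real" +
  assumes av_ultrametric: "av (x + y) \<le> max (av x) (av y)"
    and av_complete: "Metric_space.mcomplete UNIV (\<lambda>x y. av (x - y))"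
    and av_nondiscrete: "av_topology av \<noteq> discrete_topology UNIV"

text \<open>The extension to the algebraic closure exists and is unique when \<open>av\<close> is a complete
  ultrametric absolute value.\<close>

definition av_closure :: "('k::field \<Rightarrow> real) \<Rightarrow> 'k alg_closure \<Rightarrow> real" where
  "av_closure av = (THE w. absolute_value w \<and> (\<forall>x. w (to_ac x) = av x))"


section \<open>Norms and the canonical topology\<close>

definition hausdorff_vector_topology ::
  "('k::field \<Rightarrow> real) \<Rightarrow> ('k \<Rightarrow> 'e::ab_group_add \<Rightarrow> 'e) \<Rightarrow> 'e topology \<Rightarrow> bool" where
  "hausdorff_vector_topology av scl T \<longleftrightarrow>
     topspace T = UNIV \<and> Hausdorff_space T \<and>
     continuous_map (prod_topology T T) T (\<lambda>(x, y). x + y) \<and>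
     continuous_map (prod_topology (av_topology av) T) T (\<lambda>(c, x). scl c x)"

text \<open>A finite-dimensional vector space over a complete ultrametric field has exactly one
  Hausdorff vector topology.\<close>

definition canonical_topology ::
  "('k::field \<Rightarrow> real) \<Rightarrow> ('k \<Rightarrow> 'e::ab_group_add \<Rightarrow> 'e) \<Rightarrow> 'e topology" where
  "canonical_topology av scl = (THE T. hausdorff_vector_topology av scl T)"

locale ultrametric_norm =
  fixes av :: "'k::field \<Rightarrow> real"
    and scl :: "'k \<Rightarrow> 'e::ab_group_add \<Rightarrow> 'e"
    and N :: "'e \<Rightarrow> real"
  assumes N_nonneg: "0 \<le> N x"
    and N_eq_0_iff: "N x = 0 \<longleftrightarrow> x = 0"
    and N_scale: "N (scl c x) = av c * N x"
    and N_ultrametric: "N (x + y) \<le> max (N x) (N y)"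

definition defining_norm ::
  "('k::field \<Rightarrow> real) \<Rightarrow> ('k \<Rightarrow> 'e::ab_group_add \<Rightarrow> 'e) \<Rightarrow> ('e \<Rightarrow> real) \<Rightarrow> bool" where
  "defining_norm av scl N \<longleftrightarrow> ultrametric_norm av scl N \<and>
     Metric_space.mtopology UNIV (\<lambda>x y. N (x - y)) = canonical_topology av scl"

text \<open>Operator norm of a map restricted to the subspace \<open>F\<close>. In \<^typ>\<open>ennreal\<close> the supremum of the
  empty set is \<open>0\<close> (the case \<open>F = {0}\<close>) and \<open>1 / 0 = \<infinity>\<close>.\<close>

definition op_norm :: "('e::ab_group_add \<Rightarrow> real) \<Rightarrow> 'e set \<Rightarrow> ('e \<Rightarrow> 'e) \<Rightarrow> ennreal" where
  "op_norm N F f = (SUP x \<in> F - {0}. ennreal (N (f x) / N x))"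


section \<open>Hyperbolicity, centre-stable and centre subspaces\<close>

definition invariant_subspace ::
  "('k::field \<Rightarrow> 'e::ab_group_add \<Rightarrow> 'e) \<Rightarrow> ('e \<Rightarrow> 'e) \<Rightarrow> 'e set \<Rightarrow> bool" where
  "invariant_subspace scl \<alpha> F \<longleftrightarrow> module.subspace scl F \<and> \<alpha> ` F \<subseteq> F"

definition direct_sum2 :: "'e::ab_group_add set \<Rightarrow> 'e set \<Rightarrow> bool" where
  "direct_sum2 S U \<longleftrightarrow> bij_betw (\<lambda>(x, y). x + y) (S \<times> U) UNIV"

definition direct_sum3 :: "'e::ab_group_add set \<Rightarrow> 'e set \<Rightarrow> 'e set \<Rightarrow> bool" where
  "direct_sum3 S C U \<longleftrightarrow> bij_betw (\<lambda>(x, y, z). x + y + z) (S \<times> C \<times> U) UNIV"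

definition hyperbolic ::
  "('k::field \<Rightarrow> real) \<Rightarrow> ('k \<Rightarrow> 'e::ab_group_add \<Rightarrow> 'e) \<Rightarrow> ('e \<Rightarrow> 'e) \<Rightarrow> real \<Rightarrow> bool" where
  "hyperbolic av scl \<alpha> a \<longleftrightarrow>
     (\<exists>Es Eu N. invariant_subspace scl \<alpha> Es \<and> invariant_subspace scl \<alpha> Eu \<and>
        direct_sum2 Es Eu \<and> defining_norm av scl N \<and>
        (\<forall>x\<in>Es. \<forall>y\<in>Eu. N (x + y) = max (N x) (N y)) \<and>
        bij_betw \<alpha> Eu Eu \<and>
        op_norm N Es \<alpha> < ennreal a \<and>
        1 / op_norm N Eu (inv_into Eu \<alpha>) > ennreal a)"

definition centre_stable_subspace ::
  "('k::field \<Rightarrow> real) \<Rightarrow> ('k \<Rightarrow> 'e::ab_group_add \<Rightarrow> 'e) \<Rightarrow> ('e \<Rightarrow> 'e) \<Rightarrow> real \<Rightarrow> 'e set \<Rightarrow> bool" where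
  "centre_stable_subspace av scl \<alpha> a Ecs \<longleftrightarrow>
     invariant_subspace scl \<alpha> Ecs \<and>
     (\<exists>Eu N. invariant_subspace scl \<alpha> Eu \<and>
        direct_sum2 Ecs Eu \<and> bij_betw \<alpha> Eu Eu \<and> defining_norm av scl N \<and>
        (\<forall>x\<in>Ecs. \<forall>y\<in>Eu. N (x + y) = max (N x) (N y)) \<and>
        op_norm N Ecs \<alpha> \<le> ennreal a \<and>
        1 / op_norm N Eu (inv_into Eu \<alpha>) > ennreal a)"

definition centre_subspace ::
  "('k::field \<Rightarrow> real) \<Rightarrow> ('k \<Rightarrow> 'e::ab_group_add \<Rightarrow> 'e) \<Rightarrow> ('e \<Rightarrow> 'e) \<Rightarrow> real \<Rightarrow> 'e set \<Rightarrow> bool" where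
  "centre_subspace av scl \<alpha> a Ec \<longleftrightarrow>
     invariant_subspace scl \<alpha> Ec \<and>
     (\<exists>Es Eu N. invariant_subspace scl \<alpha> Es \<and> invariant_subspace scl \<alpha> Eu \<and>
        direct_sum3 Es Ec Eu \<and> defining_norm av scl N \<and>
        (\<forall>x\<in>Es. \<forall>y\<in>Ec. \<forall>z\<in>Eu. N (x + y + z) = max (N x) (max (N y) (N z))) \<and>
        (\<forall>x\<in>Ec. N (\<alpha> x) = a * N x) \<and>
        bij_betw \<alpha> Eu Eu \<and>
        op_norm N Es \<alpha> < ennreal a \<and>
        1 / op_norm N Eu (inv_into Eu \<alpha>) > ennreal a)"


section \<open>Eigenvalues over the algebraic closure\<close>

text \<open>The tensor product of \<open>E\<close> with the algebraic closure over \<open>K\<close> is the quotient of the free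
  abelian group on pairs \<open>(x, l)\<close> by the subgroup \<open>tensor_relations scl\<close>; a pair \<open>(x, l)\<close>
  represents the pure tensor of \<open>x\<close> and \<open>l\<close>.\<close>

inductive_set tensor_relations ::
  "('k::field \<Rightarrow> 'e::ab_group_add \<Rightarrow> 'e) \<Rightarrow> (('e \<times> 'k alg_closure) \<Rightarrow>\<^sub>0 int) set"
  for scl :: "'k::field \<Rightarrow> 'e::ab_group_add \<Rightarrow> 'e" where
  zero: "0 \<in> tensor_relations scl"
| diff: "s \<in> tensor_relations scl \<Longrightarrow> t \<in> tensor_relations scl \<Longrightarrow>
    s - t \<in> tensor_relations scl"
| add_left: "frag_of (x + y, l) - (frag_of (x, l) + frag_of (y, l)) \<in> tensor_relations scl"
| add_right: "frag_of (x, l + m) - (frag_of (x, l) + frag_of (x, m)) \<in> tensor_relations scl"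
| balanced: "frag_of (scl c x, l) - frag_of (x, to_ac c * l) \<in> tensor_relations scl"

text \<open>The next two maps preserve \<open>tensor_relations scl\<close> (the first one for linear \<open>\<alpha>\<close>); on the
  quotient they induce \<open>\<alpha> \<otimes> id\<close> and multiplication by the scalar \<open>m\<close>.\<close>

definition tensor_id ::
  "('e \<Rightarrow> 'e) \<Rightarrow> (('e \<times> 'k::field alg_closure) \<Rightarrow>\<^sub>0 int) \<Rightarrow> (('e \<times> 'k alg_closure) \<Rightarrow>\<^sub>0 int)" where
  "tensor_id \<alpha> = frag_extend (\<lambda>(x, l). frag_of (\<alpha> x, l))"

definition tensor_scale ::
  "'k::field alg_closure \<Rightarrow> (('e \<times> 'k alg_closure) \<Rightarrow>\<^sub>0 int) \<Rightarrow> (('e \<times> 'k alg_closure) \<Rightarrow>\<^sub>0 int)" where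
  "tensor_scale m = frag_extend (\<lambda>(x, l). frag_of (x, m * l))"

text \<open>An eigenvector is a nonzero class, given by a representative \<open>t\<close>.\<close>

definition closure_eigenvalue ::
  "('k::field \<Rightarrow> 'e::ab_group_add \<Rightarrow> 'e) \<Rightarrow> ('e \<Rightarrow> 'e) \<Rightarrow> 'k alg_closure \<Rightarrow> bool" where
  "closure_eigenvalue scl \<alpha> m \<longleftrightarrow>
     (\<exists>t. t \<notin> tensor_relations scl \<and>
          tensor_id \<alpha> t - tensor_scale m t \<in> tensor_relations scl)"

definition R_set ::
  "('k::field \<Rightarrow> real) \<Rightarrow> ('k \<Rightarrow> 'e::ab_group_add \<Rightarrow> 'e) \<Rightarrow> ('e \<Rightarrow> 'e) \<Rightarrow> real set" where
  "R_set av scl \<alpha> = {av_closure av m | m. closure_eigenvalue scl \<alpha> m}"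

end

theory Submission
  imports Defs
begin

text \<open>
  By Hensel's lemma a monic polynomial over \<open>K\<close> with nonzero constant coefficient either factors
  or is flat: its Newton polygon is a single segment, so that \<open>\<bar>c\<^sub>i\<bar> \<le> r\<^bsup>d - i\<^esup>\<close> and
  \<open>\<bar>c\<^sub>0\<bar> = r\<^bsup>d\<^esup>\<close> for some radius \<open>r\<close>. If a flat polynomial of radius \<open>r\<close> annihilates an operator
  \<open>\<alpha>\<close>, then \<open>M(x) = max {N(\<alpha>\<^sup>i x) / r\<^sup>i | i < d}\<close> is a norm with \<open>M(\<alpha> x) = r M(x)\<close>.

  Applied to multiplication operators on the algebraic closure, these norms give the extension of
  the absolute value: an algebraic \<open>z\<close> gets the radius of a flat polynomial with root \<open>z\<close>,
  and a norm adapted to both \<open>y\<close> and \<open>z\<close> yields multiplicativity and the ultrametric inequality.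
  Applied to \<open>\<alpha>\<close> itself, a factorization of an annihilating polynomial by slopes splits \<open>E\<close> into
  kernels carrying the required norms. That every ultrametric norm defines the canonical topology is
  the uniqueness of Hausdorff vector topologies in finite dimension.
\<close>

section \<open>Hensel factorization\<close>

text \<open>The radii are arbitrary positive reals and need not be absolute values of scalars, so
  polynomials cannot simply be rescaled and reduced modulo the maximal ideal; Hensel's lemma is run
  on weighted Gauss norms with a contraction factor \<theta> < 1. Irreducibility enters through
  least degree: a polynomial of least degree with a suitable property does not factor, hence is
  flat. The recurring tool is a comparison of rates: a nonzero vector killed by a polynomial with
  roots of size at most b cannot be expanded by c > b along its orbit, and dually. It makes the
  radius of an algebraic element unique, separates kernels of different slopes without Bezout
  relations, and matches eigenvalues with the behaviour of norms. The closure may have infinite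
  dimension over K, so this comparison is made without a dimension bound. For the converse direction
  an eigenvector is needed in the tensor product. It comes from dividing a polynomial by X - m, and
  a coordinate functional shows that its class is nonzero.\<close>

context complete_ultrametric_field
begin

section \<open>Ultrametric absolute values and limits\<close>

lemma av_0 [simp]: "av 0 = 0"
  by (simp add: av_eq_0_iff)

lemma av_1 [simp]: "av 1 = 1"
proof -
  have "av 1 * av 1 = av 1 * 1"
    using av_mult[of 1 1] by simp
  then show ?thesis
    using av_eq_0_iff[of 1] by (simp only: mult_cancel_left) simp
qed

lemma av_minus [simp]: "av (- x) = av x"
proof -
  have "av (-1) * av (-1) = 1"
    using av_mult[of "-1" "-1"] by simp
  then have "av (-1) = 1"
    using av_nonneg[of "-1"] by (metis abs_1 abs_mult_self_eq abs_of_nonneg power2_eq_iff power2_eq_square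
        real_sqrt_unique real_sqrt_one)
  then show ?thesis
    using av_mult[of "-1" x] by simp
qed

lemma av_minus_commute: "av (x - y) = av (y - x)"
  using av_minus[of "x - y"] by simp

lemma av_power: "av (x ^ n) = av x ^ n"
  by (induction n) (auto simp: av_mult)

lemma av_pos: "x \<noteq> 0 \<Longrightarrow> 0 < av x"
  using av_nonneg[of x] av_eq_0_iff[of x] by linarith

lemma av_inverse: "av (inverse x) = inverse (av x)"
proof (cases "x = 0")
  case False
  then have "av (inverse x) * av x = 1"
    using av_mult[of "inverse x" x] by simp
  then show ?thesis
    by (metis inverse_unique mult.commute)
qed auto

lemma av_sum_le:
  assumes "0 \<le> C" "\<And>i. i \<in> S \<Longrightarrow> av (f i) \<le> C"
  shows "av (sum f S) \<le> C"
  using assms(2)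
proof (induction S rule: infinite_finite_induct)
  case (insert x F)
  have "av (f x + sum f F) \<le> max (av (f x)) (av (sum f F))"
    by (rule av_ultrametric)
  also have "\<dots> \<le> C"
    using insert by auto
  finally show ?case
    using insert by simp
qed (use assms(1) in auto)

lemma Metric_space_av: "Metric_space UNIV (\<lambda>x y. av (x - y))"
proof
  fix x y z
  show "av (x - z) \<le> av (x - y) + av (y - z)"
    using av_triangle[of "x - y" "y - z"] by simp
qed (auto simp: av_nonneg av_eq_0_iff intro: av_minus_commute)

text \<open>Completeness of the field enters only here. By the ultrametric inequality a tail is
  bounded by its largest step, so the limit is within \<open>C * \<theta> ^ n\<close> of the n-th
  term, without the extra factor of a geometric series.\<close>

lemma geometric_limit:
  fixes x :: "nat \<Rightarrow> 'k"
  assumes "0 \<le> C" "0 \<le> \<theta>" "\<theta> < 1" and step: "\<And>n. av (x (Suc n) - x n) \<le> C * \<theta> ^ n"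
  shows "\<exists>l. \<forall>n. av (l - x n) \<le> C * \<theta> ^ n"
proof -
  interpret M: Metric_space UNIV "\<lambda>x y. av (x - y)"
    by (rule Metric_space_av)
  have tail: "av (x (n + j) - x n) \<le> C * \<theta> ^ n" for n j
  proof (induction j)
    case (Suc j)
    have "x (n + Suc j) - x n = (x (Suc (n + j)) - x (n + j)) + (x (n + j) - x n)"
      by simp
    then have "av (x (n + Suc j) - x n) \<le> max (av (x (Suc (n + j)) - x (n + j))) (av (x (n + j) - x n))"
      by (metis av_ultrametric)
    moreover have "C * \<theta> ^ (n + j) \<le> C * \<theta> ^ n"
      using assms(1-3) by (intro mult_left_mono power_decreasing) auto
    ultimately show ?case
      using Suc step[of "n + j"] by auto
  qed (use assms in auto)
  have lim0: "(\<lambda>n. C * \<theta> ^ n) \<longlonglongrightarrow> 0"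
    using assms(2,3) by (intro tendsto_mult_right_zero LIMSEQ_realpow_zero)
  have "M.MCauchy x"
    unfolding M.MCauchy_def
  proof (intro conjI allI impI)
    fix e :: real assume "0 < e"
    then obtain N where N: "\<And>n. n \<ge> N \<Longrightarrow> C * \<theta> ^ n < e"
      using order_tendstoD(2)[OF lim0] by (auto simp: eventually_sequentially)
    have "av (x n - x n') < e" if "N \<le> n" "N \<le> n'" for n n'
    proof (cases "n \<le> n'")
      case True
      then show ?thesis
        using tail[of n "n' - n"] N[OF that(1)] by (simp add: av_minus_commute)
    next
      case False
      then show ?thesis
        using tail[of n' "n - n'"] N[OF that(2)] by simp
    qed
    then show "\<exists>N. \<forall>n n'. N \<le> n \<longrightarrow> N \<le> n' \<longrightarrow> av (x n - x n') < e"
      by blast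
  qed auto
  then obtain l where l: "limitin M.mtopology x l sequentially"
    using av_complete M.mcomplete_def by blast
  have "av (l - x n) \<le> C * \<theta> ^ n" for n
  proof (rule field_le_epsilon)
    fix e :: real assume "0 < e"
    then obtain N where N: "\<And>m. m \<ge> N \<Longrightarrow> av (x m - l) < e"
      using l unfolding M.limitin_metric eventually_sequentially by auto
    have "l - x n = (l - x (n + N)) + (x (n + N) - x n)"
      by simp
    then have "av (l - x n) \<le> max (av (l - x (n + N))) (av (x (n + N) - x n))"
      by (metis av_ultrametric)
    moreover have "0 \<le> C * \<theta> ^ n"
      using assms by simp
    ultimately show "av (l - x n) \<le> C * \<theta> ^ n + e"
      using tail[of n N] N[of "n + N"] \<open>0 < e\<close> by (auto simp: av_minus_commute)
  qed
  then show ?thesis by blast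
qed

section \<open>Weighted Gauss norms of polynomials\<close>

definition gauss_le :: "real \<Rightarrow> real \<Rightarrow> 'k poly \<Rightarrow> bool" where
  "gauss_le a C f \<longleftrightarrow> (\<forall>i. av (Polynomial.coeff f i) * a ^ i \<le> C)"

lemma gauss_leD: "gauss_le a C f \<Longrightarrow> av (Polynomial.coeff f i) * a ^ i \<le> C"
  by (simp add: gauss_le_def)

lemma gauss_le_mono: "gauss_le a C f \<Longrightarrow> C \<le> D \<Longrightarrow> gauss_le a D f"
  unfolding gauss_le_def using order_trans by blast

lemma gauss_le_add: "0 < a \<Longrightarrow> gauss_le a C f \<Longrightarrow> gauss_le a D g \<Longrightarrow> gauss_le a (max C D) (f + g)"
  unfolding gauss_le_def
proof
  fix i
  assume *: "0 < a" "\<forall>i. av (Polynomial.coeff f i) * a ^ i \<le> C" "\<forall>i. av (Polynomial.coeff g i) * a ^ i \<le> D"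
  have "av (Polynomial.coeff (f + g) i) * a ^ i
      \<le> max (av (Polynomial.coeff f i)) (av (Polynomial.coeff g i)) * a ^ i"
    using * by (intro mult_right_mono) (auto simp: av_ultrametric)
  then show "av (Polynomial.coeff (f + g) i) * a ^ i \<le> max C D"
    using *(2,3)[rule_format, of i] by (auto simp: max_def split: if_splits)
qed

lemma gauss_le_minus: "gauss_le a C f \<Longrightarrow> gauss_le a C (- f)"
  by (simp add: gauss_le_def)

lemma gauss_le_diff: "0 < a \<Longrightarrow> gauss_le a C f \<Longrightarrow> gauss_le a D g \<Longrightarrow> gauss_le a (max C D) (f - g)"
  using gauss_le_add[of a C f D "- g"] by (simp add: gauss_le_minus)

lemma gauss_le_nonneg: "gauss_le a C f \<Longrightarrow> 0 \<le> C"
  using gauss_leD[of a C f 0] av_nonneg[of "Polynomial.coeff f 0"] by simp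

lemma gauss_le_monom: "av c * a ^ n \<le> C \<Longrightarrow> 0 \<le> C \<Longrightarrow> gauss_le a C (Polynomial.monom c n)"
  by (auto simp: gauss_le_def)

lemma gauss_le_1: "gauss_le a 1 1"
  using gauss_le_monom[of 1 a 0 1] by (simp add: monom_0 one_pCons)

lemma gauss_le_mult:
  assumes "0 < a" "gauss_le a C f" "gauss_le a D g"
  shows "gauss_le a (C * D) (f * g)"
  unfolding gauss_le_def
proof
  fix n
  have CD: "0 \<le> C" "0 \<le> D"
    using assms gauss_le_nonneg by blast+
  have "av (Polynomial.coeff f i * Polynomial.coeff g (n - i)) \<le> C * D / a ^ n" if "i \<le> n" for i
  proof -
    have "(av (Polynomial.coeff f i) * a ^ i) * (av (Polynomial.coeff g (n - i)) * a ^ (n - i)) \<le> C * D"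
      using assms CD by (intro mult_mono gauss_leD) (auto intro!: mult_nonneg_nonneg av_nonneg)
    moreover have "a ^ n = a ^ i * a ^ (n - i)"
      using that by (simp flip: power_add)
    ultimately show ?thesis
      using assms(1) by (simp add: av_mult field_simps)
  qed
  then have "av (Polynomial.coeff (f * g) n) \<le> C * D / a ^ n"
    unfolding coeff_mult using assms(1) CD by (intro av_sum_le) auto
  then show "av (Polynomial.coeff (f * g) n) * a ^ n \<le> C * D"
    using assms(1) by (simp add: field_simps)
qed

lemma gauss_le_zero_limit:
  assumes "0 < a" "\<And>n. gauss_le a (C * \<theta> ^ n) f" "0 \<le> \<theta>" "\<theta> < 1"
  shows "f = 0"
proof (rule poly_eqI)
  fix i
  have "(\<lambda>n. C * \<theta> ^ n) \<longlonglongrightarrow> 0"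
    using assms(3,4) by (intro tendsto_mult_right_zero LIMSEQ_realpow_zero)
  then have "av (Polynomial.coeff f i) * a ^ i \<le> 0"
    by (rule LIMSEQ_le_const) (use assms(2) in \<open>auto simp: gauss_le_def\<close>)
  then have "av (Polynomial.coeff f i) \<le> 0"
    using zero_less_power[OF assms(1), of i] by (simp add: mult_le_0_iff)
  then show "Polynomial.coeff f i = Polynomial.coeff 0 i"
    using av_pos[of "Polynomial.coeff f i"] by fastforce
qed

text \<open>The limit is taken coefficientwise. The uniform degree bound \<open>d\<close> makes it a
  polynomial again, and the rate is preserved.\<close>

lemma gauss_limit:
  fixes F :: "nat \<Rightarrow> 'k poly"
  assumes "0 < a" "0 \<le> C" "0 \<le> \<theta>" "\<theta> < 1" "\<And>n. Polynomial.degree (F n) \<le> d"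
    and step: "\<And>n. gauss_le a (C * \<theta> ^ n) (F (Suc n) - F n)"
  shows "\<exists>G. Polynomial.degree G \<le> d \<and> (\<forall>n. gauss_le a (C * \<theta> ^ n) (G - F n))"
proof -
  have "\<exists>l. \<forall>n. av (l - Polynomial.coeff (F n) i) \<le> C / a ^ i * \<theta> ^ n" for i
  proof (rule geometric_limit)
    show "av (Polynomial.coeff (F (Suc n)) i - Polynomial.coeff (F n) i) \<le> C / a ^ i * \<theta> ^ n" for n
      using gauss_leD[OF step[of n], of i] assms(1) by (simp add: field_simps)
  qed (use assms in auto)
  then obtain l where l: "\<And>i n. av (l i - Polynomial.coeff (F n) i) \<le> C / a ^ i * \<theta> ^ n"
    by metis
  define G where "G = (\<Sum>i\<le>d. Polynomial.monom (l i) i)"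
  have G: "Polynomial.coeff G i = (if i \<le> d then l i else 0)" for i
    by (simp add: G_def coeff_sum)
  have "av (Polynomial.coeff (G - F n) i) * a ^ i \<le> C * \<theta> ^ n" for n i
  proof (cases "i \<le> d")
    case True
    then show ?thesis
      using l[of i n] assms(1) by (simp add: G field_simps)
  next
    case False
    then have "Polynomial.coeff (F n) i = 0"
      using assms(5)[of n] by (intro coeff_eq_0) auto
    then show ?thesis
      using False assms by (simp add: G)
  qed
  moreover have "Polynomial.degree G \<le> d"
    by (intro degree_le) (auto simp: G)
  ultimately show ?thesis
    unfolding gauss_le_def by blast
qed

text \<open>For monic \<open>g\<close> of Gauss norm \<open>a ^ degree g\<close> the leading term
  carries the norm. Each step of long division then subtracts a multiple \<open>m * g\<close> within
  the bound for the dividend, so the bound passes to remainder and quotient.\<close>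

lemma gauss_division:
  fixes g r :: "'k poly"
  assumes "0 < a" "Polynomial.lead_coeff g = 1" "0 < Polynomial.degree g"
    "gauss_le a (a ^ Polynomial.degree g) g" "gauss_le a C r"
  shows "\<exists>u v. r = u * g + v \<and> Polynomial.degree v < Polynomial.degree g \<and> gauss_le a C v \<and>
           gauss_le a (C / a ^ Polynomial.degree g) u \<and>
           Polynomial.degree u \<le> Polynomial.degree r - Polynomial.degree g"
  using assms(5)
proof (induction "Polynomial.degree r" arbitrary: r rule: less_induct)
  case less
  let ?k = "Polynomial.degree g" and ?n = "Polynomial.degree r"
  have C: "0 \<le> C"
    using less.prems gauss_le_nonneg by blast
  show ?case
  proof (cases "?n < ?k")
    case True
    then show ?thesis
      using less.prems C assms(1) by (intro exI[of _ 0] exI[of _ r]) (auto simp: gauss_le_def)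
  next
    case False
    define m where "m = Polynomial.monom (Polynomial.lead_coeff r) (?n - ?k)"
    have "av (Polynomial.lead_coeff r) * a ^ (?n - ?k) * a ^ ?k \<le> C"
      using gauss_leD[OF less.prems, of ?n] False by (simp add: mult.assoc flip: power_add)
    then have m: "gauss_le a (C / a ^ ?k) m"
      unfolding m_def using assms(1) C by (intro gauss_le_monom) (auto simp: field_simps)
    have "gauss_le a (C / a ^ ?k * a ^ ?k) (m * g)"
      by (intro gauss_le_mult m assms)
    then have mg: "gauss_le a C (m * g)"
      using assms(1) by simp
    have rmg: "gauss_le a C (r - m * g)"
      using gauss_le_diff[OF assms(1) less.prems mg] by simp
    have "r \<noteq> 0" using False assms(3) by auto
    have deg_m: "Polynomial.degree m = ?n - ?k"
      unfolding m_def using \<open>r \<noteq> 0\<close> by (simp add: degree_monom_eq)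
    have "g \<noteq> 0" "m \<noteq> 0" using assms(3) \<open>r \<noteq> 0\<close> by (auto simp: m_def)
    then have deg_mg: "Polynomial.degree (m * g) = ?n"
      using deg_m False by (simp add: degree_mult_eq)
    have lead: "Polynomial.coeff (m * g) ?n = Polynomial.coeff r ?n"
      using coeff_mult_degree_sum[of m g] deg_m assms(2) False \<open>r \<noteq> 0\<close> by (simp add: m_def)
    have "Polynomial.degree (r - m * g) < ?n"
      using lead deg_mg False assms(3)
      by (intro degree_lessI) (auto intro: coeff_eq_0 simp: coeff_eq_0 le_less)
    then obtain u v where uv: "r - m * g = u * g + v" "Polynomial.degree v < ?k" "gauss_le a C v"
        "gauss_le a (C / a ^ ?k) u" "Polynomial.degree u \<le> Polynomial.degree (r - m * g) - ?k"
      using less.hyps[OF _ rmg] by blast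
    have "r = (m + u) * g + v"
      using uv(1) by (simp add: algebra_simps)
    moreover have "gauss_le a (C / a ^ ?k) (m + u)"
      using gauss_le_add[OF assms(1) m uv(4)] by simp
    moreover have "Polynomial.degree (m + u) \<le> ?n - ?k"
      using \<open>Polynomial.degree (r - m * g) < ?n\<close> uv(5) deg_m by (intro degree_add_le) auto
    ultimately show ?thesis
      using uv(2,3) by blast
  qed
qed

text \<open>\<open>k\<close> is the last index at which the Gauss norm is attained. In the Newton iteration the second
  factor stays close to \<open>1\<close>, so the correction to it needs no Bezout relation: dividing the
  error \<open>p - g h\<close> by \<open>g\<close> suffices.\<close>

lemma hensel_dominated:
  fixes p :: "'k poly"
  assumes a: "0 < a" and k: "0 < k" "k < Polynomial.degree p" "Polynomial.coeff p k = 1"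
    and p: "gauss_le a (a ^ k) p" and \<theta>: "0 \<le> \<theta>" "\<theta> < 1"
    and top: "\<And>i. k < i \<Longrightarrow> av (Polynomial.coeff p i) * a ^ i \<le> a ^ k * \<theta>"
  shows "\<exists>g h. p = g * h \<and> Polynomial.degree g = k"
proof -
  let ?d = "Polynomial.degree p"
  \<comment> \<open>The iteration keeps \<open>h\<close> within \<theta> of 1 and the error at
    \<open>\<theta> ^ Suc n\<close> relative to \<open>a ^ k\<close>; the degree bounds are carried
    along for the limit.\<close>
  define P where "P = (\<lambda>n (g, h). Polynomial.degree g = k \<and> Polynomial.lead_coeff g = 1 \<and>
     gauss_le a (a ^ k) g \<and> gauss_le a \<theta> (h - 1) \<and> Polynomial.degree h \<le> ?d - k \<and>
     gauss_le a (a ^ k * \<theta> ^ Suc n) (p - g * h))"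
  define Q where "Q = (\<lambda>n s s'. gauss_le a (a ^ k * \<theta> ^ Suc n) (fst s' - fst s) \<and>
     gauss_le a (\<theta> ^ Suc n) (snd s' - snd s))"
  have "\<exists>s. P 0 s"
  proof -
    \<comment> \<open>The start is the truncation of \<open>p\<close> at degree \<open>k\<close>
      together with \<open>h = 1\<close>; the omitted terms are those bounded by
      \<open>top\<close>.\<close>
    define g where "g = (\<Sum>i\<le>k. Polynomial.monom (Polynomial.coeff p i) i)"
    have g: "Polynomial.coeff g i = (if i \<le> k then Polynomial.coeff p i else 0)" for i
      by (simp add: g_def coeff_sum)
    have dg: "Polynomial.degree g = k"
      using k by (intro antisym degree_le le_degree) (auto simp: g)
    have "gauss_le a (a ^ k) g"
      using p a by (auto simp: gauss_le_def g)
    moreover have "gauss_le a (a ^ k * \<theta>) (p - g)"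
      using top a \<theta> by (auto simp: gauss_le_def g)
    ultimately have "P 0 (g, 1)"
      using dg k \<theta> by (auto simp: P_def g) (auto simp: gauss_le_def)
    then show ?thesis ..
  qed
  moreover have "\<exists>s'. P (Suc n) s' \<and> Q n s s'" if Ps: "P n s" for n s
  proof -
    obtain g h where s: "s = (g, h)" by fastforce
    note P = Ps[unfolded s P_def, simplified]
    let ?r = "p - g * h"
    obtain u v where uv: "?r = u * g + v" "Polynomial.degree v < k"
        "gauss_le a (a ^ k * \<theta> ^ Suc n) v" "gauss_le a (a ^ k * \<theta> ^ Suc n / a ^ k) u"
        "Polynomial.degree u \<le> Polynomial.degree ?r - k"
      using gauss_division[of a g "a ^ k * \<theta> ^ Suc n" ?r] a k P by auto
    have u: "gauss_le a (\<theta> ^ Suc n) u"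
      using uv(4) a by simp
    have "Polynomial.degree (g * h) \<le> ?d"
      using degree_mult_le[of g h] P k by linarith
    then have "Polynomial.degree ?r \<le> ?d"
      by (intro degree_diff_le) auto
    then have du: "Polynomial.degree u \<le> ?d - k"
      using uv(5) by linarith
    have dg: "Polynomial.degree (g + v) = k"
      using P uv(2) by (simp add: degree_add_eq_left)
    have le: "\<theta> ^ Suc n \<le> \<theta>"
      using \<theta> power_decreasing[of 1 "Suc n" \<theta>] by simp
    have le1: "\<theta> ^ Suc n \<le> 1"
      using \<theta> le by linarith
    have gv: "gauss_le a (a ^ k) (g + v)"
      using P a le1 by (intro gauss_le_mono[OF gauss_le_add[OF a _ uv(3)]]) auto
    have hu: "gauss_le a \<theta> (h - 1 + u)"
      using gauss_le_add[OF a, of \<theta> "h - 1", OF _ u] P le by (simp add: max_absorb1)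
    \<comment> \<open>Writing the old error as \<open>u * g + v\<close> cancels everything except
      the remainder \<open>v\<close>, of relative size \<open>\<theta> ^ Suc n\<close>, times
      \<open>h - 1 + u\<close>, of size \<theta>. This gains one factor \<theta>.\<close>
    have err: "p - (g + v) * (h + u) = - (v * (h - 1 + u))"
      using uv(1) by (simp add: algebra_simps)
    have "gauss_le a (a ^ k * \<theta> ^ Suc n * \<theta>) (v * (h - 1 + u))"
      by (intro gauss_le_mult a uv(3) hu)
    then have new: "gauss_le a (a ^ k * \<theta> ^ Suc (Suc n)) (p - (g + v) * (h + u))"
      unfolding err by (intro gauss_le_minus) (simp add: mult_ac)
    have "Polynomial.coeff v k = 0"
      using uv(2) by (rule coeff_eq_0)
    then have "P (Suc n) (g + v, h + u)"
      using P dg gv hu new du by (auto simp: P_def algebra_simps intro: degree_add_le)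
    moreover have "Q n s (g + v, h + u)"
      using uv(3) u by (simp add: Q_def s)
    ultimately show ?thesis by blast
  qed
  ultimately obtain F where "\<And>n. P n (F n)" and FQ: "\<And>n. Q n (F n) (F (Suc n))"
    using dependent_nat_choice[of P Q] by metis
  define g where "g = fst \<circ> F"
  define h where "h = snd \<circ> F"
  have FP: "P n (g n, h n)" for n
    using \<open>P n (F n)\<close> by (simp add: g_def h_def)
  note FP = FP[unfolded P_def, simplified]
  have "\<exists>G. Polynomial.degree G \<le> k \<and> (\<forall>n. gauss_le a (a ^ k * \<theta> * \<theta> ^ n) (G - g n))"
    using a \<theta> FP FQ by (intro gauss_limit) (auto simp: Q_def g_def mult_ac)
  then obtain G where G: "Polynomial.degree G \<le> k" "\<And>n. gauss_le a (a ^ k * \<theta> * \<theta> ^ n) (G - g n)"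
    by blast
  have "\<exists>H. Polynomial.degree H \<le> ?d - k \<and> (\<forall>n. gauss_le a (\<theta> * \<theta> ^ n) (H - h n))"
    using a \<theta> FP FQ by (intro gauss_limit) (auto simp: Q_def h_def mult_ac)
  then obtain H where H: "Polynomial.degree H \<le> ?d - k" "\<And>n. gauss_le a (\<theta> * \<theta> ^ n) (H - h n)"
    by blast
  have "gauss_le a (a ^ k * \<theta> * \<theta> ^ n) (p - G * H)" for n
  proof -
    let ?C = "a ^ k * \<theta> * \<theta> ^ n"
    have eq: "p - G * H = (p - g n * h n) - ((G - g n) * H + g n * (H - h n))"
      by (simp add: algebra_simps)
    have "gauss_le a (max \<theta> 1) (h n - 1 + 1)"
      by (intro gauss_le_add a gauss_le_1) (use FP in auto)
    then have "gauss_le a 1 (h n)"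
      using \<theta> by (simp add: max_def split: if_splits)
    moreover have "\<theta> * \<theta> ^ n \<le> 1"
      using \<theta> power_le_one[of \<theta> "Suc n"] by simp
    ultimately have "gauss_le a 1 H"
      using gauss_le_add[OF a, of 1 "h n", OF _ H(2)[of n]] by (simp add: max_absorb1)
    then have "gauss_le a (?C * 1) ((G - g n) * H)"
      using gauss_le_mult[OF a G(2)] by blast
    moreover have "gauss_le a (a ^ k * (\<theta> * \<theta> ^ n)) (g n * (H - h n))"
      by (intro gauss_le_mult a H) (use FP in auto)
    ultimately have "gauss_le a ?C ((G - g n) * H + g n * (H - h n))"
      using gauss_le_add[OF a, of ?C "(G - g n) * H" ?C] by (simp only: mult.assoc mult_1_right max.idem)
    moreover have "gauss_le a ?C (p - g n * h n)"
      using FP[of n] by (simp add: mult.assoc)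
    ultimately show ?thesis
      unfolding eq using gauss_le_diff[OF a, of ?C "p - g n * h n" ?C] by (simp only: max.idem)
  qed
  then have "p - G * H = 0"
    using gauss_le_zero_limit[of a "a ^ k * \<theta>" \<theta> "p - G * H"] a \<theta> by blast
  then have pGH: "p = G * H" by simp
  \<comment> \<open>The bounds \<open>k\<close> and \<open>?d - k\<close> on the two degrees add up
    to the degree of the product, so neither leaves any slack.\<close>
  then have "Polynomial.degree G = k"
    using degree_mult_le[of G H] G(1) H(1) k by auto
  then show ?thesis
    using pGH by blast
qed

section \<open>Flat polynomials as the unsplittable case\<close>

definition flat :: "real \<Rightarrow> 'k poly \<Rightarrow> bool" where
  "flat a q \<longleftrightarrow> 0 < a \<and> Polynomial.lead_coeff q = 1 \<and> av (Polynomial.coeff q 0) = a ^ Polynomial.degree q \<and>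
     gauss_le a (a ^ Polynomial.degree q) q"

text \<open>The radius is chosen so that the first and the last term have the same weighted size
  \<open>a ^ d\<close>, which levels the chord of the Newton polygon. If some term in between is
  larger, the last maximal index \<open>k\<close> is neither 0 nor the degree, and Hensel's lemma
  splits off a factor of degree \<open>k\<close>.\<close>

theorem flat_or_reducible:
  fixes q :: "'k poly"
  assumes q: "Polynomial.lead_coeff q = 1" "0 < Polynomial.degree q" "Polynomial.coeff q 0 \<noteq> 0"
  shows "(\<exists>a. flat a q) \<or> (\<exists>g h. q = g * h \<and> Polynomial.lead_coeff g = 1 \<and> Polynomial.lead_coeff h = 1 \<and>
           0 < Polynomial.degree g \<and> 0 < Polynomial.degree h)"
proof -
  let ?d = "Polynomial.degree q"
  define a where "a = root ?d (av (Polynomial.coeff q 0))"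
  have a: "0 < a"
    using q av_pos by (simp add: a_def)
  have a_d: "a ^ ?d = av (Polynomial.coeff q 0)"
    using q av_nonneg by (simp add: a_def)
  define t where "t i = av (Polynomial.coeff q i) * a ^ i" for i
  show ?thesis
  proof (cases "gauss_le a (a ^ ?d) q")
    case True
    then show ?thesis
      using a a_d q by (auto simp: flat_def)
  next
    case False
    then obtain j where j: "a ^ ?d < t j"
      by (auto simp: gauss_le_def t_def not_le)
    define A where "A = Max (t ` {..?d})"
    have t_le: "t i \<le> A" for i
    proof (cases "i \<le> ?d")
      case True
      then show ?thesis by (simp add: A_def)
    next
      case False
      have "0 \<le> t 0" by (simp add: t_def av_nonneg)
      also have "\<dots> \<le> A" by (simp add: A_def)
      finally show ?thesis
        using False by (simp add: t_def coeff_eq_0)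
    qed
    have "a ^ ?d < A"
      using j t_le[of j] by linarith
    have A: "0 < A"
      using \<open>a ^ ?d < A\<close> zero_less_power[OF a, of ?d] by linarith
    have "A \<in> t ` {..?d}"
      unfolding A_def by (intro Max_in) auto
    then have ne: "{i. i \<le> ?d \<and> t i = A} \<noteq> {}" by auto
    define k where "k = Max {i. i \<le> ?d \<and> t i = A}"
    have k: "k \<le> ?d" "t k = A"
      using Max_in[OF _ ne] by (auto simp: k_def)
    have k_max: "t i < A" if "k < i" for i
    proof -
      have "t i \<noteq> A"
      proof
        assume ti: "t i = A"
        then have "i \<le> ?d"
          using A by (cases "i \<le> ?d") (auto simp: t_def coeff_eq_0)
        then have "i \<le> k"
          unfolding k_def using ti by (intro Max_ge) auto
        then show False using that by simp
      qed
      then show ?thesis using t_le[of i] by simp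
    qed
    have "k \<noteq> 0"
      using k(2) \<open>a ^ ?d < A\<close> a_d by (cases "k = 0") (auto simp: t_def)
    have "k \<noteq> ?d"
      using k(2) \<open>a ^ ?d < A\<close> q by (auto simp: t_def)
    define c where "c = Polynomial.coeff q k"
    have "c \<noteq> 0"
      using k(2) A by (auto simp: c_def t_def)
    have A_eq: "A = av c * a ^ k"
      using k(2) by (simp add: t_def c_def)
    \<comment> \<open>Dividing by the coefficient of index \<open>k\<close> normalizes it to 1 and
      turns the maximum \<open>A\<close> into \<open>a ^ k\<close>.\<close>
    define p where "p = Polynomial.smult (inverse c) q"
    have dp: "Polynomial.degree p = ?d"
      using \<open>c \<noteq> 0\<close> by (simp add: p_def)
    have cp: "av (Polynomial.coeff p i) * a ^ i = t i / av c" for i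
      unfolding p_def t_def coeff_smult av_mult av_inverse by (simp add: divide_simps)
    \<comment> \<open>Only finitely many nonzero terms lie beyond \<open>k\<close>, all strictly
      below \<open>A\<close>; their maximum relative to \<open>A\<close> is the contraction
      factor.\<close>
    define \<theta> where "\<theta> = Max (t ` {k<..?d}) / A"
    have fin: "finite (t ` {k<..?d})" "t ` {k<..?d} \<noteq> {}"
      using k \<open>k \<noteq> ?d\<close> by auto
    have "Max (t ` {k<..?d}) < A"
      using k_max fin by simp
    then have \<theta>1: "\<theta> < 1"
      using A by (simp add: \<theta>_def)
    have "t ?d \<le> Max (t ` {k<..?d})"
      using k \<open>k \<noteq> ?d\<close> by simp
    moreover have "0 \<le> t ?d"
      using a by (simp add: t_def av_nonneg)
    ultimately have \<theta>0: "0 \<le> \<theta>"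
      unfolding \<theta>_def using A by (intro divide_nonneg_pos) linarith+
    have "\<exists>g h. p = g * h \<and> Polynomial.degree g = k"
    proof (rule hensel_dominated[OF a])
      show "0 < k" "k < Polynomial.degree p"
        using k \<open>k \<noteq> 0\<close> \<open>k \<noteq> ?d\<close> dp by auto
      show "Polynomial.coeff p k = 1"
        using \<open>c \<noteq> 0\<close> by (simp add: p_def c_def)
      show "gauss_le a (a ^ k) p"
        unfolding gauss_le_def cp using t_le av_pos[OF \<open>c \<noteq> 0\<close>] by (simp add: A_eq field_simps)
      show "0 \<le> \<theta>" "\<theta> < 1" by fact+
      fix i assume "k < i"
      have "t i \<le> A * \<theta>"
      proof (cases "i \<le> ?d")
        case True
        then show ?thesis
          using A \<open>k < i\<close> by (simp add: \<theta>_def)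
      next
        case False
        then show ?thesis
          using A \<theta>0 by (simp add: t_def coeff_eq_0)
      qed
      then show "av (Polynomial.coeff p i) * a ^ i \<le> a ^ k * \<theta>"
        unfolding cp using av_pos[OF \<open>c \<noteq> 0\<close>] by (simp add: A_eq field_simps)
    qed
    then obtain g h where gh: "p = g * h" "Polynomial.degree g = k"
      by blast
    have q_eq: "q = Polynomial.smult c (g * h)"
      using \<open>c \<noteq> 0\<close> gh(1) by (simp add: p_def flip: gh(1))
    have "q \<noteq> 0" using q(2) by auto
    then have "g \<noteq> 0" "h \<noteq> 0"
      using q_eq by (metis mult_zero_left mult_zero_right smult_0_right)+
    define l where "l = Polynomial.lead_coeff g"
    have "l \<noteq> 0" using \<open>g \<noteq> 0\<close> by (simp add: l_def)
    have lead: "c * l * Polynomial.lead_coeff h = 1"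
      using q(1) unfolding q_eq l_def lead_coeff_smult lead_coeff_mult by (simp add: mult.assoc)
    have deg: "?d = k + Polynomial.degree h"
      using q_eq \<open>c \<noteq> 0\<close> \<open>g \<noteq> 0\<close> \<open>h \<noteq> 0\<close> gh(2) by (simp add: degree_mult_eq)
    have "q = Polynomial.smult (inverse l) g * Polynomial.smult (c * l) h"
      using \<open>l \<noteq> 0\<close> by (simp add: q_eq mult.assoc)
    moreover have "Polynomial.lead_coeff (Polynomial.smult (inverse l) g) = 1"
      using \<open>l \<noteq> 0\<close> unfolding lead_coeff_smult l_def[symmetric] by simp
    moreover have "Polynomial.lead_coeff (Polynomial.smult (c * l) h) = 1"
      using lead unfolding lead_coeff_smult .
    moreover have "0 < Polynomial.degree (Polynomial.smult (inverse l) g)"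
      using \<open>l \<noteq> 0\<close> \<open>k \<noteq> 0\<close> gh(2) by simp
    moreover have "0 < Polynomial.degree (Polynomial.smult (c * l) h)"
      using \<open>l \<noteq> 0\<close> \<open>c \<noteq> 0\<close> deg k \<open>k \<noteq> ?d\<close> by simp
    ultimately show ?thesis by blast
  qed
qed

end

section \<open>Slopes of polynomials and adapted norms\<close>

lemma le_mult_self_imp_nonpos:
  fixes x t :: real
  assumes "x \<le> t * x" "t < 1"
  shows "x \<le> 0"
proof (rule ccontr)
  assume "\<not> x \<le> 0"
  then have "t * x < 1 * x"
    using assms(2) by (intro mult_strict_right_mono) auto
  then show False using assms(1) by simp
qed

context complete_ultrametric_field
begin

text \<open>All roots of a polynomial that is \<open>small b\<close> have absolute value \<open>\<le> b\<close>, all roots of one that is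
  \<open>large b\<close> have absolute value \<open>\<ge> b\<close>.\<close>

definition small :: "real \<Rightarrow> 'k poly \<Rightarrow> bool" where
  "small b q \<longleftrightarrow> 0 < b \<and> Polynomial.lead_coeff q = 1 \<and> gauss_le b (b ^ Polynomial.degree q) q"

definition large :: "real \<Rightarrow> 'k poly \<Rightarrow> bool" where
  "large b q \<longleftrightarrow> 0 < b \<and> Polynomial.coeff q 0 \<noteq> 0 \<and> gauss_le b (av (Polynomial.coeff q 0)) q"

text \<open>Evaluated at the degree and at index 0, the two bounds give opposite inequalities
  between the constant coefficient and \<open>b ^ degree q\<close>. Estimates for flat polynomials
  can thus be proved as two one-sided ones.\<close>

lemma flat_iff: "flat b q \<longleftrightarrow> small b q \<and> large b q"
proof
  assume "flat b q"
  then show "small b q \<and> large b q"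
    unfolding flat_def small_def large_def by (auto simp: av_eq_0_iff[symmetric])
next
  assume *: "small b q \<and> large b q"
  have "av (Polynomial.coeff q 0) \<le> b ^ Polynomial.degree q"
    using * gauss_leD[of b _ q 0] by (auto simp: small_def)
  moreover have "b ^ Polynomial.degree q \<le> av (Polynomial.coeff q 0)"
    using * gauss_leD[of b _ q "Polynomial.degree q"] by (auto simp: small_def large_def)
  ultimately show "flat b q"
    using * by (auto simp: flat_def small_def)
qed

lemma small_mult: "small b p \<Longrightarrow> small b q \<Longrightarrow> small b (p * q)"
  unfolding small_def
  by (auto simp: lead_coeff_mult degree_mult_eq power_add intro: gauss_le_mult)
    (metis degree_mult_eq gauss_le_mult leading_coeff_0_iff power_add zero_neq_one)

lemma large_mult: "large b p \<Longrightarrow> large b q \<Longrightarrow> large b (p * q)"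
  unfolding large_def by (auto simp: coeff_mult_0 av_mult intro: gauss_le_mult)

lemma flat_mult: "flat b p \<Longrightarrow> flat b q \<Longrightarrow> flat b (p * q)"
  by (simp add: flat_iff small_mult large_mult)

lemma small_mono:
  assumes "small b q" "b \<le> c"
  shows "small c q"
proof -
  let ?d = "Polynomial.degree q"
  have b: "0 < b" using assms by (simp add: small_def)
  have "av (Polynomial.coeff q i) * c ^ i \<le> c ^ ?d" for i
  proof (cases "i \<le> ?d")
    case True
    have "av (Polynomial.coeff q i) * b ^ i \<le> b ^ (?d - i) * b ^ i"
      using gauss_leD[of b _ q i] assms(1) True by (simp add: small_def flip: power_add)
    then have "av (Polynomial.coeff q i) \<le> b ^ (?d - i)"
      using b by simp
    also have "\<dots> \<le> c ^ (?d - i)"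
      using b assms(2) by (intro power_mono) auto
    finally have "av (Polynomial.coeff q i) * c ^ i \<le> c ^ (?d - i) * c ^ i"
      using b assms(2) by (intro mult_right_mono) auto
    then show ?thesis
      using True by (simp flip: power_add)
  next
    case False
    then show ?thesis
      using b assms(2) by (simp add: coeff_eq_0)
  qed
  then show ?thesis
    using assms b by (auto simp: small_def gauss_le_def)
qed

lemma large_mono:
  assumes "large b q" "0 < c" "c \<le> b"
  shows "large c q"
proof -
  have "av (Polynomial.coeff q i) * c ^ i \<le> av (Polynomial.coeff q 0)" for i
  proof -
    have "av (Polynomial.coeff q i) * c ^ i \<le> av (Polynomial.coeff q i) * b ^ i"
      using assms by (intro mult_left_mono power_mono av_nonneg) auto
    also have "\<dots> \<le> av (Polynomial.coeff q 0)"
      using assms(1) gauss_leD[of b _ q i] by (auto simp: large_def)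
    finally show ?thesis .
  qed
  then show ?thesis
    using assms by (auto simp: large_def gauss_le_def)
qed

lemma small_1: "0 < b \<Longrightarrow> small b 1"
  by (simp add: small_def gauss_le_1)

lemma large_1: "0 < b \<Longrightarrow> large b 1"
  by (simp add: large_def gauss_le_1)

lemma flat_1: "0 < b \<Longrightarrow> flat b 1"
  by (simp add: flat_iff small_1 large_1)

text \<open>The root 0 lies below every radius; this handles a vanishing constant coefficient, where
  no flat polynomial is available.\<close>

lemma small_X: "0 < b \<Longrightarrow> small b (Polynomial.monom 1 1)"
  by (auto simp: small_def degree_monom_eq gauss_le_def)

text \<open>Polynomials with such a factorization are closed under products, since the gaps around
  \<open>a\<close> survive taking the maximum of the \<open>b\<close> and the minimum of the
  \<open>c\<close>. They include X and all flat polynomials, and \<open>flat_or_reducible\<close>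
  reduces the rest to smaller degree.\<close>

theorem slope_factorization:
  fixes q :: "'k poly"
  assumes "0 < a" "Polynomial.lead_coeff q = 1"
  shows "\<exists>f g h b c. q = f * g * h \<and> 0 < b \<and> b < a \<and> a < c \<and> small b f \<and> flat a g \<and> large c h"
  using assms(2)
proof (induction "Polynomial.degree q" arbitrary: q rule: less_induct)
  case less
  let ?P = "\<lambda>q. \<exists>f g h b c. q = f * g * h \<and> 0 < b \<and> b < a \<and> a < c \<and> small b f \<and> flat a g \<and> large c h"
  have mult: "?P (p * q)" if P: "?P p" "?P q" for p q
  proof -
    obtain f g h b c where 1: "p = f * g * h" "0 < b" "b < a" "a < c" "small b f" "flat a g" "large c h"
      using P(1) by blast
    obtain f' g' h' b' c' where 2: "q = f' * g' * h'" "0 < b'" "b' < a" "a < c'" "small b' f'" "flat a g'" "large c' h'"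
      using P(2) by blast
    have "p * q = (f * f') * (g * g') * (h * h')"
      using 1(1) 2(1) by (simp add: mult_ac)
    moreover have "small (max b b') (f * f')"
      by (rule small_mult; rule small_mono) (use 1 2 in auto)
    moreover have "large (min c c') (h * h')"
      by (rule large_mult; rule large_mono) (use 1 2 \<open>0 < a\<close> in auto)
    moreover have "0 < max b b'" "max b b' < a" "a < min c c'"
      using 1 2 by auto
    ultimately show ?thesis
      using flat_mult[OF 1(6) 2(6)] by blast
  qed
  have flat_P: "?P p" if "flat r p" for r p
  proof -
    have r: "0 < r" using that by (simp add: flat_def)
    consider "r < a" | "r = a" | "a < r" by linarith
    then show ?thesis
    proof cases
      case 1
      \<comment> \<open>The radii \<open>2 * a\<close> and \<open>a / 2\<close>, here and in the
        next two cases, belong to trivial factors 1 and only have to lie on the correct side of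
        \<open>a\<close>.\<close>
      then have "p = p * 1 * 1 \<and> 0 < r \<and> r < a \<and> a < 2 * a \<and> small r p \<and> flat a 1 \<and> large (2 * a) 1"
        using that r \<open>0 < a\<close> by (simp add: flat_iff small_1 large_1)
      then show ?thesis by blast
    next
      case 2
      then have "p = 1 * p * 1 \<and> 0 < a / 2 \<and> a / 2 < a \<and> a < 2 * a \<and> small (a / 2) 1 \<and> flat a p \<and> large (2 * a) 1"
        using that r by (simp add: small_1 large_1)
      then show ?thesis by blast
    next
      case 3
      then have "p = 1 * 1 * p \<and> 0 < a / 2 \<and> a / 2 < a \<and> a < r \<and> small (a / 2) 1 \<and> flat a 1 \<and> large r p"
        using that \<open>0 < a\<close> by (simp add: flat_iff small_1 large_1)
      then show ?thesis by blast
    qed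
  qed
  consider "Polynomial.degree q = 0" | "0 < Polynomial.degree q" "Polynomial.coeff q 0 = 0"
    | "0 < Polynomial.degree q" "Polynomial.coeff q 0 \<noteq> 0" by blast
  then show ?case
  proof cases
    case 1
    then have "q = 1"
      using less.prems by (metis degree_0_id one_pCons)
    then show ?thesis
      using flat_P[OF flat_1] \<open>0 < a\<close> by blast
  next
    case 2
    obtain p where p: "q = Polynomial.pCons 0 p"
      using 2(2) by (cases q) auto
    then have "p \<noteq> 0" using 2(1) by auto
    then have "Polynomial.degree q = Suc (Polynomial.degree p)" by (simp add: p)
    moreover have "Polynomial.lead_coeff p = 1"
      using less.prems \<open>p \<noteq> 0\<close> by (simp add: p)
    ultimately have "?P p"
      using less.hyps[of p] by simp
    moreover have "?P (Polynomial.monom 1 1)"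
    proof -
      have "Polynomial.monom 1 1 = Polynomial.monom 1 1 * 1 * 1 \<and> 0 < a / 2 \<and> a / 2 < a \<and> a < 2 * a \<and>
          small (a / 2) (Polynomial.monom 1 1) \<and> flat a 1 \<and> large (2 * a) 1"
        using \<open>0 < a\<close> by (simp add: small_X flat_1 large_1 del: One_nat_def)
      then show ?thesis by blast
    qed
    moreover have "q = Polynomial.monom 1 1 * p"
      by (simp add: p monom_altdef)
    ultimately show ?thesis
      using mult by simp
  next
    case 3
    from flat_or_reducible[OF less.prems 3] show ?thesis
    proof (elim disjE exE conjE)
      fix r assume "flat r q"
      then show ?thesis by (rule flat_P)
    next
      fix g h assume gh: "q = g * h" "Polynomial.lead_coeff g = 1" "Polynomial.lead_coeff h = 1"
        "0 < Polynomial.degree g" "0 < Polynomial.degree h"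
      then have "Polynomial.degree q = Polynomial.degree g + Polynomial.degree h"
        by (metis degree_0 degree_mult_eq less_irrefl)
      then have "?P g" "?P h"
        using less.hyps[of g] less.hyps[of h] gh by auto
      then show ?thesis
        unfolding gh(1) by (rule mult)
    qed
  qed
qed

end

text \<open>No finite dimension is assumed, because the locale serves both \<alpha> and
  multiplication by an element of the algebraic closure.\<close>

locale ultrametric_operator =
  complete_ultrametric_field av + Vector_Spaces.linear scl scl \<alpha>
  for av :: "'k::field \<Rightarrow> real" and scl :: "'k \<Rightarrow> 'e::ab_group_add \<Rightarrow> 'e" and \<alpha> :: "'e \<Rightarrow> 'e"
begin

definition poly_op :: "'k poly \<Rightarrow> 'e \<Rightarrow> 'e" where
  "poly_op q x = (\<Sum>i\<le>Polynomial.degree q. scl (Polynomial.coeff q i) ((\<alpha> ^^ i) x))"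

lemma poly_op_altdef:
  assumes "Polynomial.degree q \<le> n"
  shows "poly_op q x = (\<Sum>i\<le>n. scl (Polynomial.coeff q i) ((\<alpha> ^^ i) x))"
  unfolding poly_op_def using assms
  by (intro sum.mono_neutral_left) (auto simp: coeff_eq_0)

lemma poly_op_0 [simp]: "poly_op 0 x = 0"
  by (simp add: poly_op_def)

lemma poly_op_1 [simp]: "poly_op 1 x = x"
  by (simp add: poly_op_def)

lemma poly_op_pCons: "poly_op (Polynomial.pCons c q) x = scl c x + \<alpha> (poly_op q x)"
proof -
  have "poly_op (Polynomial.pCons c q) x =
      (\<Sum>i\<le>Suc (Polynomial.degree q). scl (Polynomial.coeff (Polynomial.pCons c q) i) ((\<alpha> ^^ i) x))"
    by (rule poly_op_altdef) (auto simp: degree_pCons_le)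
  also have "\<dots> = scl c x + \<alpha> (poly_op q x)"
    by (subst sum.atMost_Suc_shift) (simp add: poly_op_def sum scale)
  finally show ?thesis .
qed

lemma poly_op_add: "poly_op (p + q) x = poly_op p x + poly_op q x"
proof -
  let ?n = "max (Polynomial.degree p) (Polynomial.degree q)"
  show ?thesis
    using poly_op_altdef[of "p + q" ?n x] poly_op_altdef[of p ?n x] poly_op_altdef[of q ?n x]
    by (simp add: degree_add_le vs1.scale_left_distrib sum.distrib)
qed

lemma poly_op_smult: "poly_op (Polynomial.smult c q) x = scl c (poly_op q x)"
  using poly_op_altdef[of "Polynomial.smult c q" "Polynomial.degree q" x]
  by (simp add: poly_op_def vs1.scale_sum_right)

lemma poly_op_mult: "poly_op (p * q) x = poly_op p (poly_op q x)"
  by (induction p) (auto simp: poly_op_add poly_op_smult poly_op_pCons)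

lemma poly_op_commute: "poly_op p (poly_op q x) = poly_op q (poly_op p x)"
  by (metis poly_op_mult mult.commute)

lemma poly_op_comp: "poly_op q (\<alpha> x) = \<alpha> (poly_op q x)"
  by (induction q) (auto simp: poly_op_pCons add scale)

lemma poly_op_vec_add: "poly_op q (x + y) = poly_op q x + poly_op q y"
  by (induction q) (auto simp: poly_op_pCons add vs1.scale_right_distrib algebra_simps)

lemma poly_op_vec_scale: "poly_op q (scl c x) = scl c (poly_op q x)"
  by (induction q) (auto simp: poly_op_pCons scale vs1.scale_right_distrib mult.commute)

lemma poly_op_vec_0 [simp]: "poly_op q 0 = 0"
  using poly_op_vec_scale[of q 0 0] by simp

lemma funpow_0 [simp]: "(\<alpha> ^^ i) 0 = 0"
  by (induction i) (auto simp: zero)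

lemma linear_poly_op: "Vector_Spaces.linear scl scl (poly_op q)"
  by unfold_locales (auto simp: poly_op_vec_add poly_op_vec_scale)

definition poly_ker :: "'k poly \<Rightarrow> 'e set" where
  "poly_ker q = {x. poly_op q x = 0}"

lemma invariant_poly_ker: "invariant_subspace scl \<alpha> (poly_ker q)"
  unfolding invariant_subspace_def poly_ker_def vs1.subspace_def
  by (auto simp: poly_op_vec_add poly_op_vec_scale poly_op_comp)

lemma invariant_funpow: "invariant_subspace scl \<alpha> F \<Longrightarrow> x \<in> F \<Longrightarrow> (\<alpha> ^^ i) x \<in> F"
  by (induction i) (auto simp: invariant_subspace_def)

lemma invariant_poly_op: "invariant_subspace scl \<alpha> F \<Longrightarrow> x \<in> F \<Longrightarrow> poly_op q x \<in> F"
  unfolding poly_op_def using invariant_funpow[of F x]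
  by (intro vs1.subspace_sum vs1.subspace_scale) (auto simp: invariant_subspace_def)

section \<open>Growth of orbits of vectors killed by a small or large polynomial\<close>

context
  fixes N :: "'e \<Rightarrow> real"
  assumes N: "ultrametric_norm av scl N"
begin

interpretation ultrametric_norm av scl N
  by (rule N)

lemma N_sum_le:
  assumes "0 \<le> C" "\<And>i. i \<in> S \<Longrightarrow> N (f i) \<le> C"
  shows "N (Groups_Big.sum f S) \<le> C"
  using assms(2)
proof (induction S rule: infinite_finite_induct)
  case (insert x F)
  have "N (f x + Groups_Big.sum f F) \<le> max (N (f x)) (N (Groups_Big.sum f F))"
    by (rule N_ultrametric)
  also have "\<dots> \<le> C"
    using insert by auto
  finally show ?case
    using insert by simp
qed (use assms(1) N_eq_0_iff[of 0] in auto)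

lemma N_minus: "N (- x) = N x"
  using N_scale[of "-1" x] by simp

text \<open>The relation is solved for the top iterate: \<open>q\<close> is monic, and its i-th
  coefficient is bounded by \<open>b ^ (degree q - i)\<close>.\<close>

lemma small_relation:
  assumes q: "small b q" "poly_op q x = 0" and "0 \<le> C"
    and C: "\<And>i. i < Polynomial.degree q \<Longrightarrow> b ^ (Polynomial.degree q - i) * N ((\<alpha> ^^ i) x) \<le> C"
  shows "N ((\<alpha> ^^ Polynomial.degree q) x) \<le> C"
proof -
  let ?d = "Polynomial.degree q" and ?s = "\<Sum>i<Polynomial.degree q. scl (Polynomial.coeff q i) ((\<alpha> ^^ i) x)"
  have b: "0 < b" using q by (simp add: small_def)
  have "0 = ?s + (\<alpha> ^^ ?d) x"
    using q by (simp add: poly_op_def small_def flip: lessThan_Suc_atMost)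
  then have "(\<alpha> ^^ ?d) x = - ?s"
    by (metis minus_unique)
  moreover have "N ?s \<le> C"
  proof (rule N_sum_le[OF \<open>0 \<le> C\<close>])
    fix i assume "i \<in> {..<?d}"
    then have i: "i < ?d" by simp
    have "av (Polynomial.coeff q i) * b ^ i \<le> b ^ (?d - i) * b ^ i"
      using gauss_leD[of b _ q i] q i by (simp add: small_def flip: power_add)
    then have "av (Polynomial.coeff q i) \<le> b ^ (?d - i)"
      using b by simp
    then have "N (scl (Polynomial.coeff q i) ((\<alpha> ^^ i) x)) \<le> b ^ (?d - i) * N ((\<alpha> ^^ i) x)"
      unfolding N_scale by (intro mult_right_mono N_nonneg)
    then show "N (scl (Polynomial.coeff q i) ((\<alpha> ^^ i) x)) \<le> C"
      using C[OF i] by linarith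
  qed
  ultimately show ?thesis by (simp add: N_minus)
qed

text \<open>Dually, the relation is solved for \<open>x\<close> itself by dividing by the constant
  coefficient, which dominates all others weighted with \<open>b ^ i\<close>.\<close>

lemma large_relation:
  assumes q: "large b q" "poly_op q x = 0" and "0 \<le> C"
    and C: "\<And>i. 0 < i \<Longrightarrow> i \<le> Polynomial.degree q \<Longrightarrow> N ((\<alpha> ^^ i) x) \<le> b ^ i * C"
  shows "N x \<le> C"
proof -
  let ?d = "Polynomial.degree q" and ?c = "Polynomial.coeff q 0"
  let ?s = "\<Sum>i<?d. scl (Polynomial.coeff q (Suc i)) ((\<alpha> ^^ Suc i) x)"
  have b: "0 < b" "?c \<noteq> 0" using q by (auto simp: large_def)
  have "0 = scl ?c x + ?s"
    using q(2) unfolding poly_op_def by (simp add: sum.atMost_shift)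
  then have "scl ?c x = - ?s"
    by (metis add.inverse_inverse minus_unique)
  then have "av ?c * N x = N ?s"
    by (metis N_minus N_scale)
  also have "\<dots> \<le> av ?c * C"
  proof (rule N_sum_le)
    show "0 \<le> av ?c * C" using \<open>0 \<le> C\<close> av_nonneg by simp
    fix i assume "i \<in> {..<?d}"
    then have i: "N ((\<alpha> ^^ Suc i) x) \<le> b ^ Suc i * C"
      using C[of "Suc i"] by simp
    have "N (scl (Polynomial.coeff q (Suc i)) ((\<alpha> ^^ Suc i) x))
        \<le> av (Polynomial.coeff q (Suc i)) * (b ^ Suc i * C)"
      unfolding N_scale by (intro mult_left_mono i av_nonneg)
    also have "\<dots> = (av (Polynomial.coeff q (Suc i)) * b ^ Suc i) * C"
      by simp
    also have "\<dots> \<le> av ?c * C"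
      using gauss_leD[of b _ q "Suc i"] q(1) \<open>0 \<le> C\<close> by (intro mult_right_mono) (auto simp: large_def)
    finally show "N (scl (Polynomial.coeff q (Suc i)) ((\<alpha> ^^ Suc i) x)) \<le> av ?c * C" .
  qed
  finally show ?thesis
    using av_pos[OF b(2)] by simp
qed

text \<open>Expansion by \<open>c\<close> bounds every lower iterate by the top one, and
  \<open>small_relation\<close> then bounds the top one by \<open>b / c < 1\<close> times itself.
  Expansion is asked only along the orbit of \<open>x\<close>, so a norm that is adapted to one
  invariant subspace can be used there.\<close>

lemma small_expanding_imp_0:
  assumes q: "small b q" "poly_op q x = 0" "b < c"
    and exp: "\<And>i. c * N ((\<alpha> ^^ i) x) \<le> N (\<alpha> ((\<alpha> ^^ i) x))"
  shows "x = 0"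
proof -
  let ?d = "Polynomial.degree q"
  have b: "0 < b" "0 < c" using q by (auto simp: small_def)
  have grow: "c ^ j * N ((\<alpha> ^^ i) x) \<le> N ((\<alpha> ^^ (i + j)) x)" for i j
  proof (induction j)
    case (Suc j)
    have "c ^ Suc j * N ((\<alpha> ^^ i) x) \<le> c * N ((\<alpha> ^^ (i + j)) x)"
      using Suc b by simp
    also have "\<dots> \<le> N ((\<alpha> ^^ (i + Suc j)) x)"
      using exp[of "i + j"] by simp
    finally show ?case .
  qed simp
  have "N ((\<alpha> ^^ ?d) x) \<le> b / c * N ((\<alpha> ^^ ?d) x)"
  proof (rule small_relation[OF q(1,2)])
    show "0 \<le> b / c * N ((\<alpha> ^^ ?d) x)" using b N_nonneg by simp
    fix i assume i: "i < ?d"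
    have "(b / c) ^ (?d - i) \<le> b / c"
      using power_decreasing[of 1 "?d - i" "b / c"] i b q(3) by simp
    then have "(b / c) ^ (?d - i) * (c ^ (?d - i) * N ((\<alpha> ^^ i) x)) \<le> b / c * N ((\<alpha> ^^ ?d) x)"
      using grow[of "?d - i" i] i b by (intro mult_mono) (auto simp: N_nonneg)
    then show "b ^ (?d - i) * N ((\<alpha> ^^ i) x) \<le> b / c * N ((\<alpha> ^^ ?d) x)"
      using b by (simp add: power_divide)
  qed
  moreover have "b / c < 1" using b q(3) by simp
  ultimately have "N ((\<alpha> ^^ ?d) x) \<le> 0"
    by (rule le_mult_self_imp_nonpos)
  then have "c ^ ?d * N x \<le> 0"
    using grow[of ?d 0] by simp
  then have "N x \<le> 0"
    using zero_less_power[OF b(2), of ?d] by (simp add: mult_le_0_iff)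
  then show ?thesis
    using N_nonneg[of x] N_eq_0_iff by simp
qed

text \<open>The mirror image: the rate \<open>b\<close> bounds all later iterates by
  \<open>x\<close>, and \<open>large_relation\<close> bounds \<open>N x\<close> by
  \<open>b / c < 1\<close> times itself.\<close>

lemma large_contracting_imp_0:
  assumes q: "large c q" "poly_op q x = 0" "0 \<le> b" "b < c"
    and con: "\<And>i. N (\<alpha> ((\<alpha> ^^ i) x)) \<le> b * N ((\<alpha> ^^ i) x)"
  shows "x = 0"
proof -
  have c: "0 < c" using q by simp
  have decay: "N ((\<alpha> ^^ i) x) \<le> b ^ i * N x" for i
  proof (induction i)
    case (Suc i)
    have "N ((\<alpha> ^^ Suc i) x) \<le> b * N ((\<alpha> ^^ i) x)"
      using con[of i] by simp
    also have "\<dots> \<le> b * (b ^ i * N x)"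
      by (intro mult_left_mono Suc q)
    finally show ?case by (simp add: mult.assoc)
  qed simp
  have "N x \<le> b / c * N x"
  proof (rule large_relation[OF q(1,2)])
    show "0 \<le> b / c * N x" using c q(3) N_nonneg by simp
    fix i :: nat assume i: "0 < i"
    have "(b / c) ^ i \<le> b / c"
      using power_decreasing[of 1 i "b / c"] i c q(3,4) by simp
    then have "c ^ i * ((b / c) ^ i * N x) \<le> c ^ i * (b / c * N x)"
      using c N_nonneg by (intro mult_left_mono mult_right_mono) auto
    then show "N ((\<alpha> ^^ i) x) \<le> c ^ i * (b / c * N x)"
      using decay[of i] c by (simp add: power_divide)
  qed
  moreover have "b / c < 1" using c q by simp
  ultimately have "N x \<le> 0"
    by (rule le_mult_self_imp_nonpos)
  then show ?thesis
    using N_nonneg[of x] N_eq_0_iff by simp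
qed

text \<open>The indices run up to \<open>n\<close> inclusive, so the maximum is over a nonempty set.
  The uses take \<open>n = degree q - 1\<close>, which is 0 for constant \<open>q\<close> and then
  gives \<open>N\<close> back.\<close>

definition cyc_norm :: "real \<Rightarrow> nat \<Rightarrow> 'e \<Rightarrow> real" where
  "cyc_norm b n x = Max ((\<lambda>i. N ((\<alpha> ^^ i) x) / b ^ i) ` {..n})"

lemma cyc_norm_ge: "i \<le> n \<Longrightarrow> N ((\<alpha> ^^ i) x) / b ^ i \<le> cyc_norm b n x"
  unfolding cyc_norm_def by (intro Max_ge) auto

lemma cyc_norm_le: "(\<And>i. i \<le> n \<Longrightarrow> N ((\<alpha> ^^ i) x) / b ^ i \<le> C) \<Longrightarrow> cyc_norm b n x \<le> C"
  unfolding cyc_norm_def by (subst Max_le_iff) auto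

lemma funpow_linear: "(\<alpha> ^^ i) (x + y) = (\<alpha> ^^ i) x + (\<alpha> ^^ i) y" "(\<alpha> ^^ i) (scl c x) = scl c ((\<alpha> ^^ i) x)"
  by (induction i) (auto simp: add scale)

text \<open>Formulated for two orbits whose norms differ by the factor \<open>s\<close>: this covers
  scalar multiples and also images under an operator that commutes with \<alpha> and scales
  \<open>N\<close> by \<open>s\<close>.\<close>

lemma cyc_norm_cmult:
  assumes "0 \<le> s" "\<And>i. N ((\<alpha> ^^ i) y) = s * N ((\<alpha> ^^ i) x)"
  shows "cyc_norm b n y = s * cyc_norm b n x"
proof -
  have "mono ((*) s)"
    using assms(1) by (intro monoI mult_left_mono)
  then have "s * cyc_norm b n x = Max ((*) s ` (\<lambda>i. N ((\<alpha> ^^ i) x) / b ^ i) ` {..n})"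
    unfolding cyc_norm_def by (intro mono_Max_commute) auto
  then show ?thesis
    unfolding cyc_norm_def image_image assms(2) by simp
qed

lemma ultrametric_cyc_norm:
  assumes "0 < b"
  shows "ultrametric_norm av scl (cyc_norm b n)"
proof
  have N0: "N x \<le> cyc_norm b n x" for x
    using cyc_norm_ge[of 0 n x b] by simp
  fix x y c
  show "0 \<le> cyc_norm b n x"
    using N0[of x] N_nonneg[of x] by linarith
  have "cyc_norm b n (scl 0 0) = av 0 * cyc_norm b n 0"
    by (rule cyc_norm_cmult) (auto simp: funpow_linear N_eq_0_iff)
  then have "cyc_norm b n 0 = 0" by simp
  then show "cyc_norm b n x = 0 \<longleftrightarrow> x = 0"
    using N0[of x] N_nonneg[of x] N_eq_0_iff[of x] by auto
  show "cyc_norm b n (scl c x) = av c * cyc_norm b n x"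
    by (rule cyc_norm_cmult) (auto simp: funpow_linear N_scale av_nonneg)
  show "cyc_norm b n (x + y) \<le> max (cyc_norm b n x) (cyc_norm b n y)"
  proof (rule cyc_norm_le)
    fix i assume i: "i \<le> n"
    have "N ((\<alpha> ^^ i) (x + y)) / b ^ i \<le> max (N ((\<alpha> ^^ i) x)) (N ((\<alpha> ^^ i) y)) / b ^ i"
      unfolding funpow_linear using assms by (intro divide_right_mono N_ultrametric) auto
    also have "\<dots> = max (N ((\<alpha> ^^ i) x) / b ^ i) (N ((\<alpha> ^^ i) y) / b ^ i)"
      using assms by (auto simp: max_def field_simps)
    also have "\<dots> \<le> max (cyc_norm b n x) (cyc_norm b n y)"
      by (intro max.mono cyc_norm_ge i)
    finally show "N ((\<alpha> ^^ i) (x + y)) / b ^ i \<le> max (cyc_norm b n x) (cyc_norm b n y)" .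
  qed
qed

text \<open>Applying \<alpha> shifts the list of iterates by one place. The only new entry is the
  iterate of order \<open>degree q\<close>, which \<open>small_relation\<close> bounds by the old
  ones.\<close>

lemma cyc_norm_small:
  assumes q: "small b q" "poly_op q x = 0"
  shows "cyc_norm b (Polynomial.degree q - 1) (\<alpha> x) \<le> b * cyc_norm b (Polynomial.degree q - 1) x"
proof (cases "Polynomial.degree q = 0")
  case True
  then have "q = 1"
    using q(1) by (metis small_def degree_0_id lead_coeff_1 one_pCons)
  then have "x = 0" using q(2) by simp
  then show ?thesis
    using ultrametric_norm.N_eq_0_iff[OF ultrametric_cyc_norm, of b _ 0] q(1) by (simp add: small_def zero)
next
  case False
  let ?d = "Polynomial.degree q"
  let ?M = "cyc_norm b (?d - 1)"
  have b: "0 < b" using q by (simp add: small_def)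
  have M: "N ((\<alpha> ^^ i) x) \<le> b ^ i * ?M x" if "i < ?d" for i
    using cyc_norm_ge[of i "?d - 1" x b] that b by (simp add: field_simps)
  show ?thesis
  proof (rule cyc_norm_le)
    fix i assume i: "i \<le> ?d - 1"
    have "N ((\<alpha> ^^ Suc i) x) \<le> b ^ Suc i * ?M x"
    proof (cases "Suc i < ?d")
      case False
      then have "Suc i = ?d" using i \<open>?d \<noteq> 0\<close> by simp
      have "N ((\<alpha> ^^ ?d) x) \<le> b ^ ?d * ?M x"
      proof (rule small_relation[OF q])
        show "0 \<le> b ^ ?d * ?M x"
          using b ultrametric_norm.N_nonneg[OF ultrametric_cyc_norm, of b] by simp
        fix j assume j: "j < ?d"
        have "b ^ (?d - j) * N ((\<alpha> ^^ j) x) \<le> b ^ (?d - j) * (b ^ j * ?M x)"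
          using b by (intro mult_left_mono M j) auto
        then show "b ^ (?d - j) * N ((\<alpha> ^^ j) x) \<le> b ^ ?d * ?M x"
          using j by (simp flip: mult.assoc power_add)
      qed
      then show ?thesis
        by (simp only: \<open>Suc i = ?d\<close>)
    qed (rule M)
    then show "N ((\<alpha> ^^ i) (\<alpha> x)) / b ^ i \<le> b * ?M x"
      using b by (simp add: field_simps funpow_swap1)
  qed
qed

text \<open>The shift loses only the entry \<open>N x\<close>, and \<open>large_relation\<close>
  recovers it from the later iterates.\<close>

lemma cyc_norm_large:
  assumes q: "large b q" "poly_op q x = 0"
  shows "b * cyc_norm b (Polynomial.degree q - 1) x \<le> cyc_norm b (Polynomial.degree q - 1) (\<alpha> x)"
proof -
  let ?d = "Polynomial.degree q"
  let ?M = "cyc_norm b (?d - 1)"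
  have b: "0 < b" using q by (simp add: large_def)
  have M0: "0 \<le> ?M (\<alpha> x)"
    using b ultrametric_norm.N_nonneg[OF ultrametric_cyc_norm, of b] by simp
  have M: "N ((\<alpha> ^^ Suc i) x) \<le> b ^ Suc i * (?M (\<alpha> x) / b)" if "i \<le> ?d - 1" for i
    using cyc_norm_ge[of i "?d - 1" "\<alpha> x" b] that b by (simp add: field_simps funpow_swap1)
  have "?M x \<le> ?M (\<alpha> x) / b"
  proof (rule cyc_norm_le)
    fix i assume i: "i \<le> ?d - 1"
    show "N ((\<alpha> ^^ i) x) / b ^ i \<le> ?M (\<alpha> x) / b"
    proof (cases i)
      case 0
      have "N x \<le> ?M (\<alpha> x) / b"
      proof (rule large_relation[OF q])
        fix j assume "0 < j" "j \<le> ?d"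
        then show "N ((\<alpha> ^^ j) x) \<le> b ^ j * (?M (\<alpha> x) / b)"
          using M[of "j - 1"] by simp
      qed (use b M0 in simp)
      then show ?thesis using 0 by simp
    next
      case (Suc j)
      then show ?thesis
        using M[of j] i b by (simp add: field_simps)
    qed
  qed
  then show ?thesis
    using b by (simp add: field_simps)
qed

end

end

section \<open>Uniqueness of the canonical topology\<close>

definition nbhd_0 :: "'e::ab_group_add topology \<Rightarrow> 'e set \<Rightarrow> bool" where
  "nbhd_0 T W \<longleftrightarrow> (\<exists>U. openin T U \<and> 0 \<in> U \<and> U \<subseteq> W)"

lemma nbhd_0_mono: "nbhd_0 T V \<Longrightarrow> V \<subseteq> W \<Longrightarrow> nbhd_0 T W"
  unfolding nbhd_0_def by blast

lemma nbhd_0_Int: "nbhd_0 T V \<Longrightarrow> nbhd_0 T W \<Longrightarrow> nbhd_0 T (V \<inter> W)"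
  unfolding nbhd_0_def
proof (elim exE conjE)
  fix A B assume "openin T A" "0 \<in> A" "A \<subseteq> V" "openin T B" "0 \<in> B" "B \<subseteq> W"
  then show "\<exists>U. openin T U \<and> 0 \<in> U \<and> U \<subseteq> V \<inter> W"
    by (intro exI[of _ "A \<inter> B"]) auto
qed

lemma nbhd_0_zero: "nbhd_0 T W \<Longrightarrow> 0 \<in> W"
  unfolding nbhd_0_def by blast

lemma (in ultrametric_norm) N_0 [simp]: "N 0 = 0"
  by (simp add: N_eq_0_iff)

section \<open>Small scalars and the topology of the base field\<close>

context complete_ultrametric_field
begin

text \<open>If all nonzero scalars had absolute value at least 1, balls of radius 1 would be
  singletons and the topology discrete. Arbitrarily small scalars are then powers of one such
  element.\<close>

lemma exists_small_nonzero: "\<exists>p. p \<noteq> 0 \<and> av p < 1"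
proof (rule ccontr)
  assume "\<not> ?thesis"
  then have big: "1 \<le> av p" if "p \<noteq> 0" for p
    using that by (auto simp: not_less)
  interpret M: Metric_space UNIV "\<lambda>x y. av (x - y)"
    by (rule Metric_space_av)
  have "M.mball x 1 = {x}" for x
    using big[of "x - y" for y] by (auto simp: M.in_mball) (smt (verit) right_minus_eq big)
  then have "openin M.mtopology {x}" for x
    by (metis M.openin_mball)
  then have "M.mtopology = discrete_topology UNIV"
    by (metis M.topspace_mtopology discrete_topology_unique)
  then show False
    using av_nondiscrete by (simp add: av_topology_def)
qed

lemma exists_av_less:
  assumes "0 < e"
  shows "\<exists>p. p \<noteq> 0 \<and> av p < e"
proof -
  obtain p where p: "p \<noteq> 0" "av p < 1" using exists_small_nonzero by blast
  obtain n where "av p ^ n < e"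
    using real_arch_pow_inv[OF assms p(2)] by blast
  then show ?thesis
    using p(1) by (intro exI[of _ "p ^ n"]) (simp add: av_power)
qed

lemma openin_av_ball: "openin (av_topology av) {d. av (d - c) < e}"
proof -
  interpret M: Metric_space UNIV "\<lambda>x y. av (x - y)"
    by (rule Metric_space_av)
  have "{d. av (d - c) < e} = M.mball c e"
    by (auto simp: av_minus_commute)
  then show ?thesis
    by (simp add: av_topology_def)
qed

lemma openin_av_topology: "openin (av_topology av) U \<longleftrightarrow> (\<forall>c\<in>U. \<exists>e>0. \<forall>d. av (d - c) < e \<longrightarrow> d \<in> U)"
proof -
  interpret M: Metric_space UNIV "\<lambda>x y. av (x - y)"
    by (rule Metric_space_av)
  show ?thesis
    unfolding av_topology_def M.openin_mtopology
    by (auto simp: M.mball_def subset_iff av_minus_commute)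
qed

end

section \<open>Neighbourhoods of 0 in a Hausdorff vector topology\<close>

locale vector_topology =
  complete_ultrametric_field av + V: vector_space scl
  for av :: "'k::field \<Rightarrow> real" and scl :: "'k \<Rightarrow> 'e::ab_group_add \<Rightarrow> 'e" +
  fixes T :: "'e topology"
  assumes hvt: "hausdorff_vector_topology av scl T"
begin

lemma topspace_T [simp]: "topspace T = UNIV"
  using hvt by (simp add: hausdorff_vector_topology_def)

lemma open_add:
  assumes "openin T U" "x + y \<in> U"
  shows "\<exists>A B. openin T A \<and> openin T B \<and> x \<in> A \<and> y \<in> B \<and> (\<forall>a\<in>A. \<forall>b\<in>B. a + b \<in> U)"
proof -
  have "continuous_map (prod_topology T T) T (\<lambda>(x, y). x + y)"
    using hvt by (simp add: hausdorff_vector_topology_def)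
  then have "openin (prod_topology T T) {p. (case p of (x, y) \<Rightarrow> x + y) \<in> U}"
    using assms(1) by (auto simp: continuous_map_def)
  then show ?thesis
    using assms(2) unfolding openin_prod_topology_alt by (fastforce simp: subset_iff)
qed

lemma open_scale:
  assumes "openin T U" "scl c x \<in> U"
  shows "\<exists>e>0. \<exists>B. openin T B \<and> x \<in> B \<and> (\<forall>d b. av (d - c) < e \<longrightarrow> b \<in> B \<longrightarrow> scl d b \<in> U)"
proof -
  have "topspace (av_topology av) = UNIV"
    using openin_av_topology[of UNIV] openin_subset[of "av_topology av" UNIV] by (auto intro: exI[of _ 1])
  moreover have "continuous_map (prod_topology (av_topology av) T) T (\<lambda>(c, x). scl c x)"
    using hvt by (simp add: hausdorff_vector_topology_def)
  ultimately have "openin (prod_topology (av_topology av) T) {p. (case p of (c, x) \<Rightarrow> scl c x) \<in> U}"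
    using assms(1) by (auto simp: continuous_map_def)
  moreover have "(c, x) \<in> {p. (case p of (c, x) \<Rightarrow> scl c x) \<in> U}"
    using assms(2) by simp
  ultimately obtain A B where AB: "openin (av_topology av) A" "openin T B" "c \<in> A" "x \<in> B"
    "A \<times> B \<subseteq> {p. (case p of (c, x) \<Rightarrow> scl c x) \<in> U}"
    unfolding openin_prod_topology_alt by meson
  obtain e where "0 < e" "\<And>d. av (d - c) < e \<Longrightarrow> d \<in> A"
    using AB(1,3) unfolding openin_av_topology by blast
  moreover have "scl d b \<in> U" if "d \<in> A" "b \<in> B" for d b
    using subsetD[OF AB(5), of "(d, b)"] that by simp
  ultimately show ?thesis
    using AB(2,4) by blast
qed

lemma nbhd_0_add:
  assumes "nbhd_0 T W"
  shows "\<exists>V. nbhd_0 T V \<and> (\<forall>x\<in>V. \<forall>y\<in>V. x + y \<in> W)"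
proof -
  obtain U where U: "openin T U" "0 \<in> U" "U \<subseteq> W"
    using assms by (auto simp: nbhd_0_def)
  then obtain A B where "openin T A" "openin T B" "0 \<in> A" "0 \<in> B" "\<forall>a\<in>A. \<forall>b\<in>B. a + b \<in> U"
    using open_add[of U 0 0] by auto
  then show ?thesis
    using U(3) by (intro exI[of _ "A \<inter> B"]) (auto simp: nbhd_0_def intro!: exI[of _ "A \<inter> B"])
qed

lemma nbhd_0_scale_vec:
  assumes "nbhd_0 T W"
  shows "\<exists>e>0. \<forall>c. av c < e \<longrightarrow> scl c x \<in> W"
proof -
  obtain U where U: "openin T U" "0 \<in> U" "U \<subseteq> W"
    using assms by (auto simp: nbhd_0_def)
  then show ?thesis
    using open_scale[of U 0 x] by fastforce
qed

lemma nbhd_0_scale: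
  assumes "nbhd_0 T W"
  shows "nbhd_0 T {x. scl c x \<in> W}"
proof -
  obtain U where U: "openin T U" "0 \<in> U" "U \<subseteq> W"
    using assms by (auto simp: nbhd_0_def)
  then obtain e B where "0 < e" "openin T B" "0 \<in> B" "\<forall>d b. av (d - c) < e \<longrightarrow> b \<in> B \<longrightarrow> scl d b \<in> U"
    using open_scale[of U c 0] by auto
  then show ?thesis
    using U(3) by (auto simp: nbhd_0_def intro!: exI[of _ B] dest!: spec[of _ c])
qed

text \<open>\<open>V\<close> is the balanced core of \<open>W\<close>. It is a neighbourhood because
  a nonzero scalar \<open>p\<close> with \<open>av p < e\<close> carries all of \<open>B\<close>
  into it; this image is written as a preimage under \<open>inverse p\<close>.\<close>

lemma nbhd_0_balanced:
  assumes "nbhd_0 T W"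
  shows "\<exists>V\<subseteq>W. nbhd_0 T V \<and> (\<forall>c x. av c \<le> 1 \<longrightarrow> x \<in> V \<longrightarrow> scl c x \<in> V)"
proof -
  define V where "V = {x. \<forall>c. av c \<le> 1 \<longrightarrow> scl c x \<in> W}"
  obtain U where U: "openin T U" "0 \<in> U" "U \<subseteq> W"
    using assms by (auto simp: nbhd_0_def)
  then obtain e B where B: "0 < e" "openin T B" "0 \<in> B" "\<And>d b. av d < e \<Longrightarrow> b \<in> B \<Longrightarrow> scl d b \<in> U"
    using open_scale[of U 0 0] by auto
  obtain p where p: "p \<noteq> 0" "av p < e"
    using exists_av_less[OF B(1)] by blast
  have "nbhd_0 T {x. scl (inverse p) x \<in> B}"
    using B by (intro nbhd_0_scale) (auto simp: nbhd_0_def)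
  moreover have "{x. scl (inverse p) x \<in> B} \<subseteq> V"
  proof (clarsimp simp: V_def)
    fix x c assume *: "scl (inverse p) x \<in> B" "av c \<le> 1"
    have "av (c * p) \<le> 1 * av p"
      unfolding av_mult by (intro mult_right_mono * av_nonneg)
    then have "scl (c * p) (scl (inverse p) x) \<in> U"
      using p(2) by (intro B(4) *) simp
    then show "scl c x \<in> W"
      using p(1) U(3) by (auto simp: mult.assoc)
  qed
  ultimately have "nbhd_0 T V"
    by (rule nbhd_0_mono)
  moreover have "V \<subseteq> W"
    by (auto simp: V_def dest: spec[of _ 1])
  moreover have "scl c x \<in> V" if "av c \<le> 1" "x \<in> V" for c x
  proof (clarsimp simp: V_def)
    fix d assume "av d \<le> 1"
    then have "av (d * c) \<le> 1"
      using that(1) av_nonneg by (simp add: av_mult mult_le_one)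
    then show "scl (d * c) x \<in> W"
      using that(2) by (simp add: V_def)
  qed
  ultimately show ?thesis by blast
qed

lemma nbhd_0_separates:
  assumes "x \<noteq> 0"
  shows "\<exists>W. nbhd_0 T W \<and> x \<notin> W"
proof -
  have "Hausdorff_space T"
    using hvt by (simp add: hausdorff_vector_topology_def)
  then obtain U U' where "openin T U" "openin T U'" "0 \<in> U" "x \<in> U'" "disjnt U U'"
    using assms unfolding Hausdorff_space_def by (metis UNIV_I topspace_T)
  then show ?thesis
    by (intro exI[of _ U]) (auto simp: nbhd_0_def disjnt_def)
qed

text \<open>Continuity of addition at \<open>(x, 0)\<close> gives one direction and at
  \<open>(x, - x)\<close> the other. Hence a vector topology is determined by its neighbourhoods of
  0.\<close>

lemma openin_iff_nbhd_0: "openin T U \<longleftrightarrow> (\<forall>x\<in>U. nbhd_0 T {y. x + y \<in> U})"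
proof
  assume U: "openin T U"
  show "\<forall>x\<in>U. nbhd_0 T {y. x + y \<in> U}"
  proof
    fix x assume "x \<in> U"
    then obtain A B where "openin T B" "x \<in> A" "0 \<in> B" "\<forall>a\<in>A. \<forall>b\<in>B. a + b \<in> U"
      using open_add[OF U, of x 0] by auto
    then show "nbhd_0 T {y. x + y \<in> U}"
      by (auto simp: nbhd_0_def intro!: exI[of _ B])
  qed
next
  assume nb: "\<forall>x\<in>U. nbhd_0 T {y. x + y \<in> U}"
  show "openin T U"
    unfolding openin_subopen[of T U]
  proof
    fix x assume "x \<in> U"
    then obtain G where G: "openin T G" "0 \<in> G" "G \<subseteq> {y. x + y \<in> U}"
      using nb by (auto simp: nbhd_0_def)
    then obtain A B where "openin T A" "x \<in> A" "- x \<in> B" "\<forall>a\<in>A. \<forall>b\<in>B. a + b \<in> G"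
      using open_add[OF G(1), of x "- x"] by auto
    moreover have "A \<subseteq> U"
    proof
      fix a assume "a \<in> A"
      then have "a + - x \<in> G" using calculation by blast
      then show "a \<in> U" using G(3) by (auto simp: subset_iff dest!: spec[of _ "a + - x"])
    qed
    ultimately show "\<exists>S. openin T S \<and> x \<in> S \<and> S \<subseteq> U" by blast
  qed
qed

lemma nbhd_0_combination:
  assumes "finite B" "nbhd_0 T W"
  shows "\<exists>e>0. \<forall>u. (\<forall>b\<in>B. av (u b) < e) \<longrightarrow> (\<Sum>b\<in>B. scl (u b) b) \<in> W"
  using assms
proof (induction B arbitrary: W rule: finite_induct)
  case empty
  then show ?case
    using nbhd_0_zero by (intro exI[of _ 1]) auto
next
  case (insert b B)
  obtain V where V: "nbhd_0 T V" "\<forall>x\<in>V. \<forall>y\<in>V. x + y \<in> W"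
    using nbhd_0_add[OF insert.prems] by blast
  obtain e where e: "0 < e" "\<And>u. (\<forall>b\<in>B. av (u b) < e) \<Longrightarrow> (\<Sum>b\<in>B. scl (u b) b) \<in> V"
    using insert.IH[OF V(1)] by blast
  obtain e' where e': "0 < e'" "\<And>c. av c < e' \<Longrightarrow> scl c b \<in> V"
    using nbhd_0_scale_vec[OF V(1), of b] by blast
  have "(\<Sum>b\<in>insert b B. scl (u b) b) \<in> W" if "\<forall>b\<in>insert b B. av (u b) < min e e'" for u
    using that insert.hyps e(2)[of u] e'(2)[of "u b"] V(2) by simp
  then show ?case
    using e(1) e'(1) by (intro exI[of _ "min e e'"]) auto
qed

text \<open>Boundedness of the coefficients near 0 for a smaller independent set makes its span complete,
  hence closed, so that it cannot accumulate at the additional basis vector.\<close>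

lemma independent_separated:
  assumes B: "finite B" "V.independent (insert b0 B)" "b0 \<notin> B"
    and V: "nbhd_0 T V" "\<And>u b. (\<Sum>b\<in>B. scl (u b) b) \<in> V \<Longrightarrow> b \<in> B \<Longrightarrow> av (u b) < 1"
  shows "\<exists>U. nbhd_0 T U \<and> (\<forall>u. b0 - (\<Sum>b\<in>B. scl (u b) b) \<notin> U)"
proof (rule ccontr)
  let ?s = "\<lambda>u. \<Sum>b\<in>B. scl (u b) b"
  assume "\<not> ?thesis"
  then have ex: "\<exists>u. b0 - ?s u \<in> U" if "nbhd_0 T U" for U
    using that by blast
  obtain W0 where W0: "nbhd_0 T W0" "\<And>x y. x \<in> W0 \<Longrightarrow> y \<in> W0 \<Longrightarrow> x + y \<in> V"
    using nbhd_0_add[OF V(1)] by blast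
  obtain W where W: "nbhd_0 T W" "W \<subseteq> W0" "\<And>c x. av c \<le> 1 \<Longrightarrow> x \<in> W \<Longrightarrow> scl c x \<in> W"
    using nbhd_0_balanced[OF W0(1)] by blast
  obtain p where p: "p \<noteq> 0" "av p < 1" using exists_small_nonzero by blast
  \<comment> \<open>\<open>Wk k\<close> is the dilation of \<open>W\<close> by \<open>p ^ k\<close>;
    these neighbourhoods decrease because \<open>W\<close> is balanced.\<close>
  define Wk where "Wk k = {x. scl (inverse p ^ k) x \<in> W}" for k
  have Wk: "nbhd_0 T (Wk k)" for k
    unfolding Wk_def by (rule nbhd_0_scale[OF W(1)])
  have Wk_Suc: "Wk (Suc k) \<subseteq> Wk k" for k
  proof
    fix x assume "x \<in> Wk (Suc k)"
    then have "scl (inverse p ^ Suc k) x \<in> W"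
      by (simp only: Wk_def mem_Collect_eq)
    then have "scl p (scl (inverse p ^ Suc k) x) \<in> W"
      by (rule W(3)[OF less_imp_le[OF p(2)]])
    moreover have "p * inverse p ^ Suc k = inverse p ^ k"
      using p(1) by (simp flip: mult.assoc)
    ultimately show "x \<in> Wk k"
      by (simp only: Wk_def mem_Collect_eq V.scale_scale)
  qed
  \<comment> \<open>Two combinations that approximate \<open>b0\<close> up to \<open>Wk k\<close>
    differ by \<open>p ^ k\<close> times an element of \<open>V\<close>, so the bound 1 for
    coefficients on \<open>V\<close> becomes \<open>av p ^ k\<close>.\<close>
  have close: "av (u b - u' b) < av p ^ k" if "b0 - ?s u \<in> Wk k" "b0 - ?s u' \<in> Wk k" "b \<in> B" for u u' k b
  proof -
    let ?c = "inverse p ^ k"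
    have "scl ?c (b0 - ?s u) \<in> W"
      using that(1) by (simp only: Wk_def mem_Collect_eq)
    then have "scl (-1) (scl ?c (b0 - ?s u)) \<in> W"
      by (rule W(3)[rotated]) simp
    then have "scl ?c (b0 - ?s u') + scl (-1) (scl ?c (b0 - ?s u)) \<in> V"
      using that(2) W(2) by (intro W0(2)) (auto simp: Wk_def)
    also have "scl ?c (b0 - ?s u') + scl (-1) (scl ?c (b0 - ?s u)) = scl ?c (?s u - ?s u')"
      by (simp add: V.scale_right_diff_distrib)
    also have "\<dots> = ?s (\<lambda>b. ?c * (u b - u' b))"
      by (simp add: V.scale_sum_right V.scale_left_diff_distrib V.scale_right_diff_distrib sum_subtractf right_diff_distrib)
    finally have "av (?c * (u b - u' b)) < 1"
      using V(2)[of "\<lambda>b. ?c * (u b - u' b)" b] that(3) by blast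
    then have "inverse (av p) ^ k * av (u b - u' b) < 1"
      by (simp only: av_mult av_power av_inverse)
    then show ?thesis
      using av_pos[OF p(1)] by (simp add: field_simps)
  qed
  obtain u where u: "\<And>k. b0 - ?s (u k) \<in> Wk k"
    using ex[OF Wk] by metis
  have "\<exists>l. \<forall>k. av (l - u k b) \<le> 1 * av p ^ k" if "b \<in> B" for b
  proof (rule geometric_limit)
    fix k
    have "b0 - ?s (u (Suc k)) \<in> Wk k"
      using u[of "Suc k"] Wk_Suc by blast
    then show "av (u (Suc k) b - u k b) \<le> 1 * av p ^ k"
      using close[OF _ u[of k] that] by (simp add: less_imp_le)
  qed (use p av_nonneg in auto)
  then obtain l where l: "\<And>b k. b \<in> B \<Longrightarrow> av (l b - u k b) \<le> av p ^ k"
    by (metis mult_1)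
  have "b0 - ?s l \<in> G" if G: "nbhd_0 T G" for G
  proof -
    obtain G' where G': "nbhd_0 T G'" "\<And>x y. x \<in> G' \<Longrightarrow> y \<in> G' \<Longrightarrow> x + y \<in> G"
      using nbhd_0_add[OF G] by blast
    obtain e where e: "0 < e" "\<And>u. (\<forall>b\<in>B. av (u b) < e) \<Longrightarrow> ?s u \<in> G'"
      using nbhd_0_combination[OF B(1) G'(1)] by blast
    obtain k where k: "av p ^ k < e"
      using real_arch_pow_inv[OF e(1) p(2)] by blast
    \<comment> \<open>The error of \<open>u k\<close> is only known to lie in \<open>Wk k\<close>. A
      fresh approximant \<open>v\<close> has its error in \<open>G'\<close> as well, and
      \<open>Wk k\<close> ties its coefficients to those of \<open>u k\<close>, hence to the limit
      \<open>l\<close>.\<close>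
    obtain v where v: "b0 - ?s v \<in> G' \<inter> Wk k"
      using ex[OF nbhd_0_Int[OF G'(1) Wk]] by blast
    have "av (v b - l b) < e" if "b \<in> B" for b
    proof -
      have "av (v b - l b) \<le> max (av (v b - u k b)) (av (u k b - l b))"
        using av_ultrametric[of "v b - u k b" "u k b - l b"] by simp
      then show ?thesis
        using close[of v k "u k" b] u[of k] v that l[OF that, of k] k by (auto simp: av_minus_commute)
    qed
    then have "?s (\<lambda>b. v b - l b) \<in> G'"
      by (intro e(2)) auto
    then have "(b0 - ?s v) + ?s (\<lambda>b. v b - l b) \<in> G"
      using v by (intro G'(2)) auto
    then show ?thesis
      by (simp add: V.scale_left_diff_distrib sum_subtractf)
  qed
  then have "b0 = ?s l"
    using nbhd_0_separates[of "b0 - ?s l"] by (metis right_minus_eq)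
  then have "b0 \<in> V.span B"
    by (metis (no_types, lifting) V.span_base V.span_scale V.span_sum)
  then show False
    using B V.independent_insert by auto
qed

text \<open>If the coefficient of \<open>b0\<close> had absolute value at least 1, dividing by it
  inside a balanced neighbourhood would put \<open>b0\<close> minus a combination of the other
  vectors into \<open>U0\<close>. This contradicts \<open>independent_separated\<close>, whose
  boundedness hypothesis for the smaller set is the induction hypothesis.\<close>

lemma independent_bounded:
  assumes "finite B" "V.independent B"
  shows "\<exists>V. nbhd_0 T V \<and> (\<forall>u. (\<Sum>b\<in>B. scl (u b) b) \<in> V \<longrightarrow> (\<forall>b\<in>B. av (u b) < 1))"
  using assms
proof (induction "card B" arbitrary: B rule: less_induct)
  case less
  let ?s = "\<lambda>B u. \<Sum>b\<in>B. scl (u b) b"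
  have "\<exists>U. nbhd_0 T U \<and> (\<forall>u. ?s B u \<in> U \<longrightarrow> av (u b0) < 1)" if b0: "b0 \<in> B" for b0
  proof -
    let ?B = "B - {b0}"
    have B: "B = insert b0 ?B" using b0 by auto
    have "card ?B < card B"
      using b0 less.prems(1) by (rule card_Diff1_less[rotated])
    moreover have "finite ?B" "V.independent ?B"
      using less.prems V.independent_mono[of B ?B] by auto
    ultimately obtain V where V: "nbhd_0 T V" "\<And>u b. ?s ?B u \<in> V \<Longrightarrow> b \<in> ?B \<Longrightarrow> av (u b) < 1"
      using less.hyps[of ?B] by blast
    have "\<exists>U. nbhd_0 T U \<and> (\<forall>u. b0 - ?s ?B u \<notin> U)"
    proof (rule independent_separated[where V = V and B = ?B])
      show "finite ?B" "V.independent (insert b0 ?B)" "b0 \<notin> ?B" "nbhd_0 T V"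
        using less.prems B V(1) by auto
      show "av (u b) < 1" if "?s ?B u \<in> V" "b \<in> ?B" for u b
        using that by (rule V(2))
    qed
    then obtain U0 where U0: "nbhd_0 T U0" "\<And>u. b0 - ?s ?B u \<notin> U0"
      by blast
    obtain U where U: "nbhd_0 T U" "U \<subseteq> U0" "\<And>c x. av c \<le> 1 \<Longrightarrow> x \<in> U \<Longrightarrow> scl c x \<in> U"
      using nbhd_0_balanced[OF U0(1)] by blast
    have "av (u b0) < 1" if "?s B u \<in> U" for u
    proof (rule ccontr)
      let ?c = "inverse (u b0)"
      assume "\<not> av (u b0) < 1"
      then have u: "1 \<le> av (u b0)" by simp
      then have "u b0 \<noteq> 0" by auto
      have "scl ?c (?s B u) \<in> U"
        using that u by (intro U(3)) (auto simp: av_inverse inverse_le_1_iff)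
      moreover have "?s B u = scl (u b0) b0 + ?s ?B u"
        using b0 less.prems by (simp add: sum.remove)
      then have "scl ?c (?s B u) = b0 - ?s ?B (\<lambda>b. - (?c * u b))"
        using \<open>u b0 \<noteq> 0\<close> by (simp add: V.scale_right_distrib V.scale_sum_right sum_negf)
      ultimately have "b0 - ?s ?B (\<lambda>b. - (?c * u b)) \<in> U"
        by simp
      then show False
        using U(2) U0(2)[of "\<lambda>b. - (?c * u b)"] by blast
    qed
    then show ?thesis using U(1) by blast
  qed
  then obtain U where U: "\<And>b. b \<in> B \<Longrightarrow> nbhd_0 T (U b)"
    "\<And>b u. b \<in> B \<Longrightarrow> ?s B u \<in> U b \<Longrightarrow> av (u b) < 1"
    by metis
  have "nbhd_0 T (\<Inter>b\<in>F. U b)" if "finite F" "F \<subseteq> B" for F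
    using that
  proof (induction F rule: finite_induct)
    case empty
    have "openin T UNIV" by (metis openin_topspace topspace_T)
    then show ?case by (auto simp: nbhd_0_def)
  next
    case (insert b F)
    then show ?case
      using nbhd_0_Int[OF U(1)[of b]] by simp
  qed
  then show ?case
    using less.prems U(2) by (intro exI[of _ "\<Inter>b\<in>B. U b"]) auto
qed

text \<open>The right-hand side does not mention the topology; this is what makes any two Hausdorff
  vector topologies agree. For the converse the coefficient bound 1 is rescaled by a scalar
  \<open>p\<close> with \<open>av p < e\<close>.\<close>

lemma nbhd_0_iff_coefficients:
  assumes B: "finite B" "V.independent B" "V.span B = UNIV"
  shows "nbhd_0 T W \<longleftrightarrow> (\<exists>e>0. \<forall>u. (\<forall>b\<in>B. av (u b) < e) \<longrightarrow> (\<Sum>b\<in>B. scl (u b) b) \<in> W)"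
proof
  assume "nbhd_0 T W"
  then show "\<exists>e>0. \<forall>u. (\<forall>b\<in>B. av (u b) < e) \<longrightarrow> (\<Sum>b\<in>B. scl (u b) b) \<in> W"
    by (rule nbhd_0_combination[OF B(1)])
next
  assume "\<exists>e>0. \<forall>u. (\<forall>b\<in>B. av (u b) < e) \<longrightarrow> (\<Sum>b\<in>B. scl (u b) b) \<in> W"
  then obtain e where e: "0 < e" "\<And>u. (\<forall>b\<in>B. av (u b) < e) \<Longrightarrow> (\<Sum>b\<in>B. scl (u b) b) \<in> W"
    by blast
  obtain p where p: "p \<noteq> 0" "av p < e"
    using exists_av_less[OF e(1)] by blast
  obtain V where V: "nbhd_0 T V" "\<And>u b. (\<Sum>b\<in>B. scl (u b) b) \<in> V \<Longrightarrow> b \<in> B \<Longrightarrow> av (u b) < 1"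
    using independent_bounded[OF B(1,2)] by blast
  have "{x. scl (inverse p) x \<in> V} \<subseteq> W"
  proof (clarify)
    fix x assume x: "scl (inverse p) x \<in> V"
    have "x \<in> V.span B" using B(3) by simp
    then obtain u where u: "x = (\<Sum>b\<in>B. scl (u b) b)"
      using V.span_finite[OF B(1)] by auto
    have "av (u b) < e" if "b \<in> B" for b
    proof -
      have "av (inverse p * u b) < 1"
        using x that V(2)[of "\<lambda>b. inverse p * u b" b] by (simp add: u V.scale_sum_right)
      then have "inverse (av p) * av (u b) < 1"
        by (simp only: av_mult av_inverse)
      then have "av (u b) < av p"
        using av_pos[OF p(1)] by (simp add: field_simps)
      then show ?thesis using p(2) by simp
    qed
    then show "x \<in> W"
      unfolding u by (intro e(2)) auto
  qed
  then show "nbhd_0 T W"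
    using nbhd_0_scale[OF V(1)] by (rule nbhd_0_mono[rotated])
qed

end

lemma hausdorff_vector_topology_unique:
  assumes "complete_ultrametric_field av" "finite_dimensional_vector_space scl B"
    and "hausdorff_vector_topology av scl T" "hausdorff_vector_topology av scl T'"
  shows "T = T'"
proof -
  interpret complete_ultrametric_field av by fact
  interpret finite_dimensional_vector_space scl B by fact
  interpret T: vector_topology av scl T by unfold_locales fact
  interpret T': vector_topology av scl T' by unfold_locales fact
  have "nbhd_0 T W \<longleftrightarrow> nbhd_0 T' W" for W
    using T.nbhd_0_iff_coefficients[OF finite_Basis independent_Basis span_Basis]
      T'.nbhd_0_iff_coefficients[OF finite_Basis independent_Basis span_Basis]
    by simp
  then show ?thesis
    unfolding topology_eq T.openin_iff_nbhd_0 T'.openin_iff_nbhd_0 by simp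
qed

section \<open>The topology of an ultrametric norm\<close>

lemma (in complete_ultrametric_field) norm_topology_hausdorff_vector:
  assumes "vector_space scl" "ultrametric_norm av scl N"
  shows "hausdorff_vector_topology av scl (Metric_space.mtopology UNIV (\<lambda>x y. N (x - y)))"
proof -
  interpret V: vector_space scl by fact
  interpret ultrametric_norm av scl N by fact
  have N_minus: "N (- x) = N x" for x
    using N_scale[of "-1" x] by simp
  have N_commute: "N (x - y) = N (y - x)" for x y
    using N_minus[of "x - y"] by simp
  interpret M: Metric_space UNIV "\<lambda>x y. N (x - y)"
  proof
    fix x y z
    have "N (x - z) \<le> max (N (x - y)) (N (y - z))"
      using N_ultrametric[of "x - y" "y - z"] by simp
    then show "N (x - z) \<le> N (x - y) + N (y - z)"
      using N_nonneg[of "x - y"] N_nonneg[of "y - z"] by linarith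
  qed (auto simp: N_nonneg N_eq_0_iff intro: N_commute)
  have openin: "openin M.mtopology U \<longleftrightarrow> (\<forall>x\<in>U. \<exists>e>0. \<forall>y. N (y - x) < e \<longrightarrow> y \<in> U)" for U
    unfolding M.openin_mtopology by (auto simp: M.mball_def subset_iff N_commute)
  have ball: "openin M.mtopology {y. N (y - x) < e}" for x e
    using M.openin_mball[of x e] by (simp add: M.mball_def N_commute)
  have top_av: "topspace (av_topology av) = UNIV"
    using openin_av_topology[of UNIV] openin_subset[of "av_topology av" UNIV] by (auto intro: exI[of _ 1])
  have "continuous_map (prod_topology M.mtopology M.mtopology) M.mtopology (\<lambda>(x, y). x + y)"
    unfolding continuous_map_def openin_prod_topology_alt
  proof (intro conjI allI impI)
    fix U x y
    assume U: "openin M.mtopology U"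
      and xy: "(x, y) \<in> {p \<in> topspace (prod_topology M.mtopology M.mtopology). (case p of (x, y) \<Rightarrow> x + y) \<in> U}"
    then obtain e where e: "0 < e" "\<And>z. N (z - (x + y)) < e \<Longrightarrow> z \<in> U"
      using openin[of U] by auto
    have "x' + y' \<in> U" if "N (x' - x) < e" "N (y' - y) < e" for x' y'
    proof (rule e(2))
      have "x' + y' - (x + y) = (x' - x) + (y' - y)" by (simp add: algebra_simps)
      then show "N (x' + y' - (x + y)) < e"
        using N_ultrametric[of "x' - x" "y' - y"] that by (metis le_less_trans max_less_iff_conj)
    qed
    then show "\<exists>A B. openin M.mtopology A \<and> openin M.mtopology B \<and> x \<in> A \<and> y \<in> B \<and>
        A \<times> B \<subseteq> {p \<in> topspace (prod_topology M.mtopology M.mtopology). (case p of (x, y) \<Rightarrow> x + y) \<in> U}"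
      using e(1) ball by (intro exI[of _ "{x'. N (x' - x) < e}"] exI[of _ "{y'. N (y' - y) < e}"]) auto
  qed auto
  moreover have "continuous_map (prod_topology (av_topology av) M.mtopology) M.mtopology (\<lambda>(c, x). scl c x)"
    unfolding continuous_map_def openin_prod_topology_alt
  proof (intro conjI allI impI)
    fix U c x
    assume U: "openin M.mtopology U"
      and cx: "(c, x) \<in> {p \<in> topspace (prod_topology (av_topology av) M.mtopology). (case p of (c, x) \<Rightarrow> scl c x) \<in> U}"
    then obtain e where e: "0 < e" "\<And>z. N (z - scl c x) < e \<Longrightarrow> z \<in> U"
      using openin[of U] by auto
    \<comment> \<open>\<open>d\<close> and \<open>d'\<close> control the two parts of
      \<open>c' (x' - x) + (c' - c) x\<close>. The summand 1 keeps the denominators positive, and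
      the cap \<open>min 1 d\<close> below gives \<open>av c' \<le> av c + 1\<close>.\<close>
    define d where "d = e / (N x + 1)"
    define d' where "d' = e / (av c + 1)"
    have pos: "0 < N x + 1" "0 < av c + 1" "0 < d" "0 < d'"
      using N_nonneg[of x] av_nonneg[of c] e(1) by (auto simp: d_def d'_def intro!: divide_pos_pos)
    have "scl c' x' \<in> U" if "av (c' - c) < min 1 d" "N (x' - x) < d'" for c' x'
    proof (rule e(2))
      have "av c' \<le> max (av (c' - c)) (av c)"
        using av_ultrametric[of "c' - c" c] by simp
      then have "av c' \<le> av c + 1"
        using that(1) av_nonneg[of c] by (auto simp: le_max_iff_disj)
      then have "av c' * N (x' - x) \<le> (av c + 1) * N (x' - x)"
        by (intro mult_right_mono N_nonneg)
      also have "\<dots> < (av c + 1) * d'"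
        using that(2) pos by (intro mult_strict_left_mono)
      finally have 1: "av c' * N (x' - x) < e"
        using pos by (simp add: d'_def)
      have "av (c' - c) * N x \<le> av (c' - c) * (N x + 1)"
        using av_nonneg by (intro mult_left_mono) auto
      also have "\<dots> < d * (N x + 1)"
        using that(1) pos by (intro mult_strict_right_mono) auto
      finally have 2: "av (c' - c) * N x < e"
        using pos by (simp add: d_def)
      have "scl c' x' - scl c x = scl c' (x' - x) + scl (c' - c) x"
        by (simp add: V.scale_right_diff_distrib V.scale_left_diff_distrib)
      then show "N (scl c' x' - scl c x) < e"
        using N_ultrametric[of "scl c' (x' - x)" "scl (c' - c) x"] 1 2 by (simp add: N_scale)
    qed
    then show "\<exists>A B. openin (av_topology av) A \<and> openin M.mtopology B \<and> c \<in> A \<and> x \<in> B \<and>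
        A \<times> B \<subseteq> {p \<in> topspace (prod_topology (av_topology av) M.mtopology). (case p of (c, x) \<Rightarrow> scl c x) \<in> U}"
    proof (intro exI conjI)
      show "openin (av_topology av) {c'. av (c' - c) < min 1 d}"
        by (rule openin_av_ball)
      show "openin M.mtopology {x'. N (x' - x) < d'}"
        by (rule ball)
    qed (use pos top_av in auto)
  qed auto
  ultimately show ?thesis
    unfolding hausdorff_vector_topology_def using M.Hausdorff_space_mtopology by simp
qed

lemma defining_norm_iff:
  assumes K: "complete_ultrametric_field av" and fd: "finite_dimensional_vector_space scl B"
  shows "defining_norm av scl N \<longleftrightarrow> ultrametric_norm av scl N"
proof -
  have V: "vector_space scl"
    using fd by (simp add: finite_dimensional_vector_space_def)
  have "Metric_space.mtopology UNIV (\<lambda>x y. N (x - y)) = canonical_topology av scl" if "ultrametric_norm av scl N"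
    unfolding canonical_topology_def
    using complete_ultrametric_field.norm_topology_hausdorff_vector[OF K V that]
      hausdorff_vector_topology_unique[OF K fd]
    by (intro the_equality[symmetric]) auto
  then show ?thesis
    by (auto simp: defining_norm_def)
qed

section \<open>Splitting a space by slopes\<close>

text \<open>The supremum norm of the coordinates in a Hamel basis. Every vector has finitely many
  nonzero coordinates, so the construction also covers the algebraic closure.\<close>

lemma ultrametric_norm_exists:
  fixes av :: "'k::field \<Rightarrow> real" and scl :: "'k \<Rightarrow> 'e::ab_group_add \<Rightarrow> 'e"
  assumes "complete_ultrametric_field av" "vector_space scl"
  shows "\<exists>N. ultrametric_norm av scl N"
proof -
  interpret K: complete_ultrametric_field av by fact
  interpret V: vector_space scl by fact
  define B where "B = V.extend_basis {}"
  have B: "V.independent B" "V.span B = UNIV"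
    unfolding B_def by (auto simp: V.independent_extend_basis V.span_extend_basis V.independent_empty)
  define r where "r = V.representation B"
  have r_add: "r (x + y) b = r x b + r y b" and r_scale: "r (scl c x) b = c * r x b" for x y c b
    using B by (auto simp: r_def V.representation_add V.representation_scale)
  have r_0: "x = 0" if "\<And>b. r x b = 0" for x
    using V.sum_nonzero_representation_eq[OF B(1), of x] B(2) that by (simp add: r_def)
  \<comment> \<open>The maximum ranges over all vectors \<open>b\<close>: coordinates vanish outside
    the basis, and the range is nonempty even for an empty basis.\<close>
  define N where "N x = Max (range (\<lambda>b. av (r x b)))" for x
  have fin: "finite (range (\<lambda>b. av (r x b)))" for x
  proof -
    have "range (\<lambda>b. av (r x b)) \<subseteq> insert 0 ((\<lambda>b. av (r x b)) ` {b. r x b \<noteq> 0})"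
      by auto
    moreover have "finite {b. r x b \<noteq> 0}"
      unfolding r_def by (rule V.finite_representation)
    ultimately show ?thesis
      by (meson finite_imageI finite_insert finite_subset)
  qed
  have N_ge: "av (r x b) \<le> N x" for x b
    unfolding N_def using fin by (intro Max_ge) auto
  have N_le: "N x \<le> C" if "\<And>b. av (r x b) \<le> C" for x C
    unfolding N_def using fin that by (subst Max_le_iff) auto
  have "ultrametric_norm av scl N"
  proof
    fix x y c
    show "0 \<le> N x"
      using N_ge[of x undefined] K.av_nonneg order_trans by blast
    show "N x = 0 \<longleftrightarrow> x = 0"
    proof
      assume "N x = 0"
      then have "av (r x b) = 0" for b
        using N_ge[of x b] K.av_nonneg[of "r x b"] by simp
      then show "x = 0" by (intro r_0) (simp add: K.av_eq_0_iff)
    next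
      assume "x = 0"
      then have "r x b = 0" for b
        by (simp add: r_def V.representation_zero)
      then show "N x = 0" by (simp add: N_def)
    qed
    have "mono ((*) (av c))"
      by (intro monoI mult_left_mono K.av_nonneg)
    then have "av c * N x = Max ((*) (av c) ` range (\<lambda>b. av (r x b)))"
      unfolding N_def using fin by (intro mono_Max_commute) auto
    then show "N (scl c x) = av c * N x"
      unfolding N_def image_image r_scale K.av_mult by simp
    show "N (x + y) \<le> max (N x) (N y)"
    proof (rule N_le)
      fix b
      have "av (r (x + y) b) \<le> max (av (r x b)) (av (r y b))"
        unfolding r_add by (rule K.av_ultrametric)
      also have "\<dots> \<le> max (N x) (N y)"
        by (intro max.mono N_ge)
      finally show "av (r (x + y) b) \<le> max (N x) (N y)" .
    qed
  qed
  then show ?thesis by blast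
qed

section \<open>Direct sums of three subspaces\<close>

lemma (in vector_space) direct_sum3I:
  assumes S: "subspace S" "subspace C" "subspace U"
    and ex: "\<And>v. \<exists>x\<in>S. \<exists>y\<in>C. \<exists>z\<in>U. v = x + y + z"
    and uniq: "\<And>x y z. x \<in> S \<Longrightarrow> y \<in> C \<Longrightarrow> z \<in> U \<Longrightarrow> x + y + z = 0 \<Longrightarrow> x = 0 \<and> y = 0 \<and> z = 0"
  shows "direct_sum3 S C U"
  unfolding direct_sum3_def bij_betw_def
proof
  show "inj_on (\<lambda>(x, y, z). x + y + z) (S \<times> C \<times> U)"
  proof (rule inj_onI, clarsimp)
    fix x y z x' y' z'
    assume *: "x \<in> S" "y \<in> C" "z \<in> U" "x' \<in> S" "y' \<in> C" "z' \<in> U" "x + y + z = x' + y' + z'"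
    then have "(x - x') + (y - y') + (z - z') = 0"
      by (simp add: algebra_simps)
    then show "x = x' \<and> y = y' \<and> z = z'"
      using uniq[of "x - x'" "y - y'" "z - z'"] * S by (auto intro: subspace_diff)
  qed
  show "(\<lambda>(x, y, z). x + y + z) ` (S \<times> C \<times> U) = UNIV"
    using ex by (force simp: image_iff)
qed

lemma direct_sum3D:
  assumes "direct_sum3 S C U"
  shows "\<exists>x\<in>S. \<exists>y\<in>C. \<exists>z\<in>U. v = x + y + z"
    and "\<lbrakk>x \<in> S; y \<in> C; z \<in> U; x' \<in> S; y' \<in> C; z' \<in> U; x + y + z = x' + y' + z'\<rbrakk>
      \<Longrightarrow> x = x' \<and> y = y' \<and> z = z'"
proof -
  have "v \<in> (\<lambda>(x, y, z). x + y + z) ` (S \<times> C \<times> U)"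
    using assms by (auto simp: direct_sum3_def bij_betw_def)
  then show "\<exists>x\<in>S. \<exists>y\<in>C. \<exists>z\<in>U. v = x + y + z"
    by auto
  have inj: "inj_on (\<lambda>(x, y, z). x + y + z) (S \<times> C \<times> U)"
    using assms by (auto simp: direct_sum3_def bij_betw_def)
  show "\<lbrakk>x \<in> S; y \<in> C; z \<in> U; x' \<in> S; y' \<in> C; z' \<in> U; x + y + z = x' + y' + z'\<rbrakk>
      \<Longrightarrow> x = x' \<and> y = y' \<and> z = z'"
    using inj_onD[OF inj, of "(x, y, z)" "(x', y', z')"] by auto
qed

text \<open>Each summand may bring its own adapted norm; the maximum identity required of the final
  norm holds by construction.\<close>

lemma (in vector_space) ultrametric_norm_direct_sum3:
  assumes S: "subspace S" "subspace C" "subspace U" and sum: "direct_sum3 S C U"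
    and N: "ultrametric_norm av scale N1" "ultrametric_norm av scale N2" "ultrametric_norm av scale N3"
    and av: "absolute_value av"
  shows "\<exists>N. ultrametric_norm av scale N \<and>
    (\<forall>x\<in>S. \<forall>y\<in>C. \<forall>z\<in>U. N (x + y + z) = max (N1 x) (max (N2 y) (N3 z)))"
proof -
  interpret N1: ultrametric_norm av scale N1 by fact
  interpret N2: ultrametric_norm av scale N2 by fact
  interpret N3: ultrametric_norm av scale N3 by fact
  interpret av: absolute_value av by fact
  note ex = direct_sum3D(1)[OF sum] and uniq = direct_sum3D(2)[OF sum]
  define N where "N v = (THE r. \<exists>x\<in>S. \<exists>y\<in>C. \<exists>z\<in>U. v = x + y + z \<and> r = max (N1 x) (max (N2 y) (N3 z)))" for v
  have N: "N (x + y + z) = max (N1 x) (max (N2 y) (N3 z))" if "x \<in> S" "y \<in> C" "z \<in> U" for x y z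
    unfolding N_def using that by (intro the_equality) (blast, metis uniq)
  have "ultrametric_norm av scale N"
  proof
    fix v w c
    obtain x y z where v: "x \<in> S" "y \<in> C" "z \<in> U" "v = x + y + z"
      using ex[of v] by blast
    obtain x' y' z' where w: "x' \<in> S" "y' \<in> C" "z' \<in> U" "w = x' + y' + z'"
      using ex[of w] by blast
    show "0 \<le> N v"
      using v by (simp add: N le_max_iff_disj N1.N_nonneg)
    have "N v = 0 \<longleftrightarrow> N1 x = 0 \<and> N2 y = 0 \<and> N3 z = 0"
      using v N1.N_nonneg[of x] N2.N_nonneg[of y] N3.N_nonneg[of z] by (auto simp: N)
    also have "\<dots> \<longleftrightarrow> x = 0 \<and> y = 0 \<and> z = 0"
      by (simp add: N1.N_eq_0_iff N2.N_eq_0_iff N3.N_eq_0_iff)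
    also have "\<dots> \<longleftrightarrow> v = 0"
      using uniq[of x y z 0 0 0] v S by (auto simp: subspace_0)
    finally show "N v = 0 \<longleftrightarrow> v = 0" .
    have "scale c v = scale c x + scale c y + scale c z"
      by (simp add: v scale_right_distrib)
    then have "N (scale c v) = max (av c * N1 x) (max (av c * N2 y) (av c * N3 z))"
      using v S by (simp add: N subspace_scale N1.N_scale N2.N_scale N3.N_scale)
    also have "\<dots> = av c * N v"
      using v av.av_nonneg[of c] by (simp add: N max_mult_distrib_left)
    finally show "N (scale c v) = av c * N v" .
    have vw: "v + w = (x + x') + (y + y') + (z + z')"
      by (simp add: v w algebra_simps)
    have "N (v + w) = max (N1 (x + x')) (max (N2 (y + y')) (N3 (z + z')))"
      unfolding vw using v w S by (intro N subspace_add)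
    also have "\<dots> \<le> max (max (N1 x) (N1 x')) (max (max (N2 y) (N2 y')) (max (N3 z) (N3 z')))"
      by (intro max.mono N1.N_ultrametric N2.N_ultrametric N3.N_ultrametric)
    also have "\<dots> = max (N v) (N w)"
      using v w by (simp only: N max.assoc max.commute max.left_commute)
    finally show "N (v + w) \<le> max (N v) (N w)" .
  qed
  then show ?thesis using N by blast
qed

lemma (in finite_dimensional_vector_space) linear_inj_on_imp_surj_on:
  assumes h: "Vector_Spaces.linear scale scale h" and S: "subspace S" "h ` S \<subseteq> S" "inj_on h S"
  shows "h ` S = S"
proof -
  interpret finite_dimensional_vector_space_pair_1 scale Basis scale ..
  interpret h: Vector_Spaces.linear scale scale h by fact
  have span_S: "span S = S"
    using S(1) by (simp add: span_eq_iff)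
  have "dim (h ` S) = dim S"
    by (intro dim_image_eq[OF h]) (unfold span_S, fact S)
  then show ?thesis
    using S h.subspace_image by (intro subspace_dim_equal) auto
qed

section \<open>Kernels of polynomials with separated slopes\<close>

context ultrametric_operator
begin

lemma poly_op_vec_minus: "poly_op q (- x) = - poly_op q x"
  using poly_op_vec_scale[of q "-1" x] by simp

lemma poly_op_vec_diff: "poly_op q (x - y) = poly_op q x - poly_op q y"
  using poly_op_vec_add[of q x "- y"] by (simp add: poly_op_vec_minus)

lemma poly_ker_poly_op: "x \<in> poly_ker f \<Longrightarrow> poly_op g x \<in> poly_ker f"
  by (simp add: poly_ker_def poly_op_commute[of f g])

lemma poly_ker_funpow: "x \<in> poly_ker f \<Longrightarrow> (\<alpha> ^^ i) x \<in> poly_ker f"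
  using invariant_funpow invariant_poly_ker by blast

text \<open>The substitute for coprimality of \<open>f\<close> and \<open>g\<close>: in the norm
  adapted to \<open>f\<close> the operator enlarges vectors on the orbit of \<open>x\<close> by at
  most the factor \<open>b\<close>, and a polynomial that is large for some \<open>c > b\<close>
  then forces \<open>x = 0\<close>.\<close>

lemma small_large_ker_disjoint:
  assumes "small b f" "large c g" "b < c" "poly_op f x = 0" "poly_op g x = 0"
  shows "x = 0"
proof -
  obtain N where N: "ultrametric_norm av scl N"
    using ultrametric_norm_exists complete_ultrametric_field_axioms vs1.vector_space_axioms by blast
  have b: "0 < b" using assms by (simp add: small_def)
  show ?thesis
  proof (rule large_contracting_imp_0[OF ultrametric_cyc_norm[OF N b] assms(2,5) _ assms(3)])
    fix i
    show "cyc_norm N b (Polynomial.degree f - 1) (\<alpha> ((\<alpha> ^^ i) x))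
        \<le> b * cyc_norm N b (Polynomial.degree f - 1) ((\<alpha> ^^ i) x)"
      using cyc_norm_small[OF N assms(1)] poly_ker_funpow[of x f i] assms(4) by (simp add: poly_ker_def)
  qed (use b in simp)
qed

text \<open>A linear relation among the first \<open>d\<close> iterates is a polynomial of degree
  less than \<open>d\<close> annihilating \<open>x\<close>. This yields annihilating polynomials in
  finite dimension, and later a coordinate functional on the orbit.\<close>

lemma krylov_independent:
  assumes nz: "\<And>q. q \<noteq> 0 \<Longrightarrow> Polynomial.degree q < d \<Longrightarrow> poly_op q x \<noteq> 0"
  shows "inj_on (\<lambda>i. (\<alpha> ^^ i) x) {..<d}" "vs1.independent ((\<lambda>i. (\<alpha> ^^ i) x) ` {..<d})"
proof -
  let ?v = "\<lambda>i. (\<alpha> ^^ i) x"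
  have indep: "c j = 0" if c: "(\<Sum>i<d. scl (c i) (?v i)) = 0" "j < d" for c j
  proof -
    let ?q = "\<Sum>i<d. Polynomial.monom (c i) i"
    have coeff: "Polynomial.coeff ?q i = (if i < d then c i else 0)" for i
      by (simp add: coeff_sum)
    have deg: "Polynomial.degree ?q < d"
    proof -
      have "Polynomial.degree ?q \<le> d - 1"
        using c(2) by (intro degree_le) (auto simp: coeff)
      then show ?thesis using c(2) by linarith
    qed
    have "poly_op ?q x = (\<Sum>i\<le>d - 1. scl (Polynomial.coeff ?q i) (?v i))"
      by (rule poly_op_altdef) (use deg in simp)
    also have "\<dots> = (\<Sum>i<d. scl (c i) (?v i))"
      by (rule sum.cong) (use c(2) in \<open>auto simp: coeff\<close>)
    finally have "?q = 0"
      using nz[OF _ deg] c(1) by auto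
    then show ?thesis
      using coeff[of j] c(2) by simp
  qed
  show inj: "inj_on ?v {..<d}"
  proof (rule inj_onI, rule ccontr)
    fix i j assume ij: "i \<in> {..<d}" "j \<in> {..<d}" "?v i = ?v j" "i \<noteq> j"
    let ?c = "\<lambda>k. if k = i then 1 else if k = j then -1 else 0 :: 'k"
    have "(\<Sum>k<d. scl (?c k) (?v k)) = (\<Sum>k\<in>{i, j}. scl (?c k) (?v k))"
      using ij by (intro sum.mono_neutral_right) auto
    also have "\<dots> = 0"
      using ij by simp
    finally show False
      using indep[of ?c i] ij by simp
  qed
  show "vs1.independent (?v ` {..<d})"
    unfolding vs1.dependent_finite[OF finite_imageI[OF finite_lessThan]]
  proof (safe, simp)
    fix u j assume u: "(\<Sum>v\<in>?v ` {..<d}. scl (u v) v) = 0" "j < d" "u (?v j) \<noteq> 0"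
    have "(\<Sum>i<d. scl (u (?v i)) (?v i)) = 0"
      using u(1) by (simp add: sum.reindex[OF inj])
    then show False
      using indep[of "\<lambda>i. u (?v i)" j] u(2,3) by simp
  qed
qed

end

locale fin_dim_ultrametric_operator =
  ultrametric_operator av scl \<alpha> + fd: finite_dimensional_vector_space scl Basis
  for av :: "'k::field \<Rightarrow> real" and scl :: "'k \<Rightarrow> 'e::ab_group_add \<Rightarrow> 'e"
    and \<alpha> :: "'e \<Rightarrow> 'e" and Basis :: "'e set"
begin

lemma annihilating_poly_vector: "\<exists>q. Polynomial.lead_coeff q = 1 \<and> poly_op q x = 0"
proof (rule ccontr)
  assume no: "\<not> ?thesis"
  have nz: "poly_op q x \<noteq> 0" if "q \<noteq> 0" for q
  proof
    assume "poly_op q x = 0"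
    then have "poly_op (Polynomial.smult (inverse (Polynomial.lead_coeff q)) q) x = 0"
      by (simp add: poly_op_smult)
    moreover have "Polynomial.lead_coeff (Polynomial.smult (inverse (Polynomial.lead_coeff q)) q) = 1"
      using that by simp
    ultimately show False using no by blast
  qed
  let ?d = "Suc (card Basis)" and ?v = "\<lambda>i. (\<alpha> ^^ i) x"
  have inj: "inj_on ?v {..<?d}" and ind: "vs1.independent (?v ` {..<?d})"
    using krylov_independent[of ?d x] nz by auto
  have "card (?v ` {..<?d}) \<le> card Basis"
    using fd.independent_card_le_dim[OF _ ind, of UNIV] fd.dim_UNIV by simp
  then show False
    using card_image[OF inj] by simp
qed

text \<open>The product of annihilators of the basis vectors kills the whole space.\<close>

lemma annihilating_poly: "\<exists>q. Polynomial.lead_coeff q = 1 \<and> (\<forall>x. poly_op q x = 0)"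
proof -
  have "\<exists>q. Polynomial.lead_coeff q = 1 \<and> (\<forall>x\<in>B. poly_op q x = 0)" if "finite B" for B
    using that
  proof (induction B rule: finite_induct)
    case empty
    then show ?case by (intro exI[of _ 1]) simp
  next
    case (insert b B)
    then obtain q where q: "Polynomial.lead_coeff q = 1" "\<forall>x\<in>B. poly_op q x = 0" by blast
    obtain p where p: "Polynomial.lead_coeff p = 1" "poly_op p b = 0"
      using annihilating_poly_vector by blast
    have "poly_op (q * p) x = 0" if "x \<in> insert b B" for x
      using that p q by (metis poly_op_commute poly_op_mult poly_op_vec_0 insertE)
    moreover have "Polynomial.lead_coeff (q * p) = 1"
      using p q unfolding lead_coeff_mult by simp
    ultimately show ?case by blast
  qed
  then obtain q where q: "Polynomial.lead_coeff q = 1" "\<forall>x\<in>Basis. poly_op q x = 0"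
    using fd.finite_Basis by blast
  then have "vs1.span Basis \<subseteq> poly_ker q"
    using invariant_poly_ker[of q] by (intro vs1.span_minimal) (auto simp: poly_ker_def invariant_subspace_def)
  then show ?thesis
    using q(1) fd.span_Basis by (auto simp: poly_ker_def)
qed

text \<open>In place of a Bezout relation: \<open>poly_op g\<close> is injective on
  \<open>poly_ker f\<close>, hence onto by finite dimension. A vector \<open>y\<close> of
  \<open>poly_ker f\<close> with the same image as \<open>x\<close> leaves \<open>x - y\<close> in
  \<open>poly_ker g\<close>.\<close>

lemma poly_ker_mult_decompose:
  assumes fg: "small b f" "large c g" "b < c" and x: "poly_op (f * g) x = 0"
  shows "\<exists>y\<in>poly_ker f. \<exists>z\<in>poly_ker g. x = y + z"
proof -
  have S: "vs1.subspace (poly_ker f)"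
    using invariant_poly_ker by (simp add: invariant_subspace_def)
  have "inj_on (poly_op g) (poly_ker f)"
  proof (rule inj_onI)
    fix y z assume *: "y \<in> poly_ker f" "z \<in> poly_ker f" "poly_op g y = poly_op g z"
    have "poly_op g (y - z) = 0"
      using * poly_op_vec_diff by simp
    moreover have "poly_op f (y - z) = 0"
      using vs1.subspace_diff[OF S *(1,2)] by (simp add: poly_ker_def)
    ultimately show "y = z"
      using small_large_ker_disjoint[OF fg] by force
  qed
  then have "poly_op g ` poly_ker f = poly_ker f"
    using S poly_ker_poly_op by (intro fd.linear_inj_on_imp_surj_on linear_poly_op) auto
  moreover have "poly_op g x \<in> poly_ker f"
    using x by (simp add: poly_ker_def poly_op_mult)
  ultimately obtain y where y: "y \<in> poly_ker f" "poly_op g x = poly_op g y"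
    by (metis imageE)
  then have "x - y \<in> poly_ker g"
    using poly_op_vec_diff by (simp add: poly_ker_def)
  then show ?thesis
    using y(1) by (metis add.commute diff_add_cancel)
qed

text \<open>The summands are the kernels of the three slope factors of an annihilating polynomial,
  split off in two steps: \<open>f\<close> from \<open>g * h\<close>, then \<open>g\<close> from
  \<open>h\<close>. Each kernel carries the cyclic norm of its own factor.\<close>

theorem spectral_splitting:
  assumes "0 < a"
  obtains Es Ec Eu N b c where
    "invariant_subspace scl \<alpha> Es" "invariant_subspace scl \<alpha> Ec" "invariant_subspace scl \<alpha> Eu"
    "direct_sum3 Es Ec Eu" "ultrametric_norm av scl N"
    "\<And>x y z. x \<in> Es \<Longrightarrow> y \<in> Ec \<Longrightarrow> z \<in> Eu \<Longrightarrow> N (x + y + z) = max (N x) (max (N y) (N z))"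
    "0 < b" "b < a" "a < c"
    "\<And>x. x \<in> Es \<Longrightarrow> N (\<alpha> x) \<le> b * N x"
    "\<And>x. x \<in> Ec \<Longrightarrow> N (\<alpha> x) = a * N x"
    "\<And>x. x \<in> Eu \<Longrightarrow> c * N x \<le> N (\<alpha> x)"
proof -
  obtain q where q: "Polynomial.lead_coeff q = 1" "\<And>x. poly_op q x = 0"
    using annihilating_poly by blast
  obtain f g h b c where fgh: "q = f * g * h" "0 < b" "b < a" "a < c" "small b f" "flat a g" "large c h"
    using slope_factorization[OF assms q(1)] by blast
  have g: "small a g" "large a g" using fgh by (auto simp: flat_iff)
  \<comment> \<open>Lowering the radius of \<open>h\<close> from \<open>c\<close> to
    \<open>a\<close> makes the whole product large at \<open>a\<close>; the gap that splits off
    \<open>f\<close> is then \<open>b < a\<close>.\<close>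
  have gh: "large a (g * h)"
    using g fgh assms by (intro large_mult large_mono[of c h a]) auto
  let ?S = "poly_ker f" and ?C = "poly_ker g" and ?U = "poly_ker h"
  note inv = invariant_poly_ker
  have sub: "vs1.subspace (poly_ker p)" for p
    using inv by (simp add: invariant_subspace_def)
  have sum: "direct_sum3 ?S ?C ?U"
  proof (rule vs1.direct_sum3I[OF sub sub sub])
    fix v
    have "poly_op (f * (g * h)) v = 0"
      using q(2) fgh(1) by (simp add: mult.assoc)
    then obtain x w where x: "x \<in> ?S" "w \<in> poly_ker (g * h)" "v = x + w"
      using poly_ker_mult_decompose[OF fgh(5) gh fgh(3)] by blast
    then have "poly_op (g * h) w = 0" by (simp add: poly_ker_def)
    then obtain y z where "y \<in> ?C" "z \<in> ?U" "w = y + z"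
      using poly_ker_mult_decompose[OF g(1) fgh(7,4)] by blast
    then show "\<exists>x\<in>?S. \<exists>y\<in>?C. \<exists>z\<in>?U. v = x + y + z"
      using x by (metis add.assoc)
  next
    fix x y z assume *: "x \<in> ?S" "y \<in> ?C" "z \<in> ?U" "x + y + z = 0"
    have "poly_op (g * h) (y + z) = 0"
      using *(2,3) by (simp add: poly_op_vec_add poly_ker_def poly_op_mult)
        (metis poly_op_commute poly_op_vec_0)
    moreover have "x = - (y + z)"
      using *(4) by (metis add.assoc eq_neg_iff_add_eq_0)
    ultimately have "poly_op (g * h) x = 0"
      by (simp only: poly_op_vec_minus) simp
    then have "x = 0"
      using small_large_ker_disjoint[OF fgh(5) gh fgh(3)] *(1) by (simp add: poly_ker_def)
    then have "y = - z"
      using *(4) by (simp add: eq_neg_iff_add_eq_0)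
    then have "poly_op h y = 0"
      using *(3) poly_op_vec_minus by (simp add: poly_ker_def)
    then have "y = 0"
      using small_large_ker_disjoint[OF g(1) fgh(7,4)] *(2) by (simp add: poly_ker_def)
    then show "x = 0 \<and> y = 0 \<and> z = 0"
      using \<open>x = 0\<close> \<open>y = - z\<close> by simp
  qed
  obtain N0 where N0: "ultrametric_norm av scl N0"
    using ultrametric_norm_exists complete_ultrametric_field_axioms vs1.vector_space_axioms by blast
  let ?N1 = "cyc_norm N0 b (Polynomial.degree f - 1)"
  let ?N2 = "cyc_norm N0 a (Polynomial.degree g - 1)"
  let ?N3 = "cyc_norm N0 c (Polynomial.degree h - 1)"
  have norms: "ultrametric_norm av scl ?N1" "ultrametric_norm av scl ?N2" "ultrametric_norm av scl ?N3"
    using ultrametric_cyc_norm[OF N0] fgh assms by auto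
  obtain N where N: "ultrametric_norm av scl N"
    "\<And>x y z. x \<in> ?S \<Longrightarrow> y \<in> ?C \<Longrightarrow> z \<in> ?U \<Longrightarrow> N (x + y + z) = max (?N1 x) (max (?N2 y) (?N3 z))"
    using vs1.ultrametric_norm_direct_sum3[OF sub sub sub sum norms absolute_value_axioms] by blast
  have zeros: "0 \<in> ?S" "0 \<in> ?C" "0 \<in> ?U" "?N1 0 = 0" "?N2 0 = 0" "?N3 0 = 0"
    "0 \<le> ?N1 x" "0 \<le> ?N2 x" "0 \<le> ?N3 x" for x
    using norms by (auto simp: poly_ker_def ultrametric_norm.N_eq_0_iff ultrametric_norm.N_nonneg)
  have NS: "N x = ?N1 x" if "x \<in> ?S" for x
    using N(2)[of x 0 0] that zeros by (simp add: max_absorb1 max_absorb2)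
  have NC: "N x = ?N2 x" if "x \<in> ?C" for x
    using N(2)[of 0 x 0] that zeros by (simp add: max_absorb1 max_absorb2)
  have NU: "N x = ?N3 x" if "x \<in> ?U" for x
    using N(2)[of 0 0 x] that zeros by (simp add: max_absorb1 max_absorb2)
  have \<alpha>: "\<alpha> x \<in> poly_ker p" if "x \<in> poly_ker p" for x p
    using inv that by (auto simp: invariant_subspace_def)
  show ?thesis
  proof (rule that[OF inv inv inv sum N(1) _ fgh(2-4)])
    show "N (x + y + z) = max (N x) (max (N y) (N z))" if "x \<in> ?S" "y \<in> ?C" "z \<in> ?U" for x y z
      using that by (simp add: N(2) NS NC NU)
    show "N (\<alpha> x) \<le> b * N x" if "x \<in> ?S" for x
      using cyc_norm_small[OF N0 fgh(5)] that by (simp add: NS \<alpha>) (simp add: poly_ker_def)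
    show "N (\<alpha> x) = a * N x" if "x \<in> ?C" for x
      using cyc_norm_small[OF N0 g(1), of x] cyc_norm_large[OF N0 g(2), of x] that
      by (simp add: NC \<alpha>) (simp add: poly_ker_def)
    show "c * N x \<le> N (\<alpha> x)" if "x \<in> ?U" for x
      using cyc_norm_large[OF N0 fgh(7)] that by (simp add: NU \<alpha>) (simp add: poly_ker_def)
  qed
qed

end

section \<open>Extension of the absolute value to the algebraic closure\<close>

lemma linear_le_power:
  fixes t :: real
  assumes "1 < t"
  shows "\<exists>n. of_nat n + 1 < t ^ n"
proof -
  define d where "d = t - 1"
  have d: "0 < d" using assms by (simp add: d_def)
  \<comment> \<open>Bernoulli's inequality alone grows linearly, so it is squared, giving exponent
    \<open>2 * n\<close>. The constant 3 absorbs \<open>2 * n + 1\<close>, which is at most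
    \<open>3 * n\<close>.\<close>
  obtain n :: nat where n: "3 < of_nat n * d\<^sup>2"
    using d by (metis reals_Archimedean3 zero_less_power)
  then have "n \<noteq> 0" by (cases "n = 0") auto
  have "of_nat n * d \<le> (1 + d) ^ n"
    using Bernoulli_inequality[of d n] d by simp
  then have "(of_nat n * d)\<^sup>2 \<le> ((1 + d) ^ n)\<^sup>2"
    using d by (intro power_mono) auto
  moreover have "t ^ (2 * n) = t ^ n * t ^ n"
    by (simp add: mult_2 power_add)
  ultimately have "of_nat n * (of_nat n * d\<^sup>2) \<le> t ^ (2 * n)"
    by (simp add: d_def power2_eq_square mult_ac)
  moreover have "of_nat n * 3 < of_nat n * (of_nat n * d\<^sup>2)"
    using n \<open>n \<noteq> 0\<close> by (intro mult_strict_left_mono) auto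
  moreover have "of_nat (2 * n) + 1 \<le> (of_nat n * 3 :: real)"
    using \<open>n \<noteq> 0\<close> by simp
  ultimately have "of_nat (2 * n) + 1 < t ^ (2 * n)"
    by linarith
  then show ?thesis by blast
qed

context complete_ultrametric_field
begin

section \<open>Multiplication operators on the algebraic closure\<close>

abbreviation ac_scale :: "'k \<Rightarrow> 'k alg_closure \<Rightarrow> 'k alg_closure" where
  "ac_scale \<equiv> \<lambda>c v. to_ac c * v"

lemma vector_space_ac: "vector_space ac_scale"
  by unfold_locales (auto simp: algebra_simps)

lemma ac_mult_operator: "ultrametric_operator av ac_scale ((*) z)"
proof -
  interpret vector_space ac_scale by (rule vector_space_ac)
  show ?thesis
    by unfold_locales (auto simp: algebra_simps)
qed

abbreviation ac_eval :: "'k poly \<Rightarrow> 'k alg_closure \<Rightarrow> 'k alg_closure" where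
  "ac_eval q z \<equiv> poly (map_poly to_ac q) z"

text \<open>Consequently a polynomial with root \<open>z\<close> annihilates every vector, and the
  operator estimates apply to multiplication by \<open>z\<close>.\<close>

lemma ac_poly_op: "ultrametric_operator.poly_op ac_scale ((*) z) q v = ac_eval q z * v"
proof -
  interpret ultrametric_operator av ac_scale "(*) z" by (rule ac_mult_operator)
  show ?thesis
    by (induction q) (auto simp: poly_op_pCons map_poly_pCons distrib_right mult.assoc)
qed

lemma ac_eval_mult: "ac_eval (p * q) z = ac_eval p z * ac_eval q z"
proof -
  interpret ultrametric_operator av ac_scale "(*) z" by (rule ac_mult_operator)
  show ?thesis
    using poly_op_mult[of p q 1] by (simp add: ac_poly_op)
qed

text \<open>A monic polynomial of least degree with root \<open>z\<close> is not divisible by X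
  because \<open>z \<noteq> 0\<close>, and no proper factor can have the root \<open>z\<close>; so
  it must be flat.\<close>

lemma flat_root_exists:
  assumes "z \<noteq> 0"
  shows "\<exists>r q. flat r q \<and> ac_eval q z = 0"
proof -
  let ?P = "\<lambda>q. Polynomial.lead_coeff q = 1 \<and> ac_eval q z = 0"
  obtain p :: "'k poly" where p: "p \<noteq> 0" "ac_eval p z = 0"
    by (rule alg_closure_algebraic)
  let ?c = "inverse (Polynomial.lead_coeff p)"
  have "ac_eval ([:?c:] * p) z = 0"
    unfolding ac_eval_mult p(2) by simp
  moreover have "Polynomial.lead_coeff ([:?c:] * p) = 1"
    using p(1) unfolding lead_coeff_mult by simp
  ultimately obtain q where q: "?P q" and min: "\<And>q'. ?P q' \<Longrightarrow> Polynomial.degree q \<le> Polynomial.degree q'"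
    using ex_has_least_nat[of ?P _ Polynomial.degree] by blast
  have deg: "0 < Polynomial.degree q"
  proof (rule ccontr)
    assume "\<not> 0 < Polynomial.degree q"
    then have "q = 1" using q by (metis degree_0_id one_pCons gr0I)
    then show False using q by simp
  qed
  have c0: "Polynomial.coeff q 0 \<noteq> 0"
  proof
    assume "Polynomial.coeff q 0 = 0"
    then obtain p where p: "q = Polynomial.pCons 0 p" by (cases q) auto
    then have "p \<noteq> 0" using deg by auto
    moreover have "ac_eval p z = 0"
      using q assms by (auto simp: p map_poly_pCons)
    ultimately have "?P p" "Polynomial.degree q = Suc (Polynomial.degree p)"
      using q by (auto simp: p)
    then show False using min[of p] by simp
  qed
  show ?thesis
  proof (rule disjE[OF flat_or_reducible[OF _ deg c0]])
    assume "\<exists>g h. q = g * h \<and> Polynomial.lead_coeff g = 1 \<and> Polynomial.lead_coeff h = 1 \<and>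
      0 < Polynomial.degree g \<and> 0 < Polynomial.degree h"
    then obtain g h where gh: "q = g * h" "Polynomial.lead_coeff g = 1" "Polynomial.lead_coeff h = 1"
      "0 < Polynomial.degree g" "0 < Polynomial.degree h" by blast
    then have d: "Polynomial.degree q = Polynomial.degree g + Polynomial.degree h"
      by (metis degree_0 degree_mult_eq less_irrefl)
    have "ac_eval g z = 0 \<or> ac_eval h z = 0"
      using q unfolding gh(1) ac_eval_mult by simp
    then show ?thesis
      using min[of g] min[of h] gh d by auto
  qed (use q in auto)
qed

text \<open>The choice is harmless: a flat polynomial of radius r with root \<open>z\<close> yields
  a norm that multiplication by \<open>z\<close> scales by r, and \<open>ac_abs_eqI\<close>
  identifies r. The element 0 is set apart because it is no root of a flat polynomial.\<close>

definition ac_abs :: "'k alg_closure \<Rightarrow> real" where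
  "ac_abs z = (if z = 0 then 0 else SOME r. \<exists>q. flat r q \<and> ac_eval q z = 0)"

lemma ac_abs_flat: "z \<noteq> 0 \<Longrightarrow> \<exists>q. flat (ac_abs z) q \<and> ac_eval q z = 0"
  unfolding ac_abs_def using someI_ex[OF flat_root_exists[of z]] by auto

lemma ac_abs_pos: "z \<noteq> 0 \<Longrightarrow> 0 < ac_abs z"
  using ac_abs_flat[of z] by (auto simp: flat_def)

lemma ac_abs_0 [simp]: "ac_abs 0 = 0"
  by (simp add: ac_abs_def)

lemma ac_abs_nonneg: "0 \<le> ac_abs z"
  using ac_abs_pos[of z] by (cases "z = 0") auto

text \<open>The new norm is a maximum over powers of \<open>z\<close>, which commute with every
  \<open>y\<close>; exact scaling by \<open>y\<close> is therefore inherited, and a norm can be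
  adapted to several elements in turn.\<close>

lemma ac_norm_adapt:
  assumes N: "ultrametric_norm av ac_scale N"
  shows "\<exists>N'. ultrametric_norm av ac_scale N' \<and> (\<forall>v. N' (z * v) = ac_abs z * N' v) \<and>
    (\<forall>y s. 0 \<le> s \<longrightarrow> (\<forall>v. N (y * v) = s * N v) \<longrightarrow> (\<forall>v. N' (y * v) = s * N' v))"
proof (cases "z = 0")
  case True
  then show ?thesis
    using N by (intro exI[of _ N]) (auto simp: ultrametric_norm.N_eq_0_iff[OF N])
next
  case False
  interpret ultrametric_operator av ac_scale "(*) z" by (rule ac_mult_operator)
  obtain q where q: "flat (ac_abs z) q" "ac_eval q z = 0"
    using ac_abs_flat[OF False] by blast
  let ?M = "cyc_norm N (ac_abs z) (Polynomial.degree q - 1)"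
  have root: "poly_op q v = 0" for v
    using q(2) by (simp add: ac_poly_op)
  have "?M (z * v) = ac_abs z * ?M v" for v
    using cyc_norm_small[OF N _ root[of v]] cyc_norm_large[OF N _ root[of v]] q(1)
    by (auto simp: flat_iff intro: antisym)
  moreover have "?M (y * v) = s * ?M v" if "0 \<le> s" "\<forall>v. N (y * v) = s * N v" for y s v
  proof (rule cyc_norm_cmult[OF N that(1)])
    fix i
    have "((*) z ^^ i) (y * v) = y * ((*) z ^^ i) v"
      by (induction i) (auto simp: mult_ac)
    then show "N (((*) z ^^ i) (y * v)) = s * N (((*) z ^^ i) v)"
      using that(2) by simp
  qed
  ultimately show ?thesis
    using ultrametric_cyc_norm[OF N ac_abs_pos[OF False]] by blast
qed

lemma ac_norm_adapt2:
  "\<exists>N. ultrametric_norm av ac_scale N \<and> (\<forall>v. N (x * v) = ac_abs x * N v) \<and> (\<forall>v. N (y * v) = ac_abs y * N v)"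
proof -
  obtain N0 where "ultrametric_norm av ac_scale N0"
    using ultrametric_norm_exists complete_ultrametric_field_axioms vector_space_ac by blast
  then obtain N1 where N1: "ultrametric_norm av ac_scale N1" "\<forall>v. N1 (x * v) = ac_abs x * N1 v"
    using ac_norm_adapt[of N0 x] by blast
  then show ?thesis
    using ac_norm_adapt[OF N1(1), of y] ac_abs_nonneg by blast
qed

lemma small_root_bound:
  assumes N: "ultrametric_norm av ac_scale N" "\<And>v. s * N v \<le> N (z * v)"
    and q: "small b q" "ac_eval q z = 0"
  shows "s \<le> b"
proof (rule ccontr)
  interpret ultrametric_operator av ac_scale "(*) z" by (rule ac_mult_operator)
  assume "\<not> s \<le> b"
  then have "(1 :: 'k alg_closure) = 0"
    using small_expanding_imp_0[OF N(1) q(1), of 1 s] q(2) N(2) by (simp add: ac_poly_op)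
  then show False by simp
qed

lemma large_root_bound:
  assumes N: "ultrametric_norm av ac_scale N" "\<And>v. N (z * v) \<le> s * N v" "0 \<le> s"
    and q: "large b q" "ac_eval q z = 0"
  shows "b \<le> s"
proof (rule ccontr)
  interpret ultrametric_operator av ac_scale "(*) z" by (rule ac_mult_operator)
  assume "\<not> b \<le> s"
  then have "(1 :: 'k alg_closure) = 0"
    using large_contracting_imp_0[OF N(1) q(1), of 1 s] q(2) N(2,3) by (simp add: ac_poly_op)
  then show False by simp
qed

lemma ac_abs_le:
  assumes "ultrametric_norm av ac_scale N" "\<And>v. N (z * v) \<le> s * N v" "0 \<le> s"
  shows "ac_abs z \<le> s"
proof (cases "z = 0")
  case False
  then show ?thesis
    using ac_abs_flat[OF False] large_root_bound[OF assms] by (auto simp: flat_iff)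
qed (use assms in simp)

text \<open>A flat polynomial with root \<open>z\<close> bounds \<open>s\<close> from both sides.
  Multiplicativity, the extension property and uniqueness all reduce to exhibiting a norm that
  \<open>z\<close> scales exactly.\<close>

lemma ac_abs_eqI:
  assumes N: "ultrametric_norm av ac_scale N" "\<And>v. N (z * v) = s * N v" "0 \<le> s"
  shows "ac_abs z = s"
proof (cases "z = 0")
  case True
  have "N 1 \<noteq> 0"
    using ultrametric_norm.N_eq_0_iff[OF N(1), of 1] by simp
  moreover have "N 0 = 0"
    using ultrametric_norm.N_eq_0_iff[OF N(1), of 0] by simp
  ultimately show ?thesis
    using N(2)[of 1] True by simp
next
  case False
  then show ?thesis
    using ac_abs_flat[OF False] small_root_bound[OF N(1), of s z] ac_abs_le[OF N(1), of z s] N(2,3)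
    by (fastforce simp: flat_iff)
qed

lemma ac_abs_mult: "ac_abs (x * y) = ac_abs x * ac_abs y"
proof -
  obtain N where N: "ultrametric_norm av ac_scale N" "\<And>v. N (x * v) = ac_abs x * N v" "\<And>v. N (y * v) = ac_abs y * N v"
    using ac_norm_adapt2 by metis
  show ?thesis
    by (rule ac_abs_eqI[OF N(1)]) (auto simp: N(2,3) mult.assoc ac_abs_nonneg)
qed

lemma ac_abs_ultrametric: "ac_abs (x + y) \<le> max (ac_abs x) (ac_abs y)"
proof -
  obtain N where N: "ultrametric_norm av ac_scale N" "\<And>v. N (x * v) = ac_abs x * N v" "\<And>v. N (y * v) = ac_abs y * N v"
    using ac_norm_adapt2 by metis
  interpret N: ultrametric_norm av ac_scale N by (rule N(1))
  show ?thesis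
  proof (rule ac_abs_le[OF N(1)])
    fix v
    have "N ((x + y) * v) \<le> max (N (x * v)) (N (y * v))"
      unfolding distrib_right by (rule N.N_ultrametric)
    also have "\<dots> = max (ac_abs x) (ac_abs y) * N v"
      unfolding N(2,3) using N.N_nonneg[of v] by (simp add: max_mult_distrib_right)
    finally show "N ((x + y) * v) \<le> max (ac_abs x) (ac_abs y) * N v" .
  qed (simp add: ac_abs_nonneg le_max_iff_disj)
qed

lemma ac_abs_to_ac: "ac_abs (to_ac c) = av c"
proof -
  obtain N where N: "ultrametric_norm av ac_scale N"
    using ac_norm_adapt2 by metis
  show ?thesis
    by (rule ac_abs_eqI[OF N]) (auto simp: ultrametric_norm.N_scale[OF N] av_nonneg)
qed

lemma absolute_value_ac_abs: "absolute_value ac_abs"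
proof
  fix x y
  show "ac_abs x = 0 \<longleftrightarrow> x = 0"
    by (metis ac_abs_0 ac_abs_pos less_irrefl)
  have "max (ac_abs x) (ac_abs y) \<le> ac_abs x + ac_abs y"
    using ac_abs_nonneg[of x] ac_abs_nonneg[of y] by simp
  then show "ac_abs (x + y) \<le> ac_abs x + ac_abs y"
    using ac_abs_ultrametric[of x y] by linarith
qed (simp_all add: ac_abs_nonneg ac_abs_mult)

section \<open>Uniqueness of the extension\<close>

lemma av_of_nat_le_1: "av (of_nat n) \<le> 1"
proof (induction n)
  case (Suc n)
  then show ?case
    using av_ultrametric[of 1 "of_nat n"] by simp
qed simp

text \<open>The definition of the extension admits every absolute value with the ordinary triangle
  inequality. Since \<open>w\<close> is at most 1 on binomial coefficients, the binomial expansion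
  bounds \<open>w (x + y) ^ n\<close> by \<open>(n + 1) * m ^ n\<close>, which fails for some n if
  \<open>m < w (x + y)\<close>.\<close>

lemma extension_ultrametric:
  assumes w: "absolute_value w" "\<And>c. w (to_ac c) = av c"
  shows "w (x + y) \<le> max (w x) (w y)"
proof (rule ccontr)
  interpret w: absolute_value w by fact
  define m where "m = max (w x) (w y)"
  assume "\<not> w (x + y) \<le> max (w x) (w y)"
  then have less: "m < w (x + y)" by (simp add: m_def not_le)
  have w1: "w 1 = 1" using w(2)[of 1] by simp
  have w_pow: "w (u ^ n) = w u ^ n" for u n
    by (induction n) (auto simp: w1 w.av_mult)
  have w0: "w 0 = 0" by (simp add: w.av_eq_0_iff)
  have w_sum: "w (sum f S) \<le> (\<Sum>i\<in>S. w (f i))" for f and S :: "nat set"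
    by (induction S rule: infinite_finite_induct)
      (auto simp: w0 intro: order_trans[OF w.av_triangle])
  have m0: "0 < m"
  proof (rule ccontr)
    assume "\<not> 0 < m"
    then have "w x = 0" "w y = 0"
      using w.av_nonneg[of x] w.av_nonneg[of y] by (auto simp: m_def)
    then have "w (x + y) = 0" by (simp add: w.av_eq_0_iff)
    then show False
      using less w.av_nonneg[of x] by (auto simp: m_def)
  qed
  have bound: "w (x + y) ^ n \<le> (of_nat n + 1) * m ^ n" for n
  proof -
    have "w (x + y) ^ n = w (\<Sum>k\<le>n. of_nat (n choose k) * x ^ k * y ^ (n - k))"
      by (simp add: binomial_ring flip: w_pow)
    also have "\<dots> \<le> (\<Sum>k\<le>n. w (of_nat (n choose k) * x ^ k * y ^ (n - k)))"
      by (rule w_sum)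
    also have "\<dots> \<le> (\<Sum>k\<le>n. m ^ n)"
    proof (rule sum_mono)
      fix k assume "k \<in> {..n}"
      then have "m ^ n = 1 * m ^ k * m ^ (n - k)" by (simp flip: power_add)
      moreover have "w (of_nat (n choose k)) \<le> 1"
        using av_of_nat_le_1[of "n choose k"] w(2)[of "of_nat (n choose k)"] by simp
      then have "w (of_nat (n choose k)) * w x ^ k * w y ^ (n - k) \<le> 1 * m ^ k * m ^ (n - k)"
        using m0 by (intro mult_mono power_mono mult_nonneg_nonneg) (auto simp: m_def w.av_nonneg)
      ultimately show "w (of_nat (n choose k) * x ^ k * y ^ (n - k)) \<le> m ^ n"
        by (simp add: w.av_mult w_pow)
    qed
    finally show ?thesis by (simp add: algebra_simps)
  qed
  have "1 < w (x + y) / m" using less m0 by simp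
  then obtain n where "of_nat n + 1 < (w (x + y) / m) ^ n"
    using linear_le_power by blast
  then show False
    using bound[of n] m0 by (simp add: power_divide field_simps)
qed

text \<open>Any extension \<open>w\<close> is itself an ultrametric norm over the base field, scaled
  by \<open>w z\<close> under multiplication by \<open>z\<close>; so \<open>ac_abs_eqI\<close>
  identifies it.\<close>

lemma av_closure_eq: "av_closure av = ac_abs"
  unfolding av_closure_def
proof (rule the_equality)
  show "absolute_value ac_abs \<and> (\<forall>x. ac_abs (to_ac x) = av x)"
    by (simp add: absolute_value_ac_abs ac_abs_to_ac)
next
  fix w assume w: "absolute_value w \<and> (\<forall>x. w (to_ac x) = av x)"
  then interpret w: absolute_value w by simp
  have "ultrametric_norm av ac_scale w"
    using w extension_ultrametric[of w]
    by unfold_locales (auto simp: w.av_nonneg w.av_eq_0_iff w.av_mult)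
  then show "w = ac_abs"
    by (intro ext sym[OF ac_abs_eqI]) (auto simp: w.av_mult w.av_nonneg)
qed

lemma av_closure_small_root: "small b q \<Longrightarrow> ac_eval q z = 0 \<Longrightarrow> av_closure av z \<le> b"
  unfolding av_closure_eq using ac_norm_adapt2[of z z] small_root_bound[of _ "ac_abs z" z b q] by auto

lemma av_closure_large_root: "large b q \<Longrightarrow> ac_eval q z = 0 \<Longrightarrow> b \<le> av_closure av z"
  unfolding av_closure_eq
  using ac_norm_adapt2[of z z] large_root_bound[of _ z "ac_abs z" b q] ac_abs_nonneg[of z] by auto

end

section \<open>Eigenvalues on the tensor product\<close>

context
  fixes scl :: "'k::field \<Rightarrow> 'e::ab_group_add \<Rightarrow> 'e"
begin

text \<open>Equality of classes in the tensor product, kept as a congruence on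
  representatives.\<close>

definition tensor_eq ::
  "(('e \<times> 'k alg_closure) \<Rightarrow>\<^sub>0 int) \<Rightarrow> (('e \<times> 'k alg_closure) \<Rightarrow>\<^sub>0 int) \<Rightarrow> bool" (infix \<open>\<doteq>\<close> 50) where
  "s \<doteq> t \<longleftrightarrow> s - t \<in> tensor_relations scl"

lemma relations_minus: "s \<in> tensor_relations scl \<Longrightarrow> - s \<in> tensor_relations scl"
  using tensor_relations.diff[OF tensor_relations.zero, of s] by simp

lemma relations_add: "s \<in> tensor_relations scl \<Longrightarrow> t \<in> tensor_relations scl \<Longrightarrow> s + t \<in> tensor_relations scl"
  using tensor_relations.diff[OF _ relations_minus, of s t] by simp

lemma tensor_eq_refl [simp]: "t \<doteq> t"
  by (simp add: tensor_eq_def tensor_relations.zero)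

lemma tensor_eq_sym: "s \<doteq> t \<Longrightarrow> t \<doteq> s"
  unfolding tensor_eq_def using relations_minus[of "s - t"] by simp

lemma tensor_eq_trans [trans]: "s \<doteq> t \<Longrightarrow> t \<doteq> u \<Longrightarrow> s \<doteq> u"
  unfolding tensor_eq_def using relations_add[of "s - t" "t - u"] by simp

lemma tensor_eq_eq_trans [trans]: "s \<doteq> t \<Longrightarrow> t = u \<Longrightarrow> s \<doteq> u" "s = t \<Longrightarrow> t \<doteq> u \<Longrightarrow> s \<doteq> u"
  by simp_all

lemma tensor_eq_add: "s \<doteq> t \<Longrightarrow> s' \<doteq> t' \<Longrightarrow> s + s' \<doteq> t + t'"
  unfolding tensor_eq_def using relations_add[of "s - t" "s' - t'"] by (simp add: algebra_simps)

lemma tensor_eq_diff: "s \<doteq> t \<Longrightarrow> s' \<doteq> t' \<Longrightarrow> s - s' \<doteq> t - t'"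
  unfolding tensor_eq_def using tensor_relations.diff[of "s - t" scl "s' - t'"] by (simp add: algebra_simps)

lemma tensor_eq_sum: "(\<And>i. i \<in> S \<Longrightarrow> f i \<doteq> g i) \<Longrightarrow> sum f S \<doteq> sum g S"
  by (induction S rule: infinite_finite_induct) (auto intro: tensor_eq_add)

lemma tensor_eq_0: "t \<doteq> 0 \<longleftrightarrow> t \<in> tensor_relations scl"
  by (simp add: tensor_eq_def)

lemma pure_add_left: "frag_of (x + y, l) \<doteq> frag_of (x, l) + frag_of (y, l)"
  unfolding tensor_eq_def by (rule tensor_relations.add_left)

lemma pure_add_right: "frag_of (x, l + m) \<doteq> frag_of (x, l) + frag_of (x, m)"
  unfolding tensor_eq_def by (rule tensor_relations.add_right)

lemma pure_balanced: "frag_of (scl c x, l) \<doteq> frag_of (x, to_ac c * l)"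
  unfolding tensor_eq_def by (rule tensor_relations.balanced)

lemma pure_zero_left: "frag_of (0, l) \<doteq> 0"
  using pure_add_left[of 0 0 l] relations_minus by (fastforce simp: tensor_eq_def)

lemma pure_zero_right: "frag_of (x, 0) \<doteq> 0"
  using pure_add_right[of x 0 0] relations_minus by (fastforce simp: tensor_eq_def)

lemma pure_diff_right: "frag_of (x, l - m) \<doteq> frag_of (x, l) - frag_of (x, m)"
  using tensor_eq_diff[OF pure_add_right[of x "l - m" m] tensor_eq_refl[of "frag_of (x, m)"]]
  by (simp add: tensor_eq_sym)

lemma pure_sum_left: "frag_of (sum f S, l) \<doteq> (\<Sum>i\<in>S. frag_of (f i, l))"
proof (induction S rule: infinite_finite_induct)
  case (insert i S)
  then show ?case
    using tensor_eq_trans[OF pure_add_left tensor_eq_add[OF tensor_eq_refl insert.IH]] by simp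
qed (simp_all add: pure_zero_left)

text \<open>The universal property of the tensor product: a map on pairs that is biadditive and
  balanced up to the congruence descends to the quotient.\<close>

lemma frag_extend_tensor_eq:
  assumes "\<And>x y l. f (x + y, l) \<doteq> f (x, l) + f (y, l)"
    and "\<And>x l m. f (x, l + m) \<doteq> f (x, l) + f (x, m)"
    and "\<And>c x l. f (scl c x, l) \<doteq> f (x, to_ac c * l)"
    and "s \<doteq> t"
  shows "frag_extend f s \<doteq> frag_extend f t"
proof -
  have "frag_extend f r \<in> tensor_relations scl" if "r \<in> tensor_relations scl" for r
    using that
  proof (induction r)
    case zero
    then show ?case by (simp add: tensor_relations.zero)
  next
    case (diff s t)
    then show ?case by (simp add: frag_extend_diff tensor_relations.diff)
  qed (use assms(1-3) in \<open>simp_all add: frag_extend_diff frag_extend_add tensor_eq_def\<close>)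
  then show ?thesis
    using assms(4) by (simp add: tensor_eq_def flip: frag_extend_diff)
qed

lemma tensor_id_eq:
  assumes "Vector_Spaces.linear scl scl \<beta>" "s \<doteq> t"
  shows "tensor_id \<beta> s \<doteq> tensor_id \<beta> t"
proof -
  interpret Vector_Spaces.linear scl scl \<beta> by fact
  show ?thesis
    unfolding tensor_id_def using assms(2)
    by (rule frag_extend_tensor_eq[rotated 3])
      (simp_all add: add scale pure_add_left pure_add_right pure_balanced)
qed

lemma tensor_scale_eq: "s \<doteq> t \<Longrightarrow> tensor_scale m s \<doteq> tensor_scale m t"
  unfolding tensor_scale_def
  by (rule frag_extend_tensor_eq)
    (simp_all add: distrib_left mult.left_commute[of m] pure_add_left pure_add_right pure_balanced)

lemma frag_pair_induct:
  assumes "\<And>x l. P (frag_of (x, l))" "P 0" "\<And>a b. P a \<Longrightarrow> P b \<Longrightarrow> P (a - b)"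
  shows "P t"
  using subset_UNIV[of "Poly_Mapping.keys t"]
  by (induction t rule: frag_induction) (use assms in auto)

lemma tensor_scale_scale: "tensor_scale m (tensor_scale n t) = tensor_scale (m * n) t"
  by (induction t rule: frag_pair_induct) (auto simp: tensor_scale_def frag_extend_diff mult.assoc)

lemma tensor_scale_1: "tensor_scale 1 t = t"
  by (induction t rule: frag_pair_induct) (auto simp: tensor_scale_def frag_extend_diff)

lemma tensor_scale_add: "tensor_scale (m + n) t \<doteq> tensor_scale m t + tensor_scale n t"
proof (induction t rule: frag_pair_induct)
  case (3 a b)
  then show ?case
    using tensor_eq_diff[OF 3] by (simp add: tensor_scale_def frag_extend_diff algebra_simps)
qed (simp_all add: tensor_scale_def distrib_right pure_add_right)

lemma tensor_scale_zero: "tensor_scale 0 t \<doteq> 0"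
proof (induction t rule: frag_pair_induct)
  case (3 a b)
  then show ?case
    using tensor_eq_diff[OF 3] by (simp add: tensor_scale_def frag_extend_diff)
qed (simp_all add: tensor_scale_def pure_zero_right)

lemma tensor_id_scale: "tensor_id \<beta> (tensor_scale m t) = tensor_scale m (tensor_id \<beta> t)"
  by (induction t rule: frag_pair_induct) (auto simp: tensor_scale_def tensor_id_def frag_extend_diff)

lemma tensor_id_zero: "tensor_id (\<lambda>_. 0) t \<doteq> 0"
proof (induction t rule: frag_pair_induct)
  case (3 a b)
  then show ?case
    using tensor_eq_diff[OF 3] by (simp add: tensor_id_def frag_extend_diff)
qed (simp_all add: tensor_id_def pure_zero_left)

end

section \<open>Eigenvalues as roots of polynomials\<close>

context ultrametric_operator
begin

abbreviation teq (infix \<open>\<doteq>\<close> 50) where "teq \<equiv> tensor_eq scl"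

lemma tensor_id_pCons:
  "tensor_id (poly_op (Polynomial.pCons c q)) t \<doteq> tensor_scale (to_ac c) t + tensor_id \<alpha> (tensor_id (poly_op q) t)"
proof (induction t rule: frag_pair_induct)
  case (1 x l)
  have "frag_of (scl c x + \<alpha> (poly_op q x), l) \<doteq> frag_of (scl c x, l) + frag_of (\<alpha> (poly_op q x), l)"
    by (rule pure_add_left)
  also have "\<dots> \<doteq> frag_of (x, to_ac c * l) + frag_of (\<alpha> (poly_op q x), l)"
    by (intro tensor_eq_add pure_balanced tensor_eq_refl)
  finally show ?case
    by (simp add: tensor_id_def tensor_scale_def poly_op_pCons)
next
  case (3 a b)
  then show ?case
    using tensor_eq_diff[OF 3] by (simp add: tensor_id_def tensor_scale_def frag_extend_diff algebra_simps)
qed (simp add: tensor_id_def tensor_scale_def)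

text \<open>Induction along the Horner recursion of \<open>tensor_id_pCons\<close>; since
  \<open>tensor_id\<close> commutes with scalars, each step turns one \<alpha> into a factor
  \<open>m\<close>.\<close>

lemma tensor_id_poly_op:
  assumes "tensor_id \<alpha> t \<doteq> tensor_scale m t"
  shows "tensor_id (poly_op q) t \<doteq> tensor_scale (ac_eval q m) t"
proof (induction q)
  case 0
  have "poly_op 0 = (\<lambda>_. 0)" by auto
  then show ?case
    using tensor_eq_trans[OF tensor_id_zero tensor_eq_sym[OF tensor_scale_zero]] by simp
next
  case (pCons c q)
  let ?e = "ac_eval q m"
  have "tensor_id \<alpha> (tensor_id (poly_op q) t) \<doteq> tensor_scale ?e (tensor_id \<alpha> t)"
    using tensor_id_eq[OF linear_axioms pCons.IH] by (simp add: tensor_id_scale)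
  also have "\<dots> \<doteq> tensor_scale (?e * m) t"
    using tensor_scale_eq[OF assms, of ?e] by (simp add: tensor_scale_scale)
  finally have "tensor_scale (to_ac c) t + tensor_id \<alpha> (tensor_id (poly_op q) t)
      \<doteq> tensor_scale (to_ac c) t + tensor_scale (?e * m) t"
    by (intro tensor_eq_add tensor_eq_refl)
  then have "tensor_id (poly_op (Polynomial.pCons c q)) t \<doteq> tensor_scale (to_ac c) t + tensor_scale (?e * m) t"
    using tensor_eq_trans[OF tensor_id_pCons] by blast
  also have "\<dots> \<doteq> tensor_scale (to_ac c + ?e * m) t"
    by (rule tensor_eq_sym[OF tensor_scale_add])
  finally show ?case
    by (simp add: map_poly_pCons mult.commute)
qed

text \<open>If the value at \<open>m\<close> were nonzero, an invertible scalar would kill the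
  eigenvector, whose class would then vanish.\<close>

theorem eigenvalue_annihilating_poly:
  assumes "closure_eigenvalue scl \<alpha> m" "\<And>x. poly_op q x = 0"
  shows "ac_eval q m = 0"
proof (rule ccontr)
  assume nz: "ac_eval q m \<noteq> 0"
  obtain t where t: "t \<notin> tensor_relations scl" "tensor_id \<alpha> t \<doteq> tensor_scale m t"
    using assms(1) by (auto simp: closure_eigenvalue_def tensor_eq_def)
  have "poly_op q = (\<lambda>_. 0)"
    using assms(2) by auto
  then have "tensor_id (poly_op q) t \<doteq> 0"
    by (simp only: tensor_id_zero)
  then have "tensor_scale (ac_eval q m) t \<doteq> 0"
    by (rule tensor_eq_trans[OF tensor_eq_sym[OF tensor_id_poly_op[OF t(2)]]])
  then have "tensor_scale (inverse (ac_eval q m)) (tensor_scale (ac_eval q m) t)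
      \<doteq> tensor_scale (inverse (ac_eval q m)) 0"
    by (rule tensor_scale_eq)
  then have "t \<doteq> 0"
    using nz by (simp add: tensor_scale_scale tensor_scale_1) (simp add: tensor_scale_def)
  then show False
    using t(1) by (simp add: tensor_eq_0)
qed

text \<open>A linear functional \<open>\<psi>\<close> induces the map \<open>x \<otimes> l \<mapsto> \<psi>(x) l\<close>, which detects nonzero tensors.\<close>

lemma functional_vanishes_on_relations:
  fixes \<psi> :: "'e \<Rightarrow> 'k"
  assumes \<psi>: "\<And>x y. \<psi> (x + y) = \<psi> x + \<psi> y" "\<And>c x. \<psi> (scl c x) = c * \<psi> x"
  obtains \<Psi> :: "(('e \<times> 'k alg_closure) \<Rightarrow>\<^sub>0 int) \<Rightarrow> 'k alg_closure" where
    "\<And>x l. \<Psi> (frag_of (x, l)) = to_ac (\<psi> x) * l" "\<And>a b. \<Psi> (a + b) = \<Psi> a + \<Psi> b"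
    "\<And>t. t \<in> tensor_relations scl \<Longrightarrow> \<Psi> t = 0" "\<Psi> 0 = 0"
proof -
  let ?g = "\<lambda>(x, l). to_ac (\<psi> x) * l"
  define \<Psi> where "\<Psi> t = (\<Sum>k\<in>Poly_Mapping.keys t. of_int (poly_mapping.lookup t k) * ?g k)" for t
  have superset: "\<Psi> t = (\<Sum>k\<in>S. of_int (poly_mapping.lookup t k) * ?g k)"
    if "finite S" "Poly_Mapping.keys t \<subseteq> S" for t S
    unfolding \<Psi>_def using that by (intro sum.mono_neutral_left) (auto simp: in_keys_iff)
  have pure: "\<Psi> (frag_of (x, l)) = to_ac (\<psi> x) * l" for x l
    by (simp add: \<Psi>_def)
  have diff: "\<Psi> (a - b) = \<Psi> a - \<Psi> b" for a b
  proof -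
    let ?S = "Poly_Mapping.keys a \<union> Poly_Mapping.keys b"
    have "\<Psi> (a - b) = (\<Sum>k\<in>?S. of_int (poly_mapping.lookup (a - b) k) * ?g k)"
      by (rule superset) (auto simp: keys_diff)
    moreover have "\<Psi> a = (\<Sum>k\<in>?S. of_int (poly_mapping.lookup a k) * ?g k)"
      "\<Psi> b = (\<Sum>k\<in>?S. of_int (poly_mapping.lookup b k) * ?g k)"
      by (rule superset; auto)+
    ultimately show ?thesis
      by (simp add: lookup_minus left_diff_distrib sum_subtractf)
  qed
  have \<Psi>0: "\<Psi> 0 = 0" by (simp add: \<Psi>_def)
  have add: "\<Psi> (a + b) = \<Psi> a + \<Psi> b" for a b
    using diff[of a "- b"] diff[of 0 b] \<Psi>0 by simp
  have "\<Psi> t = 0" if "t \<in> tensor_relations scl" for t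
    using that
    by induction (simp_all add: diff add pure \<Psi>0 \<psi> algebra_simps)
  then show ?thesis
    using that[OF pure add _ \<Psi>0] by blast
qed

text \<open>Over the closure \<open>p\<close> becomes (X - m) s, and the eigenvector is s(\<alpha>)
  applied to x \<otimes> 1, since applying \<alpha> - m to it gives p(\<alpha>) x \<otimes> 1 = 0.
  Minimality makes the iterates of \<open>x\<close> independent, so that its class is
  nonzero.\<close>

theorem minimal_poly_root_eigenvalue:
  assumes p: "Polynomial.lead_coeff p = 1" "0 < Polynomial.degree p" "poly_op p x = 0"
    and min: "\<And>q. q \<noteq> 0 \<Longrightarrow> Polynomial.degree q < Polynomial.degree p \<Longrightarrow> poly_op q x \<noteq> 0"
    and root: "ac_eval p m = 0"
  shows "closure_eigenvalue scl \<alpha> m"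
proof -
  let ?d = "Polynomial.degree p" and ?v = "\<lambda>j. (\<alpha> ^^ j) x"
  have deg_P: "Polynomial.degree (map_poly to_ac p) = ?d"
    by (rule degree_map_poly) auto
  obtain s where s: "map_poly to_ac p = [:- m, 1:] * s"
    using root by (auto simp: poly_eq_0_iff_dvd dvd_def)
  have "map_poly to_ac p \<noteq> 0"
    using deg_P p(2) by auto
  then have "s \<noteq> 0" using s by auto
  then have "?d = Suc (Polynomial.degree s)"
    using deg_P unfolding s by (subst (asm) degree_mult_eq) auto
  have ps: "to_ac (Polynomial.coeff p j) = Polynomial.coeff (Polynomial.pCons 0 s) j - m * Polynomial.coeff s j" for j
  proof -
    have "to_ac (Polynomial.coeff p j) = Polynomial.coeff (map_poly to_ac p) j"
      by (simp add: coeff_map_poly)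
    then show ?thesis by (simp add: s)
  qed
  have s_top: "Polynomial.coeff s ?d = 0"
    using \<open>?d = Suc (Polynomial.degree s)\<close> by (intro coeff_eq_0) simp
  have s_lead: "Polynomial.coeff s (?d - 1) = 1"
    using ps[of ?d] s_top p(1,2) by (cases ?d) auto
  define t where "t = (\<Sum>j<?d. frag_of (?v j, Polynomial.coeff s j))"
  have "tensor_id \<alpha> t = (\<Sum>j<?d. frag_of (?v (Suc j), Polynomial.coeff s j))"
    unfolding t_def tensor_id_def by (subst frag_extend_sum) auto
  \<comment> \<open>A zero tensor is added for the constant coefficient 0 of
    \<open>pCons 0 s\<close>, so that this sum and the one for \<open>tensor_scale\<close> run over
    the same indices.\<close>
  also have "\<dots> \<doteq> (\<Sum>j<?d. frag_of (?v (Suc j), Polynomial.coeff s j)) + frag_of (x, 0)"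
    using tensor_eq_add[OF tensor_eq_refl tensor_eq_sym[OF pure_zero_right]] by fastforce
  also have "\<dots> = (\<Sum>j\<le>?d. frag_of (?v j, Polynomial.coeff (Polynomial.pCons 0 s) j))"
    by (simp add: sum.atMost_shift add.commute)
  finally have id_t: "tensor_id \<alpha> t \<doteq> (\<Sum>j\<le>?d. frag_of (?v j, Polynomial.coeff (Polynomial.pCons 0 s) j))" .
  have "tensor_scale m t = (\<Sum>j<?d. frag_of (?v j, m * Polynomial.coeff s j))"
    unfolding t_def tensor_scale_def by (subst frag_extend_sum) auto
  also have "\<dots> \<doteq> (\<Sum>j<?d. frag_of (?v j, m * Polynomial.coeff s j)) + frag_of (?v ?d, 0)"
    using tensor_eq_add[OF tensor_eq_refl tensor_eq_sym[OF pure_zero_right]] by fastforce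
  also have "\<dots> = (\<Sum>j\<le>?d. frag_of (?v j, m * Polynomial.coeff s j))"
    using s_top by (simp flip: lessThan_Suc_atMost)
  finally have scale_t: "tensor_scale m t \<doteq> (\<Sum>j\<le>?d. frag_of (?v j, m * Polynomial.coeff s j))" .
  have "tensor_id \<alpha> t - tensor_scale m t \<doteq>
      (\<Sum>j\<le>?d. frag_of (?v j, Polynomial.coeff (Polynomial.pCons 0 s) j)) - (\<Sum>j\<le>?d. frag_of (?v j, m * Polynomial.coeff s j))"
    by (rule tensor_eq_diff[OF id_t scale_t])
  also have "\<dots> = (\<Sum>j\<le>?d. frag_of (?v j, Polynomial.coeff (Polynomial.pCons 0 s) j) - frag_of (?v j, m * Polynomial.coeff s j))"
    by (simp only: sum_subtractf)
  also have "\<dots> \<doteq> (\<Sum>j\<le>?d. frag_of (?v j, to_ac (Polynomial.coeff p j) * 1))"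
    unfolding ps mult_1_right by (intro tensor_eq_sum tensor_eq_sym[OF pure_diff_right])
  also have "\<dots> \<doteq> (\<Sum>j\<le>?d. frag_of (scl (Polynomial.coeff p j) (?v j), 1))"
    by (intro tensor_eq_sum tensor_eq_sym[OF pure_balanced])
  also have "\<dots> \<doteq> frag_of (poly_op p x, 1)"
    unfolding poly_op_def by (rule tensor_eq_sym[OF pure_sum_left])
  also have "\<dots> \<doteq> 0"
    unfolding p(3) by (rule pure_zero_left)
  finally have eig: "tensor_id \<alpha> t - tensor_scale m t \<in> tensor_relations scl"
    by (simp only: tensor_eq_0)
  have inj: "inj_on ?v {..<?d}" and ind: "vs1.independent (?v ` {..<?d})"
    using krylov_independent[of ?d x] min by auto
  define B where "B = vs1.extend_basis (?v ` {..<?d})"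
  have B: "vs1.independent B" "vs1.span B = UNIV" "?v ` {..<?d} \<subseteq> B"
    unfolding B_def using ind
    by (auto simp: vs1.independent_extend_basis vs1.span_extend_basis intro: subsetD[OF vs1.extend_basis_superset])
  \<comment> \<open>The coordinate of the last iterate; on \<open>t\<close> it returns the leading
    coefficient 1 of \<open>s\<close>.\<close>
  define \<psi> where "\<psi> y = vs1.representation B y (?v (?d - 1))" for y
  have \<psi>_v: "\<psi> (?v j) = (if j = ?d - 1 then 1 else 0)" if "j < ?d" for j
  proof -
    have "?v j \<in> B" using B(3) that by auto
    then show ?thesis
      using that p(2) inj_onD[OF inj, of j "?d - 1"]
      by (auto simp: \<psi>_def vs1.representation_basis[OF B(1)])
  qed
  obtain \<Psi> :: "(('e \<times> 'k alg_closure) \<Rightarrow>\<^sub>0 int) \<Rightarrow> 'k alg_closure" where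
    \<Psi>: "\<And>x l. \<Psi> (frag_of (x, l)) = to_ac (\<psi> x) * l" "\<And>a b. \<Psi> (a + b) = \<Psi> a + \<Psi> b"
      "\<And>t. t \<in> tensor_relations scl \<Longrightarrow> \<Psi> t = 0" "\<Psi> 0 = 0"
    by (rule functional_vanishes_on_relations[of \<psi>])
      (use B in \<open>auto simp: \<psi>_def vs1.representation_add vs1.representation_scale\<close>)
  have "\<Psi> (sum f S) = (\<Sum>j\<in>S. \<Psi> (f j))" for f and S :: "nat set"
    by (induction S rule: infinite_finite_induct) (auto simp: \<Psi>)
  then have "\<Psi> t = (\<Sum>j<?d. to_ac (\<psi> (?v j)) * Polynomial.coeff s j)"
    by (simp add: t_def \<Psi>(1))
  also have "\<dots> = (\<Sum>j<?d. if j = ?d - 1 then Polynomial.coeff s j else 0)"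
    by (rule sum.cong) (simp_all add: \<psi>_v)
  also have "\<dots> = 1"
    using p(2) s_lead by simp
  finally have "t \<notin> tensor_relations scl"
    using \<Psi>(3)[of t] by auto
  then show ?thesis
    using eig by (auto simp: closure_eigenvalue_def)
qed

text \<open>The degree is minimized over a monic polynomial and a nonzero vector of \<open>F\<close>
  jointly, so that a factorization may be exploited by changing the vector. A minimal
  \<open>p\<close> is flat, the comparison of rates forces its radius to be \<open>a\<close>, and a
  root of it is an eigenvalue of absolute value \<open>a\<close>.\<close>

lemma eigenvalue_of_isometric_part:
  assumes a: "0 < a" and N: "ultrametric_norm av scl N"
    and F: "invariant_subspace scl \<alpha> F" "F \<noteq> {0}" "\<And>x. x \<in> F \<Longrightarrow> N (\<alpha> x) = a * N x"
    and q: "Polynomial.lead_coeff q = 1" "\<And>x. poly_op q x = 0"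
  shows "a \<in> R_set av scl \<alpha>"
proof -
  interpret N: ultrametric_norm av scl N by (rule N)
  let ?P = "\<lambda>p. Polynomial.lead_coeff p = 1 \<and> (\<exists>x\<in>F. x \<noteq> 0 \<and> poly_op p x = 0)"
  have "0 \<in> F"
    using F(1) by (auto simp: invariant_subspace_def vs1.subspace_0)
  then have "?P q" using F(2) q by auto
  then obtain p where p: "?P p" and min: "\<And>q. ?P q \<Longrightarrow> Polynomial.degree p \<le> Polynomial.degree q"
    using ex_has_least_nat[of ?P _ Polynomial.degree] by blast
  then obtain x where x: "x \<in> F" "x \<noteq> 0" "poly_op p x = 0" by blast
  have deg: "0 < Polynomial.degree p"
  proof (rule ccontr)
    assume "\<not> 0 < Polynomial.degree p"
    then have "p = 1" using p by (metis degree_0_id one_pCons gr0I)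
    then show False using x by simp
  qed
  \<comment> \<open>If X divided \<open>p\<close>, then \<alpha> would kill
    \<open>poly_op p' x\<close>; exact scaling by \<open>a > 0\<close> makes this vector 0, and
    \<open>p'\<close> contradicts minimality.\<close>
  have c0: "Polynomial.coeff p 0 \<noteq> 0"
  proof
    assume "Polynomial.coeff p 0 = 0"
    then obtain p' where p': "p = Polynomial.pCons 0 p'" by (cases p) auto
    then have "p' \<noteq> 0" using deg by auto
    then have p'_lead: "Polynomial.lead_coeff p' = 1" "Polynomial.degree p = Suc (Polynomial.degree p')"
      using p by (auto simp: p')
    have y: "poly_op p' x \<in> F"
      by (rule invariant_poly_op[OF F(1) x(1)])
    have "\<alpha> (poly_op p' x) = 0"
      using x(3) by (simp add: p' poly_op_pCons)
    then have "N (poly_op p' x) = 0"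
      using F(3)[OF y] a by simp
    then have "poly_op p' x = 0" by (simp add: N.N_eq_0_iff)
    then show False
      using min[of p'] p'_lead x by auto
  qed
  have irr: "\<not> (\<exists>g h. p = g * h \<and> Polynomial.lead_coeff g = 1 \<and> Polynomial.lead_coeff h = 1 \<and>
      0 < Polynomial.degree g \<and> 0 < Polynomial.degree h)"
  proof
    assume "\<exists>g h. p = g * h \<and> Polynomial.lead_coeff g = 1 \<and> Polynomial.lead_coeff h = 1 \<and>
      0 < Polynomial.degree g \<and> 0 < Polynomial.degree h"
    then obtain g h where gh: "p = g * h" "Polynomial.lead_coeff g = 1" "Polynomial.lead_coeff h = 1"
      "0 < Polynomial.degree g" "0 < Polynomial.degree h" by blast
    then have d: "Polynomial.degree p = Polynomial.degree g + Polynomial.degree h"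
      by (metis degree_0 degree_mult_eq less_irrefl)
    \<comment> \<open>Either \<open>h\<close> already annihilates \<open>x\<close>, or
      \<open>poly_op h x\<close> is a nonzero vector of \<open>F\<close> annihilated by
      \<open>g\<close>.\<close>
    have "?P h \<or> ?P g"
      using x invariant_poly_op[OF F(1) x(1), of h] gh by (metis poly_op_mult)
    then show False
      using min[of g] min[of h] gh d by auto
  qed
  obtain r where r: "flat r p"
    using flat_or_reducible[OF _ deg c0] p irr by blast
  have x_pow: "N (\<alpha> ((\<alpha> ^^ i) x)) = a * N ((\<alpha> ^^ i) x)" for i
    using F(3) invariant_funpow[OF F(1) x(1)] by blast
  have "\<not> r < a"
    using small_expanding_imp_0[OF N, of r p x a] r x x_pow by (auto simp: flat_iff)
  moreover have "\<not> a < r"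
    using large_contracting_imp_0[OF N, of r p x a] r x x_pow a by (auto simp: flat_iff)
  ultimately have "r = a" by simp
  have "Polynomial.degree (map_poly to_ac p) = Polynomial.degree p"
    by (rule degree_map_poly) auto
  then obtain m where m: "ac_eval p m = 0"
    using alg_closed_imp_poly_has_root[of "map_poly to_ac p"] deg by auto
  have "av_closure av m = a"
    using av_closure_small_root[of a p m] av_closure_large_root[of a p m] r m \<open>r = a\<close>
    by (auto simp: flat_iff)
  moreover have "closure_eigenvalue scl \<alpha> m"
  proof (rule minimal_poly_root_eigenvalue[OF _ deg x(3) _ m])
    fix q :: "'k poly" assume q: "q \<noteq> 0" "Polynomial.degree q < Polynomial.degree p"
    show "poly_op q x \<noteq> 0"
    proof
      assume "poly_op q x = 0"
      then have "?P (Polynomial.smult (inverse (Polynomial.lead_coeff q)) q)"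
        using q(1) x by (auto simp: poly_op_smult)
      then show False
        using min q by fastforce
    qed
  qed (use p in simp)
  ultimately show ?thesis
    unfolding R_set_def by blast
qed

end

text \<open>The flat factor \<open>g\<close> of an annihilating polynomial acts injectively, since
  its kernel splits along \<open>S\<close> and \<open>U\<close>, where the rates exclude radius
  \<open>a\<close>. So \<open>f * h\<close> already annihilates the space, and its roots have
  absolute value different from \<open>a\<close>.\<close>

lemma (in fin_dim_ultrametric_operator) no_eigenvalue_of_hyperbolic:
  assumes a: "0 < a" and N: "ultrametric_norm av scl N"
    and S: "invariant_subspace scl \<alpha> S" "0 \<le> b" "b < a" "\<And>x. x \<in> S \<Longrightarrow> N (\<alpha> x) \<le> b * N x"
    and U: "invariant_subspace scl \<alpha> U" "a < c" "\<And>x. x \<in> U \<Longrightarrow> c * N x \<le> N (\<alpha> x)"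
    and sum: "direct_sum2 S U"
  shows "a \<notin> R_set av scl \<alpha>"
proof
  assume "a \<in> R_set av scl \<alpha>"
  then obtain m where m: "closure_eigenvalue scl \<alpha> m" "av_closure av m = a"
    by (auto simp: R_set_def)
  obtain q where q: "Polynomial.lead_coeff q = 1" "\<And>x. poly_op q x = 0"
    using annihilating_poly by blast
  obtain f g h b' c' where fgh: "q = f * g * h" "b' < a" "a < c'" "small b' f" "flat a g" "large c' h"
    using slope_factorization[OF a q(1)] by blast
  have inj: "inj_on (\<lambda>(x, y). x + y) (S \<times> U)" and surj: "(\<lambda>(x, y). x + y) ` (S \<times> U) = UNIV"
    using sum by (auto simp: direct_sum2_def bij_betw_def)
  have zero: "0 \<in> S" "0 \<in> U"
    using S(1) U(1) by (auto simp: invariant_subspace_def vs1.subspace_0)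
  have g_inj: "z = 0" if z: "poly_op g z = 0" for z
  proof -
    have "z \<in> (\<lambda>(x, y). x + y) ` (S \<times> U)" using surj by simp
    then obtain x y where xy: "x \<in> S" "y \<in> U" "z = x + y" by auto
    have "poly_op g x + poly_op g y = 0 + 0"
      using z by (simp add: xy poly_op_vec_add)
    then have g0: "poly_op g x = 0" "poly_op g y = 0"
      using inj_onD[OF inj, of "(poly_op g x, poly_op g y)" "(0, 0)"] zero
        invariant_poly_op[OF S(1) xy(1)] invariant_poly_op[OF U(1) xy(2)] by auto
    have "x = 0"
      using large_contracting_imp_0[OF N _ g0(1) S(2,3)] fgh(5) S(4) invariant_funpow[OF S(1) xy(1)]
      by (auto simp: flat_iff)
    moreover have "y = 0"
      using small_expanding_imp_0[OF N _ g0(2) U(2)] fgh(5) U(3) invariant_funpow[OF U(1) xy(2)]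
      by (auto simp: flat_iff)
    ultimately show ?thesis using xy(3) by simp
  qed
  have "poly_op (f * h) x = 0" for x
  proof (rule g_inj)
    have "g * (f * h) = q" by (simp add: fgh(1))
    then show "poly_op g (poly_op (f * h) x) = 0"
      using q(2)[of x] by (simp flip: poly_op_mult)
  qed
  then have "ac_eval f m = 0 \<or> ac_eval h m = 0"
    using eigenvalue_annihilating_poly[OF m(1), of "f * h"] by (simp add: ac_eval_mult)
  then show False
    using av_closure_small_root[OF fgh(4), of m] av_closure_large_root[OF fgh(6), of m] m(2) fgh(2,3) by auto
qed

section \<open>Operator norms and hyperbolicity\<close>

context ultrametric_norm
begin

lemma N_pos: "x \<noteq> 0 \<Longrightarrow> 0 < N x"
  using N_nonneg[of x] N_eq_0_iff[of x] by linarith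

lemma op_norm_leI:
  assumes "\<And>x. x \<in> F \<Longrightarrow> N (f x) \<le> b * N x"
  shows "op_norm N F f \<le> ennreal b"
  unfolding op_norm_def
proof (rule SUP_least)
  fix x assume "x \<in> F - {0}"
  then show "ennreal (N (f x) / N x) \<le> ennreal b"
    using assms[of x] N_pos[of x] by (intro ennreal_leI) (simp add: field_simps)
qed

lemma op_norm_leD:
  assumes "op_norm N F f \<le> ennreal b" "0 \<le> b" "x \<in> F" "x \<noteq> 0"
  shows "N (f x) \<le> b * N x"
proof -
  have "ennreal (N (f x) / N x) \<le> op_norm N F f"
    unfolding op_norm_def using assms(3,4) by (intro SUP_upper) auto
  then have "ennreal (N (f x) / N x) \<le> ennreal b"
    using assms(1) by (rule order_trans)
  then show ?thesis
    using assms(2) N_pos[OF assms(4)] by (simp add: ennreal_le_iff field_simps)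
qed

lemma inverse_op_norm_gtI:
  assumes "bij_betw f F F" "0 \<le> a" "a < c" "\<And>x. x \<in> F \<Longrightarrow> c * N x \<le> N (f x)"
  shows "1 / op_norm N F (inv_into F f) > ennreal a"
proof -
  have "op_norm N F (inv_into F f) \<le> ennreal (1 / c)"
  proof (rule op_norm_leI)
    fix y assume y: "y \<in> F"
    then have "f (inv_into F f y) = y" "inv_into F f y \<in> F"
      using assms(1) by (auto simp: bij_betw_def f_inv_into_f inv_into_into)
    then have "c * N (inv_into F f y) \<le> N y"
      using assms(4)[of "inv_into F f y"] by simp
    then show "N (inv_into F f y) \<le> 1 / c * N y"
      using assms(2,3) by (simp add: field_simps)
  qed
  then obtain s where s: "0 \<le> s" "s \<le> 1 / c" "op_norm N F (inv_into F f) = ennreal s"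
    using assms(2,3) by (cases "op_norm N F (inv_into F f)") (auto simp: ennreal_le_iff top_unique)
  show ?thesis
  proof (cases "s = 0")
    \<comment> \<open>This includes \<open>F = {0}\<close>, where the operator norm is an empty
      supremum and \<open>1 / 0 = \<infinity>\<close>.\<close>
    case True
    then show ?thesis using s(3) by (simp add: ennreal_divide_zero)
  next
    case False
    then have "1 / ennreal s = ennreal (1 / s)"
      using s(1) divide_ennreal[of 1 s] by simp
    moreover have "a < 1 / s"
    proof -
      have "a * s < c * s"
        using False s(1) assms(3) by (intro mult_strict_right_mono) auto
      also have "\<dots> \<le> 1"
        using s(2) assms(2,3) by (simp add: field_simps)
      finally show ?thesis
        using False s(1) by (simp add: field_simps)
    qed
    ultimately show ?thesis
      using s(3) assms(2) by (simp add: ennreal_less_iff)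
  qed
qed

text \<open>The strict inequality makes the norm of the inverse a finite real \<open>s\<close>, and
  for \<open>s \<noteq> 0\<close> the constant \<open>1 / s\<close> exceeds
  \<open>a\<close>.\<close>

lemma inverse_op_norm_gtD:
  assumes "bij_betw f F F" "0 \<le> a" "1 / op_norm N F (inv_into F f) > ennreal a" "0 \<in> F" "f 0 = 0"
  shows "\<exists>c>a. \<forall>x\<in>F. c * N x \<le> N (f x)"
proof -
  have "op_norm N F (inv_into F f) \<noteq> \<infinity>"
    using assms(3) by (auto simp: ennreal_divide_top)
  then obtain s where s: "0 \<le> s" "op_norm N F (inv_into F f) = ennreal s"
    by (cases "op_norm N F (inv_into F f)") auto
  have bound: "N x \<le> s * N (f x)" if "x \<in> F" for x
  proof (cases "f x = 0")
    case True
    then have "x = 0"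
      using assms(1,4,5) that by (metis bij_betw_def inj_onD)
    then show ?thesis using assms(5) by (simp add: N_eq_0_iff)
  next
    case False
    have "f x \<in> F" "inv_into F f (f x) = x"
      using assms(1) that by (auto simp: bij_betw_def)
    then show ?thesis
      using op_norm_leD[of F "inv_into F f" s "f x"] s False by simp
  qed
  show ?thesis
  proof (cases "s = 0")
    case True
    then have "N x = 0" if "x \<in> F" for x
      using bound[OF that] N_nonneg[of x] by simp
    \<comment> \<open>All of \<open>F\<close> is zero here, so any constant above \<open>a\<close>
      will do.\<close>
    then show ?thesis
      using N_nonneg by (intro exI[of _ "a + 1"]) auto
  next
    case False
    then have "1 / ennreal s = ennreal (1 / s)"
      using s(1) divide_ennreal[of 1 s] by simp
    then have "a < 1 / s"
      using assms(2,3) s by (simp add: ennreal_less_iff)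
    moreover have "1 / s * N x \<le> N (f x)" if "x \<in> F" for x
      using bound[OF that] False s(1) by (simp add: field_simps)
    ultimately show ?thesis by blast
  qed
qed

end

section \<open>Invariant subspaces and the eigenvalue criterion\<close>

context fin_dim_ultrametric_operator
begin

lemma bij_betw_expanding:
  assumes N: "ultrametric_norm av scl N" and U: "invariant_subspace scl \<alpha> U"
    and exp: "0 < c" "\<And>x. x \<in> U \<Longrightarrow> c * N x \<le> N (\<alpha> x)"
  shows "bij_betw \<alpha> U U"
proof -
  interpret N: ultrametric_norm av scl N by (rule N)
  have sub: "vs1.subspace U" "\<alpha> ` U \<subseteq> U"
    using U by (auto simp: invariant_subspace_def)
  have inj: "inj_on \<alpha> U"
  proof (rule inj_onI)
    fix x y assume *: "x \<in> U" "y \<in> U" "\<alpha> x = \<alpha> y"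
    have "c * N (x - y) \<le> N (\<alpha> (x - y))"
      using * sub(1) by (intro exp(2) vs1.subspace_diff)
    also have "\<dots> = 0"
      using *(3) by (simp add: diff N.N_eq_0_iff)
    finally have "N (x - y) = 0"
      using exp(1) N.N_nonneg[of "x - y"] by (simp add: mult_le_0_iff)
    then show "x = y" by (simp add: N.N_eq_0_iff)
  qed
  then show ?thesis
    using fd.linear_inj_on_imp_surj_on[OF linear_axioms sub inj] by (simp add: bij_betw_def)
qed

text \<open>One splitting serves all three claims: \<open>Ec\<close> is the centre subspace, the sum
  of \<open>Es\<close> and \<open>Ec\<close> is the centre-stable one, and if \<open>a\<close> is
  not in \<open>R_set av scl \<alpha>\<close> then \<open>Ec = {0}\<close>, so that
  \<open>Es\<close> and \<open>Eu\<close> already fill the space.\<close>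

lemma centre_subspace_exists:
  assumes a: "0 < a"
  shows "(\<exists>F. centre_stable_subspace av scl \<alpha> a F) \<and> (\<exists>F. centre_subspace av scl \<alpha> a F) \<and>
    (a \<notin> R_set av scl \<alpha> \<longrightarrow> hyperbolic av scl \<alpha> a)"
proof -
  obtain Es Ec Eu N b c where
    inv: "invariant_subspace scl \<alpha> Es" "invariant_subspace scl \<alpha> Ec" "invariant_subspace scl \<alpha> Eu"
    and sum: "direct_sum3 Es Ec Eu" and N: "ultrametric_norm av scl N"
    and max: "\<And>x y z. x \<in> Es \<Longrightarrow> y \<in> Ec \<Longrightarrow> z \<in> Eu \<Longrightarrow> N (x + y + z) = max (N x) (max (N y) (N z))"
    and bc: "0 < b" "b < a" "a < c"
    and Es: "\<And>x. x \<in> Es \<Longrightarrow> N (\<alpha> x) \<le> b * N x"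
    and Ec: "\<And>x. x \<in> Ec \<Longrightarrow> N (\<alpha> x) = a * N x"
    and Eu: "\<And>x. x \<in> Eu \<Longrightarrow> c * N x \<le> N (\<alpha> x)"
    using spectral_splitting[OF a] by blast
  interpret N: ultrametric_norm av scl N by (rule N)
  have def_N: "defining_norm av scl N"
    using defining_norm_iff[OF complete_ultrametric_field_axioms fd.finite_dimensional_vector_space_axioms] N
    by blast
  have zero: "0 \<in> Es" "0 \<in> Ec" "0 \<in> Eu"
    using inv by (auto simp: invariant_subspace_def vs1.subspace_0)
  have bij: "bij_betw \<alpha> Eu Eu"
    by (rule bij_betw_expanding[OF N inv(3) _ Eu]) (use bc in simp)
  have op_u: "1 / op_norm N Eu (inv_into Eu \<alpha>) > ennreal a"
    by (rule N.inverse_op_norm_gtI[OF bij _ bc(3) Eu]) (use a in simp)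
  have "op_norm N Es \<alpha> \<le> ennreal b"
    by (rule N.op_norm_leI[OF Es])
  also have "ennreal b < ennreal a"
    using bc by (simp add: ennreal_less_iff)
  finally have op_s: "op_norm N Es \<alpha> < ennreal a" .
  have "centre_subspace av scl \<alpha> a Ec"
    unfolding centre_subspace_def using inv sum def_N max Ec bij op_s op_u by blast
  moreover have "centre_stable_subspace av scl \<alpha> a {x + y | x y. x \<in> Es \<and> y \<in> Ec}"
    (is "centre_stable_subspace _ _ _ _ ?F")
  proof -
    have maxF: "N (x + y) = max (N x) (N y)" if "x \<in> Es" "y \<in> Ec" for x y
      using max[OF that zero(3)] N.N_nonneg[of y] by (simp add: max_absorb1)
    have "vs1.subspace ?F"
      using inv by (intro vs1.subspace_sums) (auto simp: invariant_subspace_def)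
    moreover have "\<alpha> ` ?F \<subseteq> ?F"
      using inv by (auto simp: invariant_subspace_def add) blast
    ultimately have "invariant_subspace scl \<alpha> ?F"
      by (simp add: invariant_subspace_def)
    moreover have "direct_sum2 ?F Eu"
      unfolding direct_sum2_def bij_betw_def
    proof
      show "inj_on (\<lambda>(x, y). x + y) (?F \<times> Eu)"
        by (rule inj_onI) (auto dest: direct_sum3D(2)[OF sum])
      have "v \<in> (\<lambda>(x, y). x + y) ` (?F \<times> Eu)" for v
      proof -
        obtain x y z where "x \<in> Es" "y \<in> Ec" "z \<in> Eu" "v = x + y + z"
          using direct_sum3D(1)[OF sum, of v] by blast
        then show ?thesis
          by (intro image_eqI[of _ _ "(x + y, z)"]) auto
      qed
      then show "(\<lambda>(x, y). x + y) ` (?F \<times> Eu) = UNIV"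
        by blast
    qed
    moreover have "\<forall>x\<in>?F. \<forall>z\<in>Eu. N (x + z) = Orderings.max (N x) (N z)"
      using max maxF by (auto simp: max.assoc)
    moreover have "op_norm N ?F \<alpha> \<le> ennreal a"
    proof (rule N.op_norm_leI)
      fix v assume "v \<in> ?F"
      then obtain x y where xy: "x \<in> Es" "y \<in> Ec" "v = x + y" by blast
      then have "\<alpha> x \<in> Es" "\<alpha> y \<in> Ec"
        using inv by (auto simp: invariant_subspace_def)
      then have "N (\<alpha> v) = Orderings.max (N (\<alpha> x)) (N (\<alpha> y))"
        by (simp add: xy add maxF)
      also have "\<dots> \<le> Orderings.max (a * N x) (a * N y)"
        using Es[OF xy(1)] Ec[OF xy(2)] bc N.N_nonneg[of x] mult_right_mono[of b a "N x"]
        by (intro max.mono) auto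
      also have "\<dots> = a * N v"
        using xy a by (simp add: maxF max_mult_distrib_left)
      finally show "N (\<alpha> v) \<le> a * N v" .
    qed
    ultimately show ?thesis
      unfolding centre_stable_subspace_def using inv(3) bij def_N op_u by blast
  qed
  moreover have "hyperbolic av scl \<alpha> a" if "a \<notin> R_set av scl \<alpha>"
  proof -
    obtain q where q: "Polynomial.lead_coeff q = 1" "\<And>x. poly_op q x = 0"
      using annihilating_poly by blast
    have Ec0: "Ec = {0}"
      using eigenvalue_of_isometric_part[OF a N inv(2) _ Ec q] that by blast
    have "direct_sum2 Es Eu"
      unfolding direct_sum2_def bij_betw_def
    proof
      show "inj_on (\<lambda>(x, y). x + y) (Es \<times> Eu)"
        using direct_sum3D(2)[OF sum, of _ 0 _ _ 0] zero by (intro inj_onI) auto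
      have "v \<in> (\<lambda>(x, y). x + y) ` (Es \<times> Eu)" for v
      proof -
        obtain x z where "x \<in> Es" "z \<in> Eu" "v = x + 0 + z"
          using direct_sum3D(1)[OF sum, of v] Ec0 by blast
        then show ?thesis
          by (intro image_eqI[of _ _ "(x, z)"]) auto
      qed
      then show "(\<lambda>(x, y). x + y) ` (Es \<times> Eu) = UNIV"
        by blast
    qed
    moreover have "\<forall>x\<in>Es. \<forall>z\<in>Eu. N (x + z) = Orderings.max (N x) (N z)"
      using max[OF _ zero(2)] N.N_nonneg by (auto simp: max_absorb2)
    ultimately show ?thesis
      unfolding hyperbolic_def using inv def_N bij op_s op_u by blast
  qed
  ultimately show ?thesis by blast
qed

text \<open>The two operator norm conditions are converted into uniform rates
  \<open>b < a < c\<close>, the form that \<open>no_eigenvalue_of_hyperbolic\<close>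
  requires.\<close>

lemma hyperbolic_imp_notin_R_set:
  assumes a: "0 < a" and hyp: "hyperbolic av scl \<alpha> a"
  shows "a \<notin> R_set av scl \<alpha>"
proof -
  obtain Es Eu N where
    inv: "invariant_subspace scl \<alpha> Es" "invariant_subspace scl \<alpha> Eu"
    and sum: "direct_sum2 Es Eu" and def_N: "defining_norm av scl N"
    and bij: "bij_betw \<alpha> Eu Eu"
    and op_s: "op_norm N Es \<alpha> < ennreal a"
    and op_u: "1 / op_norm N Eu (inv_into Eu \<alpha>) > ennreal a"
    using hyp unfolding hyperbolic_def by blast
  have N: "ultrametric_norm av scl N"
    using def_N by (simp add: defining_norm_def)
  interpret N: ultrametric_norm av scl N by (rule N)
  obtain b where b: "0 \<le> b" "op_norm N Es \<alpha> = ennreal b"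
    using op_s by (cases "op_norm N Es \<alpha>") auto
  have "b < a"
    using op_s b by (simp add: ennreal_less_iff)
  have contr: "N (\<alpha> x) \<le> b * N x" if "x \<in> Es" for x
    using N.op_norm_leD[of Es \<alpha> b x] b that by (cases "x = 0") (auto simp: zero N.N_eq_0_iff)
  have "0 \<in> Eu"
    using inv(2) by (auto simp: invariant_subspace_def vs1.subspace_0)
  then obtain c where c: "a < c" "\<And>x. x \<in> Eu \<Longrightarrow> c * N x \<le> N (\<alpha> x)"
    using N.inverse_op_norm_gtD[OF bij _ op_u] a zero by auto
  show ?thesis
    by (rule no_eigenvalue_of_hyperbolic[OF a N inv(1) b(1) \<open>b < a\<close> contr inv(2) c sum])
qed

end

theorem theoremA:
  fixes av :: "'k::field \<Rightarrow> real"
    and scl :: "'k \<Rightarrow> 'e::ab_group_add \<Rightarrow> 'e"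
    and \<alpha> :: "'e \<Rightarrow> 'e"
  assumes "complete_ultrametric_field av"
    and "\<exists>Basis. finite_dimensional_vector_space scl Basis"
    and "Vector_Spaces.linear scl scl \<alpha>"
  shows "(\<forall>a>0. (\<exists>F. centre_stable_subspace av scl \<alpha> a F) \<and>
                (\<exists>F. centre_subspace av scl \<alpha> a F)) \<and>
         (\<forall>a>0. hyperbolic av scl \<alpha> a \<longleftrightarrow> a \<notin> R_set av scl \<alpha>)"
proof -
  obtain Basis where "finite_dimensional_vector_space scl Basis"
    using assms(2) by blast
  then interpret fin_dim_ultrametric_operator av scl \<alpha> Basis
    using assms(1,3) by (simp add: fin_dim_ultrametric_operator_def ultrametric_operator_def)
  show ?thesis
    using centre_subspace_exists hyperbolic_imp_notin_R_set by blast
qed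

end
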